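(* Let $m\ge 1$, and for each $1\le j\le m$ let $1\le p_j\le q_j<\infty$ be real numbers and let $X_j$ be a $p_j$-convex Banach function lattice (with $p_j$-convexity constant $1$). Define $q$ by $1/q=1/q_1+\cdots+1/q_m$. Let $Y$ be a Banach space and let $T\colon X_1\times\cdots\times X_m\to Y$ be a multilinear operator. Then the following statements are equivalent. (i) $T$ is $(p_1,\ldots,p_m)$-strongly $(q_1,\ldots,q_m)$-concave. (ii) There are regular Borel probability measures $\nu_j$ on $B^{+}_{((X_j)_{p_j})^*}$, $1\le j\le m$, and a bounded multilinear operator $$S\colon \widetilde F^{q_1}_{(X_1)_{p_1}}(\nu_1)\times\cdots\times\widetilde F^{q_m}_{(X_m)_{p_m}}(\nu_m)\to Y$$ such that $T=S\circ(\iota_{X_1}\times\cdots\times\iota_{X_m})$, i.e. $T(x_1,\ldots,x_m)=S(\iota_{X_1}(x_1),\ldots,\iota_{X_m}(x_m))$ for all $x_j\in X_j$.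
   Context: A Banach function lattice on a $\sigma$-finite measure space $(\Omega,\Sigma,\mu)$ is a Banach space $X\subset L^0(\mu)$ such that $f\in L^0(\mu)$, $g\in X$, $|f|\le|g|$ a.e. imply $f\in X$ and $\|f\|_X\le\|g\|_X$. It is $p$-convex with constant $1$ if $\|(\sum_{k=1}^n|x_k|^p)^{1/p}\|_X\le(\sum_{k=1}^n\|x_k\|_X^p)^{1/p}$ for all finite sequences in $X$; then its $p$-concavification $X_p=\{f\in L^0(\mu):|f|^{1/p}\in X\}$ with norm $\|f\|_{X_p}=\||f|^{1/p}\|_X^p$ is a Banach function lattice. $B^{+}_{(X_p)^*}$ is the set of positive functionals in the closed unit ball of $(X_p)^*$, with the weak$^*$ topology. For $1\le p\le q<\infty$, a $p$-convex $X$ and a regular Borel probability measure $\nu$ on $B^{+}_{(X_p)^*}$, define the lattice seminorm on $X$ $$\|x\|_{p,q,\nu}=\Big(\int_{B^{+}_{(X_p)^*}}\langle|x|^p,x^*\rangle^{q/p}\,d\nu(x^* )\Big)^{1/q}.$$ Let $N=\{x\in X:\|x\|_{p,q,\nu}=0\}$. Then $\widetilde F^{q}_{X_p}(\nu)$ denotes the Banach lattice obtained as the completion of the quotient $X/N$ under the norm $\|[x]\|=\|x\|_{p,q,\nu}$, and $\iota_X\colon X\to\widetilde F^q_{X_p}(\nu)$ is the (bounded) map $\iota_X(x)=[x]$. Let $1/r_j=1/p_j-1/q_j$ (with $r_j=\infty$ if $p_j=q_j$). A multilinear operator $T\colon X_1\times\cdots\times X_m\to Y$ is $(p_1,\ldots,p_m)$-strongly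 $(q_1,\ldots,q_m)$-concave if there is $C>0$ such that for every $n$ and all finite sequences $(x_k^j)_{k=1}^n$ in $X_j$, $1\le j\le m$, $$\Big(\sum_{k=1}^n\|T(x_k^1,\ldots,x_k^m)\|_Y^q\Big)^{1/q}\le C\prod_{j=1}^m\ \sup_{(\beta_k^j)\in B_{r_j}^n}\Big\|\Big(\sum_{k=1}^n|\beta_k^jx_k^j|^{p_j}\Big)^{1/p_j}\Big\|_{X_j},$$ where $1/q=1/q_1+\cdots+1/q_m$ and $B_r^n$ is the closed unit ball of $\ell_r^n=(\mathbb R^n,\|\cdot\|_r)$. *)

theory Defs
  imports "HOL-Analysis.Analysis" "HOL-Probability.Probability_Measure"
begin

section \<open>Seminormed spaces with explicit carrier\<close>

record 'v seminormed =
  vcarrier :: "'v set"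
  vplus :: "'v \<Rightarrow> 'v \<Rightarrow> 'v"
  vscale :: "real \<Rightarrow> 'v \<Rightarrow> 'v"
  vnorm :: "'v \<Rightarrow> real"

definition vdist :: "'v seminormed \<Rightarrow> 'v \<Rightarrow> 'v \<Rightarrow> real" where
  "vdist V x y = vnorm V (vplus V x (vscale V (-1) y))"

definition vCauchy :: "'v seminormed \<Rightarrow> (nat \<Rightarrow> 'v) \<Rightarrow> bool" where
  "vCauchy V u \<longleftrightarrow> (\<forall>n. u n \<in> vcarrier V) \<and>
     (\<forall>e>0. \<exists>n0. \<forall>i\<ge>n0. \<forall>k\<ge>n0. vdist V (u i) (u k) < e)"

definition null_rel :: "'v seminormed \<Rightarrow> ('v \<times> 'v) set" where
  "null_rel V = {(x, y). x \<in> vcarrier V \<and> y \<in> vcarrier V \<and> vdist V x y = 0}"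

definition vclass :: "'v seminormed \<Rightarrow> 'v \<Rightarrow> 'v set" where
  "vclass V x = null_rel V `` {x}"

text \<open>The quotient of \<open>V\<close> by the kernel of its seminorm. The seminorm is constant on each
  class, so the image below is a singleton; likewise the unions are unions of equal sets.\<close>

definition quotient_space :: "'v seminormed \<Rightarrow> 'v set seminormed" where
  "quotient_space V =
     \<lparr> vcarrier = vcarrier V // null_rel V,
       vplus = (\<lambda>A B. \<Union>a\<in>A. \<Union>b\<in>B. vclass V (vplus V a b)),
       vscale = (\<lambda>c A. \<Union>a\<in>A. vclass V (vscale V c a)),
       vnorm = (\<lambda>A. the_elem (vnorm V ` A)) \<rparr>"

definition Cauchy_space :: "'v seminormed \<Rightarrow> (nat \<Rightarrow> 'v) seminormed" where
  "Cauchy_space V =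
     \<lparr> vcarrier = {u. vCauchy V u},
       vplus = (\<lambda>u v n. vplus V (u n) (v n)),
       vscale = (\<lambda>c u n. vscale V c (u n)),
       vnorm = (\<lambda>u. lim (\<lambda>n. vnorm V (u n))) \<rparr>"

text \<open>The completion of a normed space: Cauchy sequences modulo null sequences.\<close>

definition completion :: "'v seminormed \<Rightarrow> (nat \<Rightarrow> 'v) set seminormed" where
  "completion V = quotient_space (Cauchy_space V)"

definition to_completion :: "'v seminormed \<Rightarrow> 'v \<Rightarrow> (nat \<Rightarrow> 'v) set" where
  "to_completion V x = vclass (Cauchy_space V) (\<lambda>_. x)"

definition multilinear_map ::
    "('m::finite \<Rightarrow> 'v seminormed) \<Rightarrow> (('m \<Rightarrow> 'v) \<Rightarrow> 'y::real_vector) \<Rightarrow> bool" where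
  "multilinear_map V S \<longleftrightarrow>
     (\<forall>x. (\<forall>j. x j \<in> vcarrier (V j)) \<longrightarrow>
        (\<forall>j. \<forall>u\<in>vcarrier (V j). \<forall>v\<in>vcarrier (V j). \<forall>c.
           S (x(j := vplus (V j) u v)) = S (x(j := u)) + S (x(j := v)) \<and>
           S (x(j := vscale (V j) c u)) = c *\<^sub>R S (x(j := u))))"

definition bounded_multilinear_map ::
    "('m::finite \<Rightarrow> 'v seminormed) \<Rightarrow> (('m \<Rightarrow> 'v) \<Rightarrow> 'y::real_normed_vector) \<Rightarrow> bool" where
  "bounded_multilinear_map V S \<longleftrightarrow> multilinear_map V S \<and>
     (\<exists>K. \<forall>x. (\<forall>j. x j \<in> vcarrier (V j)) \<longrightarrow> norm (S x) \<le> K * (\<Prod>j\<in>UNIV. vnorm (V j) (x j)))"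

section \<open>Banach function lattices\<close>

text \<open>An element of \<open>L\<^sup>0(\<mu>)\<close> is given by a measurable representative. A function lattice is the
  set \<open>X\<close> of all representatives of its elements (the ideal property makes it closed under a.e.
  equality), and its norm is a function \<open>N\<close> on representatives that vanishes exactly on the
  functions that are a.e. zero.\<close>

definition fun_space :: "('a \<Rightarrow> real) set \<Rightarrow> (('a \<Rightarrow> real) \<Rightarrow> real) \<Rightarrow> ('a \<Rightarrow> real) seminormed" where
  "fun_space X N =
     \<lparr> vcarrier = X,
       vplus = (\<lambda>f g \<omega>. f \<omega> + g \<omega>),
       vscale = (\<lambda>c f \<omega>. c * f \<omega>),
       vnorm = N \<rparr>"

definition banach_function_lattice ::
    "'a measure \<Rightarrow> ('a \<Rightarrow> real) set \<Rightarrow> (('a \<Rightarrow> real) \<Rightarrow> real) \<Rightarrow> bool" where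
  "banach_function_lattice M X N \<longleftrightarrow>
     sigma_finite_measure M \<and>
     X \<subseteq> borel_measurable M \<and>
     (\<lambda>_. 0) \<in> X \<and>
     (\<forall>f\<in>X. \<forall>g\<in>X. (\<lambda>\<omega>. f \<omega> + g \<omega>) \<in> X) \<and>
     (\<forall>c. \<forall>f\<in>X. (\<lambda>\<omega>. c * f \<omega>) \<in> X) \<and>
     (\<forall>f\<in>X. 0 \<le> N f \<and> (N f = 0 \<longleftrightarrow> (AE \<omega> in M. f \<omega> = 0))) \<and>
     (\<forall>f\<in>X. \<forall>g\<in>X. N (\<lambda>\<omega>. f \<omega> + g \<omega>) \<le> N f + N g) \<and>
     (\<forall>c. \<forall>f\<in>X. N (\<lambda>\<omega>. c * f \<omega>) = \<bar>c\<bar> * N f) \<and>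
     (\<forall>u. vCauchy (fun_space X N) u \<longrightarrow> (\<exists>f\<in>X. (\<lambda>n. N (\<lambda>\<omega>. u n \<omega> - f \<omega>)) \<longlonglongrightarrow> 0)) \<and>
     (\<forall>f\<in>borel_measurable M. \<forall>g\<in>X. (AE \<omega> in M. \<bar>f \<omega>\<bar> \<le> \<bar>g \<omega>\<bar>) \<longrightarrow> f \<in> X \<and> N f \<le> N g)"

definition p_convex1 :: "real \<Rightarrow> ('a \<Rightarrow> real) set \<Rightarrow> (('a \<Rightarrow> real) \<Rightarrow> real) \<Rightarrow> bool" where
  "p_convex1 p X N \<longleftrightarrow>
     (\<forall>(n::nat) x. (\<forall>k<n. x k \<in> X) \<longrightarrow>
        N (\<lambda>\<omega>. (\<Sum>k<n. \<bar>x k \<omega>\<bar> powr p) powr (1 / p)) \<le> (\<Sum>k<n. N (x k) powr p) powr (1 / p))"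

definition concav :: "'a measure \<Rightarrow> real \<Rightarrow> ('a \<Rightarrow> real) set \<Rightarrow> ('a \<Rightarrow> real) set" where
  "concav M p X = {f \<in> borel_measurable M. (\<lambda>\<omega>. \<bar>f \<omega>\<bar> powr (1 / p)) \<in> X}"

definition concav_norm :: "real \<Rightarrow> (('a \<Rightarrow> real) \<Rightarrow> real) \<Rightarrow> ('a \<Rightarrow> real) \<Rightarrow> real" where
  "concav_norm p N f = N (\<lambda>\<omega>. \<bar>f \<omega>\<bar> powr (1 / p)) powr p"

text \<open>Functionals are taken extensional, i.e. undefined off the carrier, so that distinct elements
  of the set differ as functionals. The norm bound makes a functional respect a.e. equality.\<close>

definition pos_dual_ball ::
    "'a measure \<Rightarrow> ('a \<Rightarrow> real) set \<Rightarrow> (('a \<Rightarrow> real) \<Rightarrow> real) \<Rightarrow> (('a \<Rightarrow> real) \<Rightarrow> real) set" where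
  "pos_dual_ball M E N =
     {\<phi> \<in> extensional E.
        (\<forall>f\<in>E. \<forall>g\<in>E. \<phi> (\<lambda>\<omega>. f \<omega> + g \<omega>) = \<phi> f + \<phi> g) \<and>
        (\<forall>c. \<forall>f\<in>E. \<phi> (\<lambda>\<omega>. c * f \<omega>) = c * \<phi> f) \<and>
        (\<forall>f\<in>E. \<bar>\<phi> f\<bar> \<le> N f) \<and>
        (\<forall>f\<in>E. (AE \<omega> in M. 0 \<le> f \<omega>) \<longrightarrow> 0 \<le> \<phi> f)}"

definition weak_star_pos_dual_ball ::
    "'a measure \<Rightarrow> ('a \<Rightarrow> real) set \<Rightarrow> (('a \<Rightarrow> real) \<Rightarrow> real) \<Rightarrow> (('a \<Rightarrow> real) \<Rightarrow> real) topology" where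
  "weak_star_pos_dual_ball M E N =
     subtopology (product_topology (\<lambda>_. euclideanreal) E) (pos_dual_ball M E N)"

definition regular_borel_prob :: "'b topology \<Rightarrow> 'b measure \<Rightarrow> bool" where
  "regular_borel_prob B \<nu> \<longleftrightarrow>
     prob_space \<nu> \<and> space \<nu> = topspace B \<and>
     sets \<nu> = sigma_sets (topspace B) {U. openin B U} \<and>
     (\<forall>A\<in>sets \<nu>. emeasure \<nu> A = (SUP K\<in>{K. compactin B K \<and> K \<subseteq> A}. emeasure \<nu> K) \<and>
                  emeasure \<nu> A = (INF U\<in>{U. openin B U \<and> A \<subseteq> U}. emeasure \<nu> U))"

definition pq_seminorm ::
    "real \<Rightarrow> real \<Rightarrow> (('a \<Rightarrow> real) \<Rightarrow> real) measure \<Rightarrow> ('a \<Rightarrow> real) \<Rightarrow> real" where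
  "pq_seminorm p q \<nu> x = (LINT \<phi>|\<nu>. \<phi> (\<lambda>\<omega>. \<bar>x \<omega>\<bar> powr p) powr (q / p)) powr (1 / q)"

text \<open>Only the Banach space structure of the completed quotient is recorded; its lattice order
  does not enter the notion of a bounded multilinear operator.\<close>

definition seminorm_quotient ::
    "('a \<Rightarrow> real) set \<Rightarrow> real \<Rightarrow> real \<Rightarrow> (('a \<Rightarrow> real) \<Rightarrow> real) measure \<Rightarrow> ('a \<Rightarrow> real) set seminormed" where
  "seminorm_quotient X p q \<nu> = quotient_space (fun_space X (pq_seminorm p q \<nu>))"

definition F_tilde ::
    "('a \<Rightarrow> real) set \<Rightarrow> real \<Rightarrow> real \<Rightarrow> (('a \<Rightarrow> real) \<Rightarrow> real) measure \<Rightarrow>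
     (nat \<Rightarrow> ('a \<Rightarrow> real) set) set seminormed" where
  "F_tilde X p q \<nu> = completion (seminorm_quotient X p q \<nu>)"

definition iota ::
    "('a \<Rightarrow> real) set \<Rightarrow> real \<Rightarrow> real \<Rightarrow> (('a \<Rightarrow> real) \<Rightarrow> real) measure \<Rightarrow> ('a \<Rightarrow> real) \<Rightarrow>
     (nat \<Rightarrow> ('a \<Rightarrow> real) set) set" where
  "iota X p q \<nu> x =
     to_completion (seminorm_quotient X p q \<nu>) (vclass (fun_space X (pq_seminorm p q \<nu>)) x)"

section \<open>Strongly concave multilinear operators\<close>

definition r_exponent :: "real \<Rightarrow> real \<Rightarrow> ereal" where
  "r_exponent p q = (if p = q then \<infinity> else ereal (1 / (1 / p - 1 / q)))"

definition ell_norm :: "ereal \<Rightarrow> nat \<Rightarrow> (nat \<Rightarrow> real) \<Rightarrow> real" where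
  "ell_norm r n \<beta> =
     (if r = \<infinity> then Max (insert 0 ((\<lambda>k. \<bar>\<beta> k\<bar>) ` {..<n}))
      else (\<Sum>k<n. \<bar>\<beta> k\<bar> powr real_of_ereal r) powr (1 / real_of_ereal r))"

text \<open>For a function lattice the supremum is over a nonempty bounded set of reals, because
  \<open>\<bar>\<beta> k\<bar> \<le> 1\<close> on the unit ball.\<close>

definition strongly_concave ::
    "('m::finite \<Rightarrow> real) \<Rightarrow> ('m \<Rightarrow> real) \<Rightarrow> ('m \<Rightarrow> ('a \<Rightarrow> real) set) \<Rightarrow>
     ('m \<Rightarrow> ('a \<Rightarrow> real) \<Rightarrow> real) \<Rightarrow> (('m \<Rightarrow> 'a \<Rightarrow> real) \<Rightarrow> 'y::real_normed_vector) \<Rightarrow> bool" where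
  "strongly_concave p q X N T \<longleftrightarrow>
     (let s = 1 / (\<Sum>j\<in>UNIV. 1 / q j) in
      \<exists>C>0. \<forall>(n::nat) x. (\<forall>j. \<forall>k<n. x j k \<in> X j) \<longrightarrow>
        (\<Sum>k<n. norm (T (\<lambda>j. x j k)) powr s) powr (1 / s)
          \<le> C * (\<Prod>j\<in>UNIV. SUP \<beta>\<in>{\<beta>. ell_norm (r_exponent (p j) (q j)) n \<beta> \<le> 1}.
                   N j (\<lambda>\<omega>. (\<Sum>k<n. \<bar>\<beta> k * x j k \<omega>\<bar> powr p j) powr (1 / p j))))"

text \<open>A multilinear operator on function lattices is a multilinear map on representatives that
  respects a.e. equality in every argument.\<close>

definition multilinear_operator ::
    "('m::finite \<Rightarrow> 'a measure) \<Rightarrow> ('m \<Rightarrow> ('a \<Rightarrow> real) set) \<Rightarrow> ('m \<Rightarrow> ('a \<Rightarrow> real) \<Rightarrow> real) \<Rightarrow>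
     (('m \<Rightarrow> 'a \<Rightarrow> real) \<Rightarrow> 'y::real_vector) \<Rightarrow> bool" where
  "multilinear_operator M X N T \<longleftrightarrow>
     multilinear_map (\<lambda>j. fun_space (X j) (N j)) T \<and>
     (\<forall>x y. (\<forall>j. x j \<in> X j \<and> y j \<in> X j \<and> (AE \<omega> in M j. x j \<omega> = y j \<omega>)) \<longrightarrow> T x = T y)"

end

theory Submission
  imports Defs
begin

text \<open>
  Strong concavity is turned into a domination
  \<open>\<parallel>T x\<parallel> \<le> C \<Prod>\<^sub>j \<parallel>x\<^sub>j\<parallel>\<close> by the seminorms attached to suitable \<open>\<nu>\<^sub>j\<close>, which is the same as a
  bounded factorization through the completed quotients.

  Hoelder duality together with norm-attaining positive functionals identifies the \<open>q\<close>-th power of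
  the supremum over \<open>\<beta>\<close> with the supremum over \<open>\<phi>\<close> in the dual ball of
  \<open>\<Sum>\<^sub>k \<langle>|x\<^sub>k|\<^sup>p, \<phi>\<rangle> powr (q / p)\<close>. After AM--GM, strong concavity says that no function in a
  certain convex cone on the product of the dual balls is bounded below by a positive constant.
  Hahn--Banach gives a mean (a finitely additive probability) that is nonpositive on the cone.
  Its marginals need not be countably additive, but each one is dominated on closed sets by a Radon
  probability measure, and domination suffices because only upper bounds on \<open>\<parallel>T x\<parallel>\<close> are needed.
  Homogeneity turns the resulting sum back into a product.
\<close>

section \<open>Hahn--Banach for spaces of functions\<close>

text \<open>Two suprema must be brought together. Strong concavity takes a supremum over
  \<open>\<beta>\<close> of norms in \<open>X j\<close>. A norming functional rewrites each such
  norm as a value at some \<open>\<phi>\<close>, and for fixed \<open>\<phi>\<close> the supremum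
  over \<open>\<beta>\<close> is explicit, because 1/r = 1/p - 1/q makes r/p and q/p conjugate
  exponents.

  A cone function is a constant minus a sum of functions of one coordinate each. Hence
  near-maximisers can be chosen in each dual ball separately, and only the marginals of the mean are
  needed: no measure on the product is built.

  The mean acts on all bounded functions, so each marginal is a finitely additive set function on
  all subsets. Its values on closed sets form a content, and Halmos's passage from contents to
  regular measures gives the Radon measure. The integrands are continuous, so their superlevel sets
  are closed, and domination on closed sets passes to integrals.

  The weights in AM--GM and in the converse Hoelder estimate are the same numbers s / q_j. They sum
  to 1 because 1/s is the sum of the 1/q_j.\<close>

definition fun_subspace :: "('b \<Rightarrow> real) set \<Rightarrow> bool" where
  "fun_subspace E \<longleftrightarrow> (\<lambda>_. 0) \<in> E \<and> (\<forall>f\<in>E. \<forall>g\<in>E. (\<lambda>x. f x + g x) \<in> E) \<and>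
     (\<forall>c. \<forall>f\<in>E. (\<lambda>x. c * f x) \<in> E)"

definition sublinear_on :: "('b \<Rightarrow> real) set \<Rightarrow> (('b \<Rightarrow> real) \<Rightarrow> real) \<Rightarrow> bool" where
  "sublinear_on E P \<longleftrightarrow> (\<forall>f\<in>E. \<forall>g\<in>E. P (\<lambda>x. f x + g x) \<le> P f + P g) \<and>
     (\<forall>c>0. \<forall>f\<in>E. P (\<lambda>x. c * f x) = c * P f)"

definition linear_on :: "('b \<Rightarrow> real) set \<Rightarrow> (('b \<Rightarrow> real) \<Rightarrow> real) \<Rightarrow> bool" where
  "linear_on E L \<longleftrightarrow> (\<forall>f\<in>E. \<forall>g\<in>E. L (\<lambda>x. f x + g x) = L f + L g) \<and>
     (\<forall>c. \<forall>f\<in>E. L (\<lambda>x. c * f x) = c * L f)"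

lemma fun_subspaceD:
  assumes "fun_subspace E"
  shows "(\<lambda>_. 0) \<in> E" "f \<in> E \<Longrightarrow> g \<in> E \<Longrightarrow> (\<lambda>x. f x + g x) \<in> E" "f \<in> E \<Longrightarrow> (\<lambda>x. c * f x) \<in> E"
    "f \<in> E \<Longrightarrow> (\<lambda>x. - f x) \<in> E" "f \<in> E \<Longrightarrow> g \<in> E \<Longrightarrow> (\<lambda>x. f x - g x) \<in> E"
proof -
  show 1: "(\<lambda>_. 0) \<in> E" "f \<in> E \<Longrightarrow> g \<in> E \<Longrightarrow> (\<lambda>x. f x + g x) \<in> E"
    "f \<in> E \<Longrightarrow> (\<lambda>x. c * f x) \<in> E" for f g c
    using assms unfolding fun_subspace_def by blast+
  show 2: "(\<lambda>x. - f x) \<in> E" if "f \<in> E" for f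
    using 1(3)[OF that, of "-1"] by simp
  show "(\<lambda>x. f x - g x) \<in> E" if "f \<in> E" "g \<in> E"
    using 1(2)[OF that(1) 2[OF that(2)]] by simp
qed

lemma fun_subspace_sum:
  assumes "fun_subspace E" "\<And>k. k \<in> A \<Longrightarrow> f k \<in> E"
  shows "(\<lambda>x. \<Sum>k\<in>A. f k x) \<in> E"
proof (cases "finite A")
  case True
  then show ?thesis
    using assms(2) by (induction A) (simp_all add: fun_subspaceD[OF assms(1)])
qed (simp add: fun_subspaceD[OF assms(1)])

lemma sublinear_onD:
  assumes "fun_subspace E" "sublinear_on E P"
  shows "f \<in> E \<Longrightarrow> g \<in> E \<Longrightarrow> P (\<lambda>x. f x + g x) \<le> P f + P g"
    "c > 0 \<Longrightarrow> f \<in> E \<Longrightarrow> P (\<lambda>x. c * f x) = c * P f"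
    "P (\<lambda>_. 0) = 0" "f \<in> E \<Longrightarrow> - P (\<lambda>x. - f x) \<le> P f"
proof -
  show 1: "f \<in> E \<Longrightarrow> g \<in> E \<Longrightarrow> P (\<lambda>x. f x + g x) \<le> P f + P g"
    "c > 0 \<Longrightarrow> f \<in> E \<Longrightarrow> P (\<lambda>x. c * f x) = c * P f" for f g c
    using assms(2) unfolding sublinear_on_def by blast+
  show 2: "P (\<lambda>_. 0) = 0"
    using 1(2)[of 2 "\<lambda>_. 0"] fun_subspaceD(1)[OF assms(1)] by simp
  show "f \<in> E \<Longrightarrow> - P (\<lambda>x. - f x) \<le> P f"
    using 1(1)[of f "\<lambda>x. - f x"] 2 fun_subspaceD(4)[OF assms(1)] by simp
qed

lemma linear_onD:
  assumes "linear_on E L"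
  shows "f \<in> E \<Longrightarrow> g \<in> E \<Longrightarrow> L (\<lambda>x. f x + g x) = L f + L g"
    "f \<in> E \<Longrightarrow> L (\<lambda>x. c * f x) = c * L f"
    "f \<in> E \<Longrightarrow> L (\<lambda>x. - f x) = - L f"
    "fun_subspace E \<Longrightarrow> f \<in> E \<Longrightarrow> g \<in> E \<Longrightarrow> L (\<lambda>x. f x - g x) = L f - L g"
    "fun_subspace E \<Longrightarrow> L (\<lambda>_. 0) = 0"
proof -
  show 1: "f \<in> E \<Longrightarrow> g \<in> E \<Longrightarrow> L (\<lambda>x. f x + g x) = L f + L g"
    "f \<in> E \<Longrightarrow> L (\<lambda>x. c * f x) = c * L f" for f g c
    using assms unfolding linear_on_def by blast+
  show 2: "f \<in> E \<Longrightarrow> L (\<lambda>x. - f x) = - L f" for f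
    using 1(2)[of f "-1"] by simp
  show "fun_subspace E \<Longrightarrow> f \<in> E \<Longrightarrow> g \<in> E \<Longrightarrow> L (\<lambda>x. f x - g x) = L f - L g"
    using 1(1)[of f "\<lambda>x. - g x"] 2[of g] fun_subspaceD(4)[of E g] by simp
  show "fun_subspace E \<Longrightarrow> L (\<lambda>_. 0) = 0"
    using 1(2)[of "\<lambda>_. 0" 0] fun_subspaceD(1)[of E] by simp
qed

lemma linear_on_sum:
  assumes "fun_subspace E" "linear_on E L" "\<And>k. k \<in> A \<Longrightarrow> f k \<in> E"
  shows "L (\<lambda>x. \<Sum>k\<in>A. f k x) = (\<Sum>k\<in>A. L (f k))"
proof (cases "finite A")
  case True
  then show ?thesis
    using assms(3)
  proof (induction A)
    case (insert a A)
    then show ?case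
      using linear_onD(1)[OF assms(2), of "f a" "\<lambda>x. \<Sum>k\<in>A. f k x"]
      by (simp add: fun_subspace_sum[OF assms(1)])
  qed (simp add: linear_onD(5)[OF assms(2,1)])
qed (simp add: linear_onD(5)[OF assms(2,1)])

text \<open>The one-dimensional step of Hahn--Banach, done by lowering \<open>P\<close> instead of
  extending from a subspace: a linear \<open>L\<close> below \<open>Q\<close> has
  \<open>- L v \<le> Q (\<lambda>x. - v x) \<le> - P v\<close>, hence \<open>L v \<ge> P v\<close>.
  The infimum is finite because subadditivity keeps the set above
  \<open>- P (\<lambda>x. - f x)\<close>.\<close>

lemma sublinear_on_directional:
  assumes E: "fun_subspace E" and P: "sublinear_on E P" and v: "v \<in> E"
  defines "Q \<equiv> \<lambda>f. Inf ((\<lambda>t. P (\<lambda>x. f x + t * v x) - t * P v) ` {0..})"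
  shows "sublinear_on E Q" "\<And>f. f \<in> E \<Longrightarrow> Q f \<le> P f" "Q (\<lambda>x. - v x) \<le> - P v"
proof -
  note ED = fun_subspaceD[OF E] and PD = sublinear_onD[OF E P]
  define G where "G f t = P (\<lambda>x. f x + t * v x) - t * P v" for f t
  have Q: "Q f = Inf (G f ` {0..})" for f
    unfolding Q_def G_def ..
  have tv: "P (\<lambda>x. t * v x) = t * P v" if "t \<ge> 0" for t
    using PD(2)[of t v] PD(3) v that by (cases "t = 0") auto
  have lb: "- P (\<lambda>x. - f x) \<le> G f t" if f: "f \<in> E" and t: "t \<ge> 0" for f t
  proof -
    have "P (\<lambda>x. (f x + t * v x) + (- f x)) \<le> P (\<lambda>x. f x + t * v x) + P (\<lambda>x. - f x)"
      by (rule PD(1)) (use f v in \<open>simp_all add: ED\<close>)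
    then show ?thesis using tv[OF t] unfolding G_def by simp
  qed
  have bdd: "bdd_below (G f ` {0..})" if "f \<in> E" for f
    using lb[OF that] by (intro bdd_belowI[of _ "- P (\<lambda>x. - f x)"]) auto
  have Qle: "Q f \<le> G f t" if "f \<in> E" "t \<ge> 0" for f t
    unfolding Q by (rule cINF_lower[OF bdd]) (use that in auto)
  have Qge: "a \<le> Q f" if "\<And>t. t \<ge> 0 \<Longrightarrow> a \<le> G f t" for a f
    unfolding Q by (rule cINF_greatest) (use that in auto)
  show "Q f \<le> P f" if "f \<in> E" for f
    using Qle[OF that, of 0] by (simp add: G_def)
  show "Q (\<lambda>x. - v x) \<le> - P v"
    using Qle[of "\<lambda>x. - v x" 1] PD(3) v by (simp add: G_def ED)
  show "sublinear_on E Q"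
    unfolding sublinear_on_def
  proof (intro conjI ballI allI impI)
    fix f g assume f: "f \<in> E" and g: "g \<in> E"
    have *: "Q (\<lambda>x. f x + g x) \<le> G f s + G g t" if "s \<ge> 0" "t \<ge> 0" for s t
    proof -
      have "P (\<lambda>x. (f x + s * v x) + (g x + t * v x))
          \<le> P (\<lambda>x. f x + s * v x) + P (\<lambda>x. g x + t * v x)"
        by (rule PD(1)) (use f g v in \<open>simp_all add: ED\<close>)
      then have "G (\<lambda>x. f x + g x) (s + t) \<le> G f s + G g t"
        unfolding G_def by (simp add: algebra_simps)
      then show ?thesis
        using Qle[of "\<lambda>x. f x + g x" "s + t"] f g that by (simp add: ED)
    qed
    have "Q (\<lambda>x. f x + g x) - Q g \<le> G f s" if s: "s \<ge> 0" for s
      using Qge[of "Q (\<lambda>x. f x + g x) - G f s" g] *[OF s] by (simp add: algebra_simps)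
    then have "Q (\<lambda>x. f x + g x) - Q g \<le> Q f"
      by (rule Qge)
    then show "Q (\<lambda>x. f x + g x) \<le> Q f + Q g" by simp
  next
    have le: "Q (\<lambda>x. c * f x) \<le> c * Q f" if c: "c > 0" and f: "f \<in> E" for c f
    proof -
      have "Q (\<lambda>x. c * f x) / c \<le> G f t" if t: "t \<ge> 0" for t
      proof -
        have "P (\<lambda>x. c * (f x + t * v x)) = c * P (\<lambda>x. f x + t * v x)"
          by (rule PD(2)) (use f v c in \<open>simp_all add: ED\<close>)
        then have "G (\<lambda>x. c * f x) (c * t) = c * G f t"
          unfolding G_def by (simp add: algebra_simps)
        then show ?thesis
          using Qle[of "\<lambda>x. c * f x" "c * t"] f c t by (simp add: ED field_simps)
      qed
      then have "Q (\<lambda>x. c * f x) / c \<le> Q f" by (rule Qge)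
      then show ?thesis using c by (simp add: field_simps)
    qed
    fix c :: real and f assume c: "c > 0" and f: "f \<in> E"
    have "Q (\<lambda>x. (1/c) * (c * f x)) \<le> (1/c) * Q (\<lambda>x. c * f x)"
      by (rule le) (use c f in \<open>auto simp: ED\<close>)
    then show "Q (\<lambda>x. c * f x) = c * Q f"
      using le[OF c f] c by (simp add: field_simps)
  qed
qed

text \<open>The lower bound for chains in Zorn's lemma. The bound
  \<open>- P (\<lambda>x. - f x)\<close> is common to all members, so the infimum is finite.
  Subadditivity needs the chain condition: the infima at \<open>f\<close> and at \<open>g\<close>
  must be approached by a single functional.\<close>

lemma sublinear_on_chain_Inf:
  assumes E: "fun_subspace E" and C: "C \<noteq> {}"
    and sub: "\<And>Q. Q \<in> C \<Longrightarrow> sublinear_on E Q \<and> (\<forall>f\<in>E. Q f \<le> P f)"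
    and chain: "\<And>Q R. Q \<in> C \<Longrightarrow> R \<in> C \<Longrightarrow> Q \<le> R \<or> R \<le> Q"
  shows "sublinear_on E (\<lambda>f. INF Q\<in>C. Q f)" "\<And>f Q. f \<in> E \<Longrightarrow> Q \<in> C \<Longrightarrow> (INF Q\<in>C. Q f) \<le> Q f"
proof -
  note ED = fun_subspaceD[OF E]
  have QD: "Q (\<lambda>x. f x + g x) \<le> Q f + Q g" "c > 0 \<Longrightarrow> Q (\<lambda>x. c * f x) = c * Q f"
    "- P (\<lambda>x. - f x) \<le> Q f"
    if "Q \<in> C" "f \<in> E" "g \<in> E" for Q f g c
  proof -
    have Q: "sublinear_on E Q" "\<And>f. f \<in> E \<Longrightarrow> Q f \<le> P f" using sub[OF that(1)] by auto
    note QD = sublinear_onD[OF E Q(1)]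
    show "Q (\<lambda>x. f x + g x) \<le> Q f + Q g" "c > 0 \<Longrightarrow> Q (\<lambda>x. c * f x) = c * Q f"
      using QD(1,2) that by blast+
    show "- P (\<lambda>x. - f x) \<le> Q f"
      using QD(4)[OF that(2)] Q(2)[OF ED(4)[OF that(2)]] by linarith
  qed
  have bdd: "bdd_below ((\<lambda>Q. Q f) ` C)" if "f \<in> E" for f
    using QD(3)[OF _ that that] by (intro bdd_belowI[of _ "- P (\<lambda>x. - f x)"]) auto
  show low: "(INF Q\<in>C. Q f) \<le> Q f" if "f \<in> E" "Q \<in> C" for f Q
    by (rule cINF_lower[OF bdd]) (use that in auto)
  show "sublinear_on E (\<lambda>f. INF Q\<in>C. Q f)"
    unfolding sublinear_on_def
  proof (intro conjI ballI allI impI)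
    fix f g assume f: "f \<in> E" and g: "g \<in> E"
    let ?I = "INF Q\<in>C. Q (\<lambda>x. f x + g x)"
    have *: "?I \<le> Q f + R g" if "Q \<in> C" "R \<in> C" for Q R
    proof -
      have "\<exists>S\<in>C. S \<le> Q \<and> S \<le> R"
        using chain[OF that] that by blast
      then obtain S where "S \<in> C" "S \<le> Q" "S \<le> R"
        by blast
      then show ?thesis
        using low[OF ED(2)[OF f g], of S] QD(1)[of S f g] f g le_funD[of S Q f] le_funD[of S R g]
        by simp
    qed
    have "?I - (INF Q\<in>C. Q g) \<le> Q f" if Q: "Q \<in> C" for Q
    proof -
      have "?I - Q f \<le> (INF Q\<in>C. Q g)"
        by (rule cINF_greatest[OF C]) (use *[OF Q] in \<open>simp add: algebra_simps\<close>)
      then show ?thesis by simp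
    qed
    then have "?I - (INF Q\<in>C. Q g) \<le> (INF Q\<in>C. Q f)"
      by (intro cINF_greatest[OF C])
    then show "?I \<le> (INF Q\<in>C. Q f) + (INF Q\<in>C. Q g)" by simp
  next
    fix c :: real and f assume c: "c > 0" and f: "f \<in> E"
    have "(INF Q\<in>C. Q (\<lambda>x. c * f x)) / c \<le> (INF Q\<in>C. Q f)"
    proof (rule cINF_greatest[OF C])
      fix Q assume "Q \<in> C"
      then show "(INF Q\<in>C. Q (\<lambda>x. c * f x)) / c \<le> Q f"
        using low[of "\<lambda>x. c * f x" Q] QD(2)[of Q f f c] f c by (simp add: ED field_simps)
    qed
    moreover have "c * (INF Q\<in>C. Q f) \<le> (INF Q\<in>C. Q (\<lambda>x. c * f x))"
    proof (rule cINF_greatest[OF C])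
      fix Q assume "Q \<in> C"
      then show "c * (INF Q\<in>C. Q f) \<le> Q (\<lambda>x. c * f x)"
        using low[of f Q] QD(2)[of Q f f c] f c by simp
    qed
    ultimately show "(INF Q\<in>C. Q (\<lambda>x. c * f x)) = c * (INF Q\<in>C. Q f)"
      using c by (simp add: field_simps)
  qed
qed

text \<open>A minimal sublinear functional below \<open>P\<close> equals each of its directional modifications
  and is therefore linear; starting Zorn's lemma from the modification of \<open>P\<close> in direction
  \<open>v\<close> forces the value at \<open>v\<close>.\<close>

theorem hahn_banach_fun:
  assumes E: "fun_subspace E" and P: "sublinear_on E P" and v: "v \<in> E"
  obtains L where "linear_on E L" "\<And>f. f \<in> E \<Longrightarrow> L f \<le> P f" "L v = P v"
proof -
  note ED = fun_subspaceD[OF E]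
  define P' where "P' f = Inf ((\<lambda>t. P (\<lambda>x. f x + t * v x) - t * P v) ` {0..})" for f
  note P' = sublinear_on_directional[OF E P v, folded P'_def]
  \<comment> \<open>Off \<open>E\<close> all members of \<open>A\<close> agree, so the pointwise
    order on total functions compares them on \<open>E\<close> only.\<close>
  define A where "A = {Q \<in> extensional E. sublinear_on E Q \<and> (\<forall>f\<in>E. Q f \<le> P' f)}"
  have ext: "restrict Q E \<in> A" if "sublinear_on E Q" "\<forall>f\<in>E. Q f \<le> P' f" for Q
    using that unfolding A_def sublinear_on_def by (auto simp: ED)
  \<comment> \<open>The order is reversed: a chain is bounded by its pointwise infimum, and Zorn's
    maximal element is a minimal functional.\<close>
  have po: "partial_order_on A (relation_of (\<ge>) A)"
    by (rule partial_order_on_relation_ofI) auto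
  obtain L where LA: "L \<in> A" and Lmin: "\<And>Q. Q \<in> A \<Longrightarrow> Q \<le> L \<Longrightarrow> Q = L"
  proof -
    have "\<exists>m\<in>A. \<forall>a\<in>A. m \<ge> a \<longrightarrow> a = m"
    proof (rule predicate_Zorn[OF po])
      fix C assume C: "C \<in> Chains (relation_of (\<ge>) A)"
      show "\<exists>u\<in>A. \<forall>a\<in>C. a \<ge> u"
      proof (cases "C = {}")
        case True
        then show ?thesis using ext[OF P'(1)] by auto
      next
        case False
        have CA: "C \<subseteq> A" and ch: "\<And>Q R. Q \<in> C \<Longrightarrow> R \<in> C \<Longrightarrow> Q \<le> R \<or> R \<le> Q"
          using C unfolding Chains_def relation_of_def by auto
        have sub: "sublinear_on E Q \<and> (\<forall>f\<in>E. Q f \<le> P' f)" if "Q \<in> C" for Q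
          using CA that unfolding A_def by auto
        let ?I = "\<lambda>f. INF Q\<in>C. Q f"
        have inf: "sublinear_on E ?I"
          by (rule sublinear_on_chain_Inf(1)[OF E False, of P']) (use sub ch in blast)+
        have inf2: "?I f \<le> Q f" if "f \<in> E" "Q \<in> C" for f Q
          by (rule sublinear_on_chain_Inf(2)[OF E False, of P']) (use sub ch that in blast)+
        have "\<forall>f\<in>E. ?I f \<le> P' f"
        proof
          fix f assume f: "f \<in> E"
          obtain Q where Q: "Q \<in> C" using False by blast
          show "?I f \<le> P' f" using order_trans[OF inf2[OF f Q]] sub[OF Q] f by blast
        qed
        then have "restrict ?I E \<in> A" by (rule ext[OF inf])
        moreover have "restrict ?I E \<le> Q" if "Q \<in> C" for Q
        proof (rule le_funI)
          fix f show "restrict ?I E f \<le> Q f"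
          proof (cases "f \<in> E")
            case False
            have "Q \<in> extensional E" using that CA unfolding A_def by blast
            from extensional_arb[OF this False] show ?thesis using False by simp
          qed (simp add: inf2 that)
        qed
        ultimately show ?thesis by blast
      qed
    qed
    then show ?thesis using that by blast
  qed
  have L: "sublinear_on E L" "\<And>f. f \<in> E \<Longrightarrow> L f \<le> P' f" "L \<in> extensional E"
    using LA unfolding A_def by auto
  note LD = sublinear_onD[OF E L(1)]
  have neg: "L (\<lambda>x. - w x) = - L w" if w: "w \<in> E" for w
  proof -
    define Q where "Q f = Inf ((\<lambda>t. L (\<lambda>x. f x + t * w x) - t * L w) ` {0..})" for f
    note Q = sublinear_on_directional[OF E L(1) w, folded Q_def]
    have "restrict Q E \<in> A"
      using Q(1,2) L(2) by (intro ext) (auto intro: order_trans)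
    moreover have "restrict Q E \<le> L"
    proof (rule le_funI)
      fix f show "restrict Q E f \<le> L f"
        using Q(2)[of f] extensional_arb[OF L(3), of f] by (cases "f \<in> E") auto
    qed
    ultimately have "restrict Q E = L" by (rule Lmin)
    then have "L (\<lambda>x. - w x) \<le> - L w"
      using Q(3) ED(4)[OF w] by (metis restrict_apply)
    then show ?thesis using LD(4)[OF w] by simp
  qed
  have "linear_on E L"
    unfolding linear_on_def
  proof (intro conjI ballI allI)
    fix f g assume f: "f \<in> E" and g: "g \<in> E"
    have "L (\<lambda>x. - f x + - g x) \<le> L (\<lambda>x. - f x) + L (\<lambda>x. - g x)"
      by (rule LD(1)) (use f g in \<open>auto simp: ED\<close>)
    then show "L (\<lambda>x. f x + g x) = L f + L g"
      using neg[OF f] neg[OF g] neg[OF ED(2)[OF f g]] LD(1)[OF f g] by simp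
  next
    fix c :: real and f assume f: "f \<in> E"
    consider "c > 0" | "c = 0" | "c < 0" by linarith
    then show "L (\<lambda>x. c * f x) = c * L f"
    proof cases
      case 3
      then show ?thesis
        using LD(2)[of "- c" f] f neg[OF ED(3)[OF f, of "- c"]] by simp
    qed (use LD(2,3) f in auto)
  qed
  moreover have "L f \<le> P f" if "f \<in> E" for f
    using L(2)[OF that] P'(2)[OF that] by simp
  moreover have "L v = P v"
    using L(2)[OF ED(4)[OF v]] P'(3) neg[OF v] calculation(2)[OF v] by simp
  ultimately show thesis by (rule that)
qed

section \<open>Means, and their separation from convex cones\<close>

definition bounded_funs_on :: "'b set \<Rightarrow> ('b \<Rightarrow> real) set" where
  "bounded_funs_on \<Omega> = {f. \<exists>B. \<forall>x\<in>\<Omega>. \<bar>f x\<bar> \<le> B}"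

lemma fun_subspace_bounded_funs: "fun_subspace (bounded_funs_on \<Omega>)"
  unfolding fun_subspace_def bounded_funs_on_def
proof (intro conjI ballI allI)
  show "(\<lambda>_. 0) \<in> {f. \<exists>B. \<forall>x\<in>\<Omega>. \<bar>f x :: real\<bar> \<le> B}" by auto
next
  fix f g assume "f \<in> {f. \<exists>B. \<forall>x\<in>\<Omega>. \<bar>f x :: real\<bar> \<le> B}" "g \<in> {f. \<exists>B. \<forall>x\<in>\<Omega>. \<bar>f x :: real\<bar> \<le> B}"
  then obtain B C where "\<forall>x\<in>\<Omega>. \<bar>f x\<bar> \<le> B" "\<forall>x\<in>\<Omega>. \<bar>g x\<bar> \<le> C" by auto
  then have "\<forall>x\<in>\<Omega>. \<bar>f x + g x\<bar> \<le> B + C" by (smt (verit))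
  then show "(\<lambda>x. f x + g x) \<in> {f. \<exists>B. \<forall>x\<in>\<Omega>. \<bar>f x :: real\<bar> \<le> B}" by auto
next
  fix c f assume "f \<in> {f. \<exists>B. \<forall>x\<in>\<Omega>. \<bar>f x :: real\<bar> \<le> B}"
  then obtain B where "\<forall>x\<in>\<Omega>. \<bar>f x\<bar> \<le> B" by auto
  then have "\<forall>x\<in>\<Omega>. \<bar>c * f x\<bar> \<le> \<bar>c\<bar> * B" by (simp add: abs_mult mult_left_mono)
  then show "(\<lambda>x. c * f x) \<in> {f. \<exists>B. \<forall>x\<in>\<Omega>. \<bar>f x :: real\<bar> \<le> B}" by blast
qed

text \<open>A state on the bounded functions on \<open>\<Omega>\<close>, that is, integration
  against a finitely additive probability on all subsets. The functions are total, but positivity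
  tests only points of \<open>\<Omega>\<close>, so values elsewhere have no influence
  (\<open>mean_on_cong\<close>).\<close>

definition mean_on :: "'b set \<Rightarrow> (('b \<Rightarrow> real) \<Rightarrow> real) \<Rightarrow> bool" where
  "mean_on \<Omega> L \<longleftrightarrow> linear_on (bounded_funs_on \<Omega>) L \<and> L (\<lambda>_. 1) = 1 \<and>
     (\<forall>f\<in>bounded_funs_on \<Omega>. (\<forall>x\<in>\<Omega>. 0 \<le> f x) \<longrightarrow> 0 \<le> L f)"

text \<open>Hahn--Banach for \<open>P f\<close>, the infimum of the constants \<open>t\<close> such
  that \<open>f \<le> t + h\<close> on \<open>\<Omega>\<close> for some \<open>h\<close> in the
  cone. For \<open>f\<close> in the cone the constant 0 is admissible, so
  \<open>L f \<le> P f \<le> 0\<close>. Constants as upper bounds, with \<open>h = 0\<close>, give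
  normalization and positivity.\<close>

theorem mean_nonpos_on_cone:
  assumes bdd: "H \<subseteq> bounded_funs_on \<Omega>" and zero: "(\<lambda>_. 0) \<in> H"
    and add: "\<And>f g. f \<in> H \<Longrightarrow> g \<in> H \<Longrightarrow> (\<lambda>x. f x + g x) \<in> H"
    and scale: "\<And>c f. c > 0 \<Longrightarrow> f \<in> H \<Longrightarrow> (\<lambda>x. c * f x) \<in> H"
    and small: "\<And>h \<epsilon>. h \<in> H \<Longrightarrow> \<epsilon> > 0 \<Longrightarrow> \<exists>x\<in>\<Omega>. h x \<le> \<epsilon>"
  obtains L where "mean_on \<Omega> L" "\<And>h. h \<in> H \<Longrightarrow> L h \<le> 0"
proof -
  let ?E = "bounded_funs_on \<Omega>"
  note E = fun_subspace_bounded_funs[of \<Omega>]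
  note ED = fun_subspaceD[OF E]
  define A where "A f = {t. \<exists>h\<in>H. \<forall>x\<in>\<Omega>. f x \<le> t + h x}" for f
  \<comment> \<open>\<open>small\<close> is what keeps \<open>P\<close> finite: at a point where
    \<open>h\<close> is at most \<open>e\<close>, the inequality \<open>f \<le> t + h\<close> forces
    \<open>t \<ge> - B - e\<close>.\<close>
  have lb: "- B \<le> t" if "\<And>x. x \<in> \<Omega> \<Longrightarrow> - B \<le> f x" "t \<in> A f" for B t f
  proof (rule field_le_epsilon)
    fix e :: real assume e: "e > 0"
    have "\<exists>h\<in>H. \<forall>x\<in>\<Omega>. f x \<le> t + h x" using that(2) by (simp add: A_def)
    then obtain h where h: "h \<in> H" "\<forall>x\<in>\<Omega>. f x \<le> t + h x" by blast
    obtain x where "x \<in> \<Omega>" "h x \<le> e" using small[OF h(1) e] by auto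
    then show "- B \<le> t + e" using that(1)[of x] h(2)[rule_format, of x] by simp
  qed
  have ABdd: "bdd_below (A f)" and ANe: "A f \<noteq> {}" if "f \<in> ?E" for f
  proof -
    have "\<exists>B. \<forall>x\<in>\<Omega>. \<bar>f x\<bar> \<le> B" using that by (simp add: bounded_funs_on_def)
    then obtain B where B: "\<forall>x\<in>\<Omega>. \<bar>f x\<bar> \<le> B" by blast
    have B': "- B \<le> f x" if "x \<in> \<Omega>" for x
      using B[rule_format, OF that] by simp
    show "bdd_below (A f)"
      by (rule bdd_belowI[of _ "- B"]) (rule lb[OF B'])
    have "\<forall>x\<in>\<Omega>. f x \<le> B + 0" using B by (simp add: abs_le_iff)
    then have "B \<in> A f" unfolding A_def using zero by (intro CollectI bexI[OF _ zero])
    then show "A f \<noteq> {}" by auto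
  qed
  define P where "P f = Inf (A f)" for f
  have Ple: "P f \<le> t" if "f \<in> ?E" "t \<in> A f" for f t
    unfolding P_def by (rule cInf_lower) (use that ABdd in auto)
  have Pge: "a \<le> P f" if "f \<in> ?E" "\<And>t. t \<in> A f \<Longrightarrow> a \<le> t" for f a
    unfolding P_def by (rule cInf_greatest) (use that ANe in auto)
  have "sublinear_on ?E P"
    unfolding sublinear_on_def
  proof (intro conjI ballI allI impI)
    fix f g assume f: "f \<in> ?E" and g: "g \<in> ?E"
    have "s + t \<in> A (\<lambda>x. f x + g x)" if st: "s \<in> A f" "t \<in> A g" for s t
    proof -
      obtain h where h: "h \<in> H" "\<forall>x\<in>\<Omega>. f x \<le> s + h x"
        using st(1) unfolding A_def by blast
      obtain k where k: "k \<in> H" "\<forall>x\<in>\<Omega>. g x \<le> t + k x"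
        using st(2) unfolding A_def by blast
      have "f x + g x \<le> s + t + (h x + k x)" if "x \<in> \<Omega>" for x
        using add_mono[OF h(2)[rule_format, OF that] k(2)[rule_format, OF that]]
        by (simp add: ac_simps)
      then show ?thesis unfolding A_def by (intro CollectI bexI[OF _ add[OF h(1) k(1)]] ballI)
    qed
    then have *: "P (\<lambda>x. f x + g x) \<le> s + t" if "s \<in> A f" "t \<in> A g" for s t
      using Ple[OF ED(2)[OF f g]] that by blast
    have "P (\<lambda>x. f x + g x) - P g \<le> s" if s: "s \<in> A f" for s
      using Pge[OF g, of "P (\<lambda>x. f x + g x) - s"] *[OF s] by (simp add: algebra_simps)
    then have "P (\<lambda>x. f x + g x) - P g \<le> P f" by (rule Pge[OF f])
    then show "P (\<lambda>x. f x + g x) \<le> P f + P g" by simp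
  next
    have le: "P (\<lambda>x. c * f x) \<le> c * P f" if c: "c > 0" and f: "f \<in> ?E" for c f
    proof -
      have "P (\<lambda>x. c * f x) / c \<le> t" if t: "t \<in> A f" for t
      proof -
        obtain h where h: "h \<in> H" "\<forall>x\<in>\<Omega>. f x \<le> t + h x" using t unfolding A_def by blast
        then have "\<forall>x\<in>\<Omega>. c * f x \<le> c * t + c * h x"
          using c by (metis distrib_left mult_le_cancel_left_pos)
        then have "c * t \<in> A (\<lambda>x. c * f x)" unfolding A_def by (intro CollectI bexI[OF _ scale[OF c h(1)]])
        then show ?thesis using Ple[OF ED(3)[OF f], of "c * t" c] c by (simp add: pos_divide_le_eq mult.commute)
      qed
      then have "P (\<lambda>x. c * f x) / c \<le> P f" by (rule Pge[OF f])
      then show ?thesis using c by (simp add: field_simps)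
    qed
    fix c :: real and f assume c: "c > 0" and f: "f \<in> ?E"
    have "P (\<lambda>x. (1/c) * (c * f x)) \<le> (1/c) * P (\<lambda>x. c * f x)"
      by (rule le) (use c f in \<open>auto simp: ED\<close>)
    then show "P (\<lambda>x. c * f x) = c * P f"
      using le[OF c f] c by (simp add: field_simps)
  qed
  then obtain L where L: "linear_on ?E L" "\<And>f. f \<in> ?E \<Longrightarrow> L f \<le> P f"
    using hahn_banach_fun[OF E _ ED(1)] by metis
  note LD = linear_onD[OF L(1)]
  have upper: "L f \<le> t" if "f \<in> ?E" "\<And>x. x \<in> \<Omega> \<Longrightarrow> f x \<le> t" for f t
  proof -
    have "\<forall>x\<in>\<Omega>. f x \<le> t + 0" using that(2) by simp
    then have "t \<in> A f" unfolding A_def by (intro CollectI bexI[OF _ zero])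
    then show ?thesis using L(2)[OF that(1)] Ple[OF that(1), of t] by simp
  qed
  have one: "(\<lambda>_. 1) \<in> ?E" by (auto simp: bounded_funs_on_def)
  have "mean_on \<Omega> L"
    unfolding mean_on_def
  proof (intro conjI ballI impI)
    have "L (\<lambda>_. 1) \<le> 1" by (rule upper[OF one]) simp
    moreover have "L (\<lambda>x. - 1) \<le> - 1" by (rule upper) (use ED(4)[OF one] in auto)
    ultimately show "L (\<lambda>_. 1) = 1" using LD(3)[OF one] by simp
  next
    fix f assume f: "f \<in> ?E" "\<forall>x\<in>\<Omega>. 0 \<le> f x"
    have "L (\<lambda>x. - f x) \<le> 0" by (rule upper) (use ED(4)[OF f(1)] f in auto)
    then show "0 \<le> L f" using LD(3)[OF f(1)] by simp
  qed (rule L(1))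
  moreover have "L h \<le> 0" if "h \<in> H" for h
  proof -
    have h: "h \<in> ?E" and "0 \<in> A h" unfolding A_def using that bdd by auto
    then show ?thesis using L(2)[OF h] Ple[OF h, of 0] by simp
  qed
  ultimately show thesis by (rule that)
qed

section \<open>Radon probability measures from finitely additive ones\<close>

locale fin_additive_prob =
  fixes B :: "'b topology" and m :: "'b set \<Rightarrow> real"
  assumes compact: "compact_space B" and Hausdorff: "Hausdorff_space B"
    and nonneg: "\<And>A. A \<subseteq> topspace B \<Longrightarrow> 0 \<le> m A"
    and additive: "\<And>A C. A \<subseteq> topspace B \<Longrightarrow> C \<subseteq> topspace B \<Longrightarrow> A \<inter> C = {} \<Longrightarrow> m (A \<union> C) = m A + m C"
    and total: "m (topspace B) = 1"
begin

text \<open>Halmos's construction of a regular measure from a content. Closed sets are the compact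
  sets here; only their \<open>m\<close>-values enter, first as inner approximation of open sets,
  then through open sets as outer approximation of arbitrary ones.\<close>

definition inner :: "'b set \<Rightarrow> ennreal" where
  "inner U = (SUP C\<in>{C. closedin B C \<and> C \<subseteq> U}. ennreal (m C))"

definition outer :: "'b set \<Rightarrow> ennreal" where
  "outer A = (INF U\<in>{U. openin B U \<and> A \<subseteq> U}. inner U)"

lemma m_empty: "m {} = 0"
  using additive[of "{}" "{}"] by simp

lemma m_mono: "m A \<le> m C" if "A \<subseteq> C" "C \<subseteq> topspace B"
proof -
  have "m (A \<union> (C - A)) = m A + m (C - A)" by (rule additive) (use that in auto)
  then show ?thesis using nonneg[of "C - A"] that by (simp add: Un_absorb1 le_supI1 Diff_subset order_trans[OF Diff_subset])
qed

lemma m_Un_le: "m (A \<union> C) \<le> m A + m C" if "A \<subseteq> topspace B" "C \<subseteq> topspace B"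
proof -
  have "m (A \<union> (C - A)) = m A + m (C - A)" by (rule additive) (use that in auto)
  then show ?thesis using m_mono[of "C - A" C] that by auto
qed

lemma inner_upper: "closedin B C \<Longrightarrow> C \<subseteq> U \<Longrightarrow> ennreal (m C) \<le> inner U"
  unfolding inner_def by (rule SUP_upper) simp

lemma inner_mono: "U \<subseteq> V \<Longrightarrow> inner U \<le> inner V"
  unfolding inner_def by (rule SUP_subset_mono) auto

lemma inner_empty: "inner {} = 0"
  unfolding inner_def by (auto simp: m_empty intro!: antisym SUP_least)

text \<open>\<open>C - U\<close> and \<open>C - V\<close> are disjoint closed sets; normality
  separates them by open sets, and deleting one of these from \<open>C\<close> leaves a closed part
  inside \<open>U\<close>, deleting the other a closed part inside \<open>V\<close>. It yields
  subadditivity of \<open>inner\<close>.\<close>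

lemma closed_split:
  assumes C: "closedin B C" and U: "openin B U" and V: "openin B V" and "C \<subseteq> U \<union> V"
  obtains D E where "closedin B D" "closedin B E" "D \<subseteq> U" "E \<subseteq> V" "C = D \<union> E"
proof -
  have "normal_space B"
    using compact Hausdorff compact_Hausdorff_or_regular_imp_normal_space by blast
  moreover have "closedin B (C - U)" "closedin B (C - V)" "disjnt (C - U) (C - V)"
    using assms by (auto simp: closedin_diff disjnt_def)
  ultimately obtain G H where GH: "openin B G" "openin B H" "C - U \<subseteq> G" "C - V \<subseteq> H" "disjnt G H"
    unfolding normal_space_def by meson
  show thesis
    by (rule that[of "C - G" "C - H"]) (use GH C in \<open>auto simp: closedin_diff disjnt_iff\<close>)
qed

lemma inner_Un_le:
  assumes "openin B U" "openin B V"
  shows "inner (U \<union> V) \<le> inner U + inner V"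
  unfolding inner_def[of "U \<union> V"]
proof (rule SUP_least)
  fix C assume "C \<in> {C. closedin B C \<and> C \<subseteq> U \<union> V}"
  then have C: "closedin B C" "C \<subseteq> U \<union> V" by auto
  obtain D E where DE: "closedin B D" "closedin B E" "D \<subseteq> U" "E \<subseteq> V" "C = D \<union> E"
    by (rule closed_split[OF C(1) assms C(2)])
  have s: "D \<subseteq> topspace B" "E \<subseteq> topspace B" using closedin_subset[OF DE(1)] closedin_subset[OF DE(2)] by simp_all
  have "ennreal (m C) \<le> ennreal (m D) + ennreal (m E)"
    using m_Un_le[OF s] nonneg[OF s(1)] nonneg[OF s(2)] DE(5)
    by (simp flip: ennreal_plus)
  also have "\<dots> \<le> inner U + inner V" by (intro add_mono inner_upper DE)
  finally show "ennreal (m C) \<le> inner U + inner V" .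
qed

text \<open>Countable subadditivity out of finite additivity: a closed set inside the union is
  compact, so finitely many of the \<open>U i\<close> cover it already.\<close>

lemma inner_UN_le:
  assumes "\<And>i. openin B (U i)"
  shows "inner (\<Union>i. U i) \<le> (\<Sum>i. inner (U (i::nat)))"
  unfolding inner_def[of "\<Union>i. U i"]
proof (rule SUP_least)
  fix C assume "C \<in> {C. closedin B C \<and> C \<subseteq> (\<Union>i. U i)}"
  then have C: "closedin B C" "C \<subseteq> (\<Union>i. U i)" by auto
  have "compactin B C" using C(1) compact closedin_compact_space by blast
  then have "\<exists>F. finite F \<and> F \<subseteq> range U \<and> C \<subseteq> \<Union>F"
    using C(2) assms unfolding compactin_def by auto
  then obtain F where "finite F" "F \<subseteq> range U" "C \<subseteq> \<Union>F" by blast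
  then obtain I where I: "finite I" "C \<subseteq> (\<Union>i\<in>I. U i)"
    by (metis finite_subset_image)
  have fin: "inner (\<Union>i\<in>I. U i) \<le> (\<Sum>i\<in>I. inner (U i))" using I(1)
  proof (induction I)
    case (insert a I)
    have "inner (U a \<union> (\<Union>i\<in>I. U i)) \<le> inner (U a) + inner (\<Union>i\<in>I. U i)"
      by (rule inner_Un_le) (use assms in auto)
    also have "\<dots> \<le> inner (U a) + (\<Sum>i\<in>I. inner (U i))" using insert.IH by (rule add_left_mono)
    finally show ?case using insert by simp
  qed (simp add: inner_empty)
  have "ennreal (m C) \<le> inner (\<Union>i\<in>I. U i)" by (rule inner_upper[OF C(1) I(2)])
  also have "\<dots> \<le> (\<Sum>i. inner (U i))"
    using fin sum_le_suminf[of "\<lambda>i. inner (U i)" I] I(1) by (auto intro: order_trans)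
  finally show "ennreal (m C) \<le> (\<Sum>i. inner (U i))" .
qed

text \<open>The nontrivial half of Caratheodory's condition for an open test set \<open>V\<close>.
  Choose a closed \<open>C\<close> in \<open>V \<inter> U\<close> first and then a closed
  \<open>D\<close> in the open set \<open>V - C\<close>, which contains \<open>V - U\<close>. Then
  \<open>C\<close> and \<open>D\<close> are disjoint with closed union in \<open>V\<close>, so
  additivity of \<open>m\<close> applies; take suprema over \<open>D\<close>, then over
  \<open>C\<close>.\<close>

lemma inner_disjoint_closed:
  assumes U: "openin B U" and V: "openin B V"
  shows "inner (V \<inter> U) + outer (V - U) \<le> inner V"
proof -
  have "ennreal (m C) + outer (V - U) \<le> inner V" if C: "closedin B C" "C \<subseteq> V \<inter> U" for C
  proof -
    have oV: "openin B (V - C)" using V C by (simp add: openin_diff)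
    have CS: "C \<subseteq> topspace B" using C closedin_subset by auto
    have "ennreal (m C) + ennreal (m D) \<le> inner V" if D: "closedin B D" "D \<subseteq> V - C" for D
    proof -
      have DS: "D \<subseteq> topspace B" using D closedin_subset by auto
      have "m (C \<union> D) = m C + m D" by (rule additive[OF CS DS]) (use D in auto)
      then have "ennreal (m C) + ennreal (m D) = ennreal (m (C \<union> D))"
        using nonneg[OF CS] nonneg[OF DS] by simp
      also have "\<dots> \<le> inner V"
        by (rule inner_upper) (use C D in \<open>auto simp: closedin_Un\<close>)
      finally show ?thesis .
    qed
    moreover have "ennreal (m C) + inner (V - C)
        = (SUP D\<in>{D. closedin B D \<and> D \<subseteq> V - C}. ennreal (m C) + ennreal (m D))"
      unfolding inner_def by (rule ennreal_SUP_add_right) auto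
    ultimately have "ennreal (m C) + inner (V - C) \<le> inner V"
      by (simp add: SUP_le_iff)
    moreover have "outer (V - U) \<le> inner (V - C)"
      unfolding outer_def by (rule INF_lower) (use C oV in auto)
    ultimately show ?thesis by (meson add_left_mono order_trans)
  qed
  moreover have "inner (V \<inter> U) + outer (V - U)
      = (SUP C\<in>{C. closedin B C \<and> C \<subseteq> V \<inter> U}. ennreal (m C) + outer (V - U))"
    unfolding inner_def by (rule ennreal_SUP_add_left[symmetric]) auto
  ultimately show ?thesis by (simp add: SUP_le_iff)
qed

lemma outer_open: "openin B U \<Longrightarrow> outer U = inner U"
  unfolding outer_def by (intro antisym INF_lower INF_greatest inner_mono) auto

lemma outer_mono: "A \<subseteq> C \<Longrightarrow> outer A \<le> outer C"
  unfolding outer_def by (rule INF_superset_mono) auto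

lemma outer_topspace: "outer (topspace B) = 1"
proof -
  have "ennreal (m C) \<le> 1" if "closedin B C" for C
    using ennreal_leI[OF m_mono[OF closedin_subset[OF that] order_refl]] total by simp
  then have "inner (topspace B) \<le> 1"
    unfolding inner_def by (intro SUP_least) simp
  moreover have "1 \<le> inner (topspace B)"
    using inner_upper[of "topspace B" "topspace B"] total by simp
  ultimately have "inner (topspace B) = 1" by (rule antisym)
  then show ?thesis by (simp add: outer_open)
qed

lemma outer_measure_space_outer: "outer_measure_space (Pow (topspace B)) outer"
  unfolding outer_measure_space_def
proof (intro conjI)
  show "positive (Pow (topspace B)) outer"
    using outer_open[of "{}"] by (simp add: positive_def inner_empty)
  show "increasing (Pow (topspace B)) outer"
    by (simp add: increasing_def outer_mono)
  show "countably_subadditive (Pow (topspace B)) outer"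
    unfolding countably_subadditive_def
  proof (intro allI impI)
    fix A :: "nat \<Rightarrow> 'b set"
    assume A: "range A \<subseteq> Pow (topspace B)"
    show "outer (\<Union>i. A i) \<le> (\<Sum>i. outer (A i))"
    proof (rule ennreal_le_epsilon)
      fix e :: real assume e: "0 < e" and fin: "(\<Sum>i. outer (A i)) < top"
      have "\<forall>i. \<exists>U. openin B U \<and> A i \<subseteq> U \<and> inner U \<le> outer (A i) + ennreal (e * (1/2) ^ Suc i)"
      proof
        fix i
        have "outer (A i) < top"
          using ennreal_suminf_lessD[OF fin] .
        moreover have "0 < ennreal (e * (1/2) ^ Suc i)"
          using e by (simp add: ennreal_zero_less_mult_iff)
        ultimately have "outer (A i) + 0 < outer (A i) + ennreal (e * (1/2) ^ Suc i)"
          unfolding ennreal_add_left_cancel_less by auto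
        then have "(INF U\<in>{U. openin B U \<and> A i \<subseteq> U}. inner U) < outer (A i) + ennreal (e * (1/2) ^ Suc i)"
          unfolding outer_def[of "A i", symmetric] by simp
        then obtain U where "U \<in> {U. openin B U \<and> A i \<subseteq> U}"
          and "inner U < outer (A i) + ennreal (e * (1/2) ^ Suc i)"
          unfolding INF_less_iff by (elim bexE)
        then show "\<exists>U. openin B U \<and> A i \<subseteq> U \<and> inner U \<le> outer (A i) + ennreal (e * (1/2) ^ Suc i)"
          by (intro exI[of _ U]) simp
      qed
      from choice[OF this] obtain U where "\<forall>i. openin B (U i) \<and> A i \<subseteq> U i \<and>
          inner (U i) \<le> outer (A i) + ennreal (e * (1/2) ^ Suc i)" ..
      then have U: "openin B (U i)" "A i \<subseteq> U i"
        "inner (U i) \<le> outer (A i) + ennreal (e * (1/2) ^ Suc i)" for i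
        by (simp_all only:)
      have "outer (\<Union>i. A i) \<le> inner (\<Union>i. U i)"
        unfolding outer_def by (rule INF_lower) (use U in auto)
      also have "\<dots> \<le> (\<Sum>i. inner (U i))" by (rule inner_UN_le[OF U(1)])
      also have "\<dots> \<le> (\<Sum>i. outer (A i) + ennreal (e * (1/2) ^ Suc i))"
        by (rule suminf_le[OF U(3)]) auto
      also have "\<dots> = (\<Sum>i. outer (A i)) + (\<Sum>i. ennreal (e * (1/2) ^ Suc i))"
        by (rule suminf_add[symmetric]) auto
      also have "(\<Sum>i. ennreal (e * (1/2) ^ Suc i)) = ennreal e"
        using sums_mult[OF power_half_series, of e] e
        by (intro suminf_ennreal_eq) auto
      finally show "outer (\<Union>i. A i) \<le> (\<Sum>i. outer (A i)) + ennreal e" .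
    qed
  qed
qed

text \<open>An arbitrary test set \<open>A\<close> is reduced to the open sets \<open>V\<close>
  containing it, since \<open>outer A\<close> is an infimum over these.\<close>

lemma open_in_lambda_system:
  assumes U: "openin B U"
  shows "U \<in> lambda_system (topspace B) (Pow (topspace B)) outer"
proof -
  interpret sigma_algebra "topspace B" "Pow (topspace B)" by (rule sigma_algebra_Pow)
  have le: "outer (A \<inter> U) + outer (A - U) \<le> outer A" for A
    unfolding outer_def[of A]
  proof (rule INF_greatest)
    fix V assume "V \<in> {V. openin B V \<and> A \<subseteq> V}"
    then have V: "openin B V" "A \<subseteq> V" by auto
    have "outer (A \<inter> U) + outer (A - U) \<le> outer (V \<inter> U) + outer (V - U)"
      using V by (intro add_mono outer_mono) auto
    also have "\<dots> \<le> inner V"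
      using inner_disjoint_closed[OF U V(1)] outer_open[OF openin_Int[OF V(1) U]] by simp
    finally show "outer (A \<inter> U) + outer (A - U) \<le> inner V" .
  qed
  have "positive (Pow (topspace B)) outer" "countably_subadditive (Pow (topspace B)) outer"
    using outer_measure_space_outer unfolding outer_measure_space_def by auto
  then have sub: "subadditive (Pow (topspace B)) outer"
    by (intro countably_subadditive_subadditive)
  have ge: "outer A \<le> outer (A \<inter> U) + outer (A - U)" if "A \<subseteq> topspace B" for A
    using subadditiveD[OF sub, of "A \<inter> U" "A - U"] that by (auto simp: Int_Diff_Un)
  show ?thesis
    unfolding lambda_system_eq using openin_subset[OF U] le ge by (auto intro: antisym)
qed

definition radon :: "'b measure" where
  "radon = measure_of (topspace B) {U. openin B U} outer"

lemma space_radon: "space radon = topspace B"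
  unfolding radon_def by (rule space_measure_of) (auto dest: openin_subset)

lemma sets_radon: "sets radon = sigma_sets (topspace B) {U. openin B U}"
  unfolding radon_def by (rule sets_measure_of) (auto dest: openin_subset)

text \<open>\<open>measure_of\<close> takes the values of \<open>outer\<close> only once
  \<open>outer\<close> is known to be a measure on the generated sigma-algebra. Caratheodory
  provides this on the lambda-system, which contains the open sets and hence the Borel sets.\<close>

lemma emeasure_radon:
  assumes "A \<in> sets radon"
  shows "emeasure radon A = outer A"
proof -
  let ?L = "lambda_system (topspace B) (Pow (topspace B)) outer"
  let ?S = "sigma_sets (topspace B) {U. openin B U}"
  interpret sigma_algebra "topspace B" "Pow (topspace B)" by (rule sigma_algebra_Pow)
  have ms: "measure_space (topspace B) ?L outer"
    by (rule caratheodory_lemma[OF outer_measure_space_outer])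
  then interpret L: sigma_algebra "topspace B" ?L by (simp add: measure_space_def)
  have sub: "?S \<subseteq> ?L" by (rule L.sigma_sets_subset) (use open_in_lambda_system in auto)
  interpret S: sigma_algebra "topspace B" ?S
    by (rule sigma_algebra_sigma_sets) (auto dest: openin_subset)
  have "measure_space (topspace B) ?S outer"
    by (rule measure_down[OF ms S.sigma_algebra_axioms sub])
  then have "positive (sets radon) outer" "countably_additive (sets radon) outer"
    by (simp_all add: measure_space_def sets_radon)
  then show ?thesis
    by (intro emeasure_measure_of[OF radon_def] assms) (auto dest: openin_subset)
qed

lemma compactin_iff_closedin: "compactin B C \<longleftrightarrow> closedin B C"
  using compact Hausdorff closedin_compact_space compactin_imp_closedin by blast

lemma open_sets_radon: "openin B U \<Longrightarrow> U \<in> sets radon"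
  by (simp add: sets_radon sigma_sets.Basic)

lemma closed_sets_radon: "closedin B C \<Longrightarrow> C \<in> sets radon"
  using open_sets_radon[of "topspace B - C"] sets.compl_sets[of "topspace B - C" radon] closedin_subset[of B C]
  by (auto simp: space_radon double_diff)

lemma prob_space_radon: "prob_space radon"
  by (rule prob_spaceI)
    (use emeasure_radon[of "topspace B"] open_sets_radon[of "topspace B"] in
      \<open>simp add: space_radon outer_topspace\<close>)

lemma regular_borel_prob_radon: "regular_borel_prob B radon"
  unfolding regular_borel_prob_def
proof (intro conjI ballI prob_space_radon space_radon sets_radon)
  interpret prob_space radon by (rule prob_space_radon)
  have outer_reg: "emeasure radon A = (INF U\<in>{U. openin B U \<and> A \<subseteq> U}. emeasure radon U)"
    if A: "A \<in> sets radon" for A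
    unfolding emeasure_radon[OF A] outer_def
    by (intro INF_cong) (auto simp: emeasure_radon open_sets_radon outer_open)
  fix A assume A: "A \<in> sets radon"
  show "emeasure radon A = (INF U\<in>{U. openin B U \<and> A \<subseteq> U}. emeasure radon U)"
    by (rule outer_reg[OF A])
  have AS: "A \<subseteq> topspace B" using sets.sets_into_space[OF A] by (simp add: space_radon)
  show "emeasure radon A = (SUP K\<in>{K. compactin B K \<and> K \<subseteq> A}. emeasure radon K)"
  proof (rule antisym)
    show "(SUP K\<in>{K. compactin B K \<and> K \<subseteq> A}. emeasure radon K) \<le> emeasure radon A"
      using A by (intro SUP_least emeasure_mono) auto
    show "emeasure radon A \<le> (SUP K\<in>{K. compactin B K \<and> K \<subseteq> A}. emeasure radon K)"
      (is "_ \<le> ?s")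
    proof (rule ennreal_le_epsilon)
      fix e :: real assume e: "0 < e"
      \<comment> \<open>Outer regularity holds by construction. Inner regularity follows by
        complementation: the total mass is finite, and the complement of an open set containing
        \<open>?A'\<close> is a compact subset of \<open>A\<close>.\<close>
      let ?A' = "topspace B - A"
      have A': "?A' \<in> sets radon" using sets.compl_sets[OF A] by (simp add: space_radon)
      have "emeasure radon ?A' < emeasure radon ?A' + ennreal e"
        using e by (simp add: emeasure_eq_measure flip: ennreal_plus) (simp add: ennreal_lessI)
      then obtain U where U: "openin B U" "?A' \<subseteq> U" "emeasure radon U < emeasure radon ?A' + ennreal e"
        unfolding outer_reg[OF A'] INF_less_iff by (auto simp: outer_reg[OF A'])
      let ?C = "topspace B - U"
      have US: "U \<in> sets radon" by (rule open_sets_radon[OF U(1)])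
      have C: "closedin B ?C" "?C \<subseteq> A" using U by auto
      have "ennreal (measure radon U) < ennreal (measure radon ?A' + e)"
        using U(3) e by (simp add: emeasure_eq_measure flip: ennreal_plus)
      then have "measure radon U < measure radon ?A' + e" by (simp add: ennreal_less_iff)
      moreover have "measure radon ?A' = 1 - measure radon A" "measure radon ?C = 1 - measure radon U"
        using prob_compl[OF A] prob_compl[OF US] by (simp_all add: space_radon)
      ultimately have "measure radon A \<le> measure radon ?C + e" by simp
      then have "emeasure radon A \<le> emeasure radon ?C + ennreal e"
        using e by (simp add: emeasure_eq_measure flip: ennreal_plus)
      also have "emeasure radon ?C \<le> ?s"
        by (rule SUP_upper) (use C in \<open>simp add: compactin_iff_closedin\<close>)
      finally show "emeasure radon A \<le> ?s + ennreal e" by (simp add: add_right_mono)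
    qed
  qed
qed

text \<open>Every open set containing \<open>C\<close> has \<open>inner\<close> value at least
  \<open>m C\<close>. The inequality can be strict: \<open>m\<close> may vanish on \<open>C\<close>
  while charging each of its neighbourhoods, and that mass ends up on \<open>C\<close>.\<close>

lemma closed_le_radon:
  assumes "closedin B C"
  shows "m C \<le> measure radon C"
proof -
  interpret prob_space radon by (rule prob_space_radon)
  have "ennreal (m C) \<le> outer C"
    unfolding outer_def by (rule INF_greatest) (use assms inner_upper in auto)
  then show ?thesis
    using emeasure_radon[OF closed_sets_radon[OF assms]] ennreal_le_iff[of "measure radon C" "m C"]
    by (simp add: emeasure_eq_measure)
qed

end

section \<open>Domination of a mean by a Radon integral\<close>

lemma continuous_map_borel_measurable:
  assumes "regular_borel_prob B \<nu>" "continuous_map B euclideanreal g"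
  shows "g \<in> borel_measurable \<nu>"
proof (rule borel_measurableI)
  fix S :: "real set" assume "open S"
  then have "openin B {x \<in> topspace B. g x \<in> S}"
    using assms(2) by (auto simp: continuous_map_def)
  moreover have "{x \<in> topspace B. g x \<in> S} = g -` S \<inter> space \<nu>"
    using assms(1) by (auto simp: regular_borel_prob_def)
  ultimately show "g -` S \<inter> space \<nu> \<in> sets \<nu>"
    using assms(1) by (simp add: regular_borel_prob_def sigma_sets.Basic)
qed

lemma mean_on_mono:
  assumes L: "mean_on \<Omega> L" and f: "f \<in> bounded_funs_on \<Omega>" and g: "g \<in> bounded_funs_on \<Omega>"
    and le: "\<And>x. x \<in> \<Omega> \<Longrightarrow> f x \<le> g x"
  shows "L f \<le> L g"
proof -
  note E = fun_subspace_bounded_funs[of \<Omega>]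
  have lin: "linear_on (bounded_funs_on \<Omega>) L" using L by (simp add: mean_on_def)
  have "0 \<le> L (\<lambda>x. g x - f x)"
    using L fun_subspaceD(5)[OF E g f] le by (simp add: mean_on_def)
  then show ?thesis using linear_onD(4)[OF lin E g f] by simp
qed

lemma mean_on_cong:
  assumes "mean_on \<Omega> L" "f \<in> bounded_funs_on \<Omega>" "\<And>x. x \<in> \<Omega> \<Longrightarrow> f x = g x"
  shows "L f = L g"
proof -
  have "g \<in> bounded_funs_on \<Omega>" using assms(2,3) by (auto simp: bounded_funs_on_def)
  then show ?thesis
    using mean_on_mono[OF assms(1), of f g] mean_on_mono[OF assms(1), of g f] assms(2,3)
    by (intro antisym) auto
qed

text \<open>A layer-cake approximation from above with step \<open>h\<close>. The layers are the
  closed half-lines \<open>{real i * h..}\<close>, so that their preimages under a continuous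
  function are closed sets, as \<open>closed_le_radon\<close> requires.\<close>

lemma staircase_bounds:
  fixes y h :: real
  assumes y: "0 \<le> y" "y < real n * h" and h: "h > 0"
  shows "y \<le> (\<Sum>i<n. h * indicat_real {real i * h..} y)" "(\<Sum>i<n. h * indicat_real {real i * h..} y) \<le> y + h"
proof -
  define k where "k = nat \<lfloor>y / h\<rfloor>"
  have k: "real k = of_int \<lfloor>y / h\<rfloor>" using y h by (simp add: k_def)
  have kb: "real k * h \<le> y" "y < (real k + 1) * h"
    using h unfolding k by (simp_all add: pos_le_divide_eq[symmetric] pos_divide_less_eq[symmetric])
  have kn: "k < n"
  proof -
    have "real k * h < real n * h" using kb(1) y(2) by linarith
    then show ?thesis using h by simp
  qed
  have "real i * h \<le> y \<longleftrightarrow> i \<le> k" for i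
  proof
    assume "real i * h \<le> y"
    then have "real i * h < (real k + 1) * h" using kb by linarith
    then have "real i < real k + 1" using h by simp
    then show "i \<le> k" by linarith
  next
    assume "i \<le> k"
    then have "real i * h \<le> real k * h" using h by simp
    then show "real i * h \<le> y" using kb by linarith
  qed
  then have "(\<Sum>i<n. h * indicat_real {real i * h..} y) = (\<Sum>i<n. if i \<in> {..k} then h else 0)"
    by (intro sum.cong) (auto simp: indicator_def)
  also have "\<dots> = (\<Sum>i\<in>{..<n} \<inter> {..k}. h)" by (subst sum.inter_restrict) auto
  also have "{..<n} \<inter> {..k} = {..k}" using kn by auto
  \<comment> \<open>The layer \<open>i = 0\<close> always counts, so there are \<open>k + 1\<close>
    layers: the sum exceeds \<open>y\<close>, by at most \<open>h\<close>.\<close>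
  finally have "(\<Sum>i<n. h * indicat_real {real i * h..} y) = (real k + 1) * h" by (simp only: sum_constant card_atMost of_nat_Suc add.commute)
  then show "y \<le> (\<Sum>i<n. h * indicat_real {real i * h..} y)" "(\<Sum>i<n. h * indicat_real {real i * h..} y) \<le> y + h"
    using kb by (simp_all add: algebra_simps)
qed

text \<open>Replace \<open>g\<close> by a staircase over its closed superlevel sets, which lies
  above \<open>g\<close> and at most \<open>h\<close> higher. The mean of the staircase is a
  nonnegative combination of \<open>m\<close>-values of closed sets, so it grows when
  \<open>m\<close> is replaced by \<open>radon\<close>; then \<open>h\<close> tends to 0. Here
  \<open>m\<close> is the image under \<open>\<pi>\<close> of the finitely additive probability
  behind \<open>L\<close>.\<close>

theorem mean_dominated_by_radon:
  fixes \<pi> :: "'c \<Rightarrow> 'b"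
  assumes B: "compact_space B" "Hausdorff_space B"
    and L: "mean_on \<Omega> L" and \<pi>: "\<And>x. x \<in> \<Omega> \<Longrightarrow> \<pi> x \<in> topspace B"
  obtains \<nu> where "regular_borel_prob B \<nu>"
    "\<And>g R. continuous_map B euclideanreal g \<Longrightarrow> (\<And>y. y \<in> topspace B \<Longrightarrow> 0 \<le> g y \<and> g y \<le> R) \<Longrightarrow>
       L (\<lambda>x. g (\<pi> x)) \<le> (LINT y|\<nu>. g y)"
proof -
  note E = fun_subspace_bounded_funs[of \<Omega>]
  have lin: "linear_on (bounded_funs_on \<Omega>) L" using L by (simp add: mean_on_def)
  define m where "m A = L (\<lambda>x. indicat_real A (\<pi> x))" for A
  have ind: "(\<lambda>x. indicat_real A (\<pi> x)) \<in> bounded_funs_on \<Omega>" for A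
    by (auto simp: bounded_funs_on_def indicator_def intro!: exI[of _ 1])
  interpret fin_additive_prob B m
  proof
    show "0 \<le> m A" for A
      using L ind[of A] by (simp add: mean_on_def m_def)
    show "m (A \<union> C) = m A + m C" if "A \<inter> C = {}" for A C
    proof -
      have "m (A \<union> C) = L (\<lambda>x. indicat_real A (\<pi> x) + indicat_real C (\<pi> x))"
        unfolding m_def using that by (intro arg_cong[where f = L] ext indicator_add[symmetric])
      then show ?thesis by (simp add: m_def linear_onD(1)[OF lin ind ind])
    qed
    have "m (topspace B) = L (\<lambda>_. 1)"
      unfolding m_def by (rule mean_on_cong[OF L ind]) (simp add: \<pi>)
    then show "m (topspace B) = 1" using L by (simp add: mean_on_def)
  qed (use B in auto)
  interpret prob_space radon by (rule prob_space_radon)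
  show thesis
  proof (rule that[OF regular_borel_prob_radon])
    fix g R assume g: "continuous_map B euclideanreal g"
      and gb: "\<And>y. y \<in> topspace B \<Longrightarrow> 0 \<le> g y \<and> g y \<le> R"
    have meas: "g \<in> borel_measurable radon"
      by (rule continuous_map_borel_measurable[OF regular_borel_prob_radon g])
    have int: "integrable radon g"
      using gb by (intro integrable_const_bound[where B = R] AE_I2 meas) (auto simp: space_radon)
    have gE: "(\<lambda>x. g (\<pi> x)) \<in> bounded_funs_on \<Omega>"
      using gb[OF \<pi>] by (auto simp: bounded_funs_on_def intro!: exI[of _ R])
    show "L (\<lambda>x. g (\<pi> x)) \<le> (LINT y|radon. g y)"
    proof (rule field_le_epsilon)
      fix h :: real assume h: "h > 0"
      \<comment> \<open>Enough layers of height \<open>h\<close> to exceed the bound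
        \<open>R\<close> of \<open>g\<close>.\<close>
      obtain n where n: "R / h < real n" using reals_Archimedean2 by blast
      define C where "C i = {y \<in> topspace B. g y \<in> {real i * h..}}" for i :: nat
      have cl: "closedin B (C i)" for i
        unfolding C_def by (rule closedin_continuous_map_preimage[OF g]) simp
      have indint: "integrable radon (\<lambda>y. h * indicat_real (C i) y)" for i
        by (intro integrable_mult_right integrable_real_indicator closed_sets_radon cl)
          (simp add: emeasure_eq_measure)
      have stair: "g y \<le> (\<Sum>i<n. h * indicat_real (C i) y)" "(\<Sum>i<n. h * indicat_real (C i) y) \<le> g y + h"
        if y: "y \<in> topspace B" for y
      proof -
        have "indicat_real (C i) y = indicat_real {real i * h..} (g y)" for i
          using y by (simp add: C_def indicator_def)
        moreover have "g y < real n * h" using n h gb[OF y] by (simp add: pos_divide_less_eq)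
        ultimately show "g y \<le> (\<Sum>i<n. h * indicat_real (C i) y)"
          "(\<Sum>i<n. h * indicat_real (C i) y) \<le> g y + h"
          using staircase_bounds[of "g y" n h] gb[OF y] h by simp_all
      qed
      note hind = fun_subspaceD(3)[OF E ind]
      have "L (\<lambda>x. g (\<pi> x)) \<le> L (\<lambda>x. \<Sum>i<n. h * indicat_real (C i) (\<pi> x))"
        by (rule mean_on_mono[OF L gE fun_subspace_sum[OF E hind]]) (rule stair(1)[OF \<pi>])
      also have "\<dots> = (\<Sum>i<n. h * m (C i))"
        by (simp only: linear_on_sum[OF E lin hind] linear_onD(2)[OF lin ind] m_def)
      also have "\<dots> \<le> (\<Sum>i<n. h * measure radon (C i))"
        using h by (intro sum_mono mult_left_mono closed_le_radon cl) simp
      also have "\<dots> = (LINT y|radon. (\<Sum>i<n. h * indicat_real (C i) y))"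
        using closed_sets_radon[OF cl] indint
        by (subst Bochner_Integration.integral_sum) auto
      also have "\<dots> \<le> (LINT y|radon. g y + h)"
        using int stair(2)
        by (intro integral_mono Bochner_Integration.integrable_sum indint) (auto simp: space_radon)
      also have "\<dots> = (LINT y|radon. g y) + h"
        using int prob_space by simp
      finally show "L (\<lambda>x. g (\<pi> x)) \<le> (LINT y|radon. g y) + h" .
    qed
  qed
qed

section \<open>Inequalities\<close>

text \<open>Jensen's inequality for \<open>exp\<close> at the points \<open>ln (b j)\<close>. If
  some \<open>b j\<close> is 0, the product vanishes, because \<open>0 powr \<theta> j\<close> is 0
  for every exponent, the exponent 0 included.\<close>

lemma weighted_arith_geo_mean:
  fixes \<theta> b :: "'i \<Rightarrow> real"
  assumes J: "finite J" and \<theta>: "\<And>j. j \<in> J \<Longrightarrow> 0 \<le> \<theta> j" "sum \<theta> J = 1"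
    and b: "\<And>j. j \<in> J \<Longrightarrow> 0 \<le> b j"
  shows "(\<Prod>j\<in>J. b j powr \<theta> j) \<le> (\<Sum>j\<in>J. \<theta> j * b j)"
proof (cases "\<exists>j\<in>J. b j = 0")
  case True
  then have "(\<Prod>j\<in>J. b j powr \<theta> j) = 0" using J by force
  then show ?thesis using \<theta> b by (simp add: sum_nonneg)
next
  case False
  have "(\<Prod>j\<in>J. b j powr \<theta> j) = exp (\<Sum>j\<in>J. \<theta> j *\<^sub>R ln (b j))"
    using False by (simp add: exp_sum[OF J] powr_def)
  also have "\<dots> \<le> (\<Sum>j\<in>J. \<theta> j * exp (ln (b j)))"
    using convex_on_sum[OF J _ exp_convex \<theta>(2,1), of "\<lambda>j. ln (b j)"] \<theta>(2) J by force
  also have "\<dots> = (\<Sum>j\<in>J. \<theta> j * b j)"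
    using False b by (intro sum.cong) (auto simp: less_le)
  finally show ?thesis .
qed

text \<open>Divide each \<open>a j\<close> by its sum \<open>A j\<close>, apply AM--GM for every
  \<open>k\<close>, and add over \<open>k\<close>: the right-hand sides add up to the sum of the
  weights, which is 1.\<close>

lemma Holder_sum_prod:
  fixes \<theta> :: "'i \<Rightarrow> real" and a :: "'i \<Rightarrow> 'k \<Rightarrow> real"
  assumes J: "finite J" and \<theta>: "\<And>j. j \<in> J \<Longrightarrow> 0 < \<theta> j" "sum \<theta> J = 1"
    and a: "\<And>j k. j \<in> J \<Longrightarrow> k \<in> K \<Longrightarrow> 0 \<le> a j k"
  shows "(\<Sum>k\<in>K. \<Prod>j\<in>J. a j k powr \<theta> j) \<le> (\<Prod>j\<in>J. (\<Sum>k\<in>K. a j k) powr \<theta> j)"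
proof (cases "finite K")
  case K: True
  define A where "A j = (\<Sum>k\<in>K. a j k)" for j
  have A0: "0 \<le> A j" if "j \<in> J" for j unfolding A_def using a[OF that] by (simp add: sum_nonneg)
  show ?thesis
  proof (cases "\<exists>j\<in>J. A j = 0")
    case True
    then obtain i where i: "i \<in> J" "A i = 0" by blast
    have "a i k = 0" if "k \<in> K" for k
      using i(2) that a[OF i(1)] K unfolding A_def by (simp add: sum_nonneg_eq_0_iff)
    then have "(\<Prod>j\<in>J. a j k powr \<theta> j) = 0" if "k \<in> K" for k
      using i(1) J that by (intro prod_zero) auto
    then show ?thesis by (simp add: prod_nonneg)
  next
    case False
    then have Apos: "0 < A j" if "j \<in> J" for j using A0[OF that] that by force
    have "(\<Prod>j\<in>J. a j k powr \<theta> j) \<le> (\<Prod>j\<in>J. A j powr \<theta> j) * (\<Sum>j\<in>J. \<theta> j * (a j k / A j))"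
      if k: "k \<in> K" for k
    proof -
      have "(\<Prod>j\<in>J. (a j k / A j) powr \<theta> j) \<le> (\<Sum>j\<in>J. \<theta> j * (a j k / A j))"
        using a Apos \<theta> k by (intro weighted_arith_geo_mean J) (auto intro: less_imp_le divide_nonneg_pos)
      then have "(\<Prod>j\<in>J. A j powr \<theta> j) * (\<Prod>j\<in>J. (a j k / A j) powr \<theta> j)
          \<le> (\<Prod>j\<in>J. A j powr \<theta> j) * (\<Sum>j\<in>J. \<theta> j * (a j k / A j))"
        by (intro mult_left_mono prod_nonneg) auto
      moreover have "(\<Prod>j\<in>J. A j powr \<theta> j) * (\<Prod>j\<in>J. (a j k / A j) powr \<theta> j) = (\<Prod>j\<in>J. a j k powr \<theta> j)"
        unfolding prod.distrib[symmetric]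
      proof (intro prod.cong refl)
        fix j assume j: "j \<in> J"
        show "A j powr \<theta> j * (a j k / A j) powr \<theta> j = a j k powr \<theta> j"
          using Apos[OF j] a[OF j k] by (simp add: powr_divide)
      qed
      ultimately show ?thesis by simp
    qed
    then have "(\<Sum>k\<in>K. \<Prod>j\<in>J. a j k powr \<theta> j)
        \<le> (\<Sum>k\<in>K. (\<Prod>j\<in>J. A j powr \<theta> j) * (\<Sum>j\<in>J. \<theta> j * (a j k / A j)))"
      by (rule sum_mono)
    also have "\<dots> = (\<Prod>j\<in>J. A j powr \<theta> j) * (\<Sum>j\<in>J. \<theta> j * ((\<Sum>k\<in>K. a j k) / A j))"
      unfolding sum_distrib_left[symmetric] sum_divide_distrib
      by (subst sum.swap) (simp add: sum_distrib_left)
    also have "(\<Sum>j\<in>J. \<theta> j * ((\<Sum>k\<in>K. a j k) / A j)) = sum \<theta> J"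
      using Apos by (intro sum.cong) (simp_all add: A_def[symmetric] less_imp_neq[symmetric])
    finally show ?thesis using \<theta>(2) by (simp add: A_def)
  qed
qed (simp add: prod_nonneg)

text \<open>For positive arguments this is convexity of the power function. If one argument is 0,
  what remains is \<open>s powr p \<le> s\<close> for \<open>0 < s < 1\<close>.\<close>

lemma powr_convex_combination:
  fixes u v t p :: real
  assumes p: "1 \<le> p" and u: "0 \<le> u" and v: "0 \<le> v" and t: "0 < t" "t < 1"
  shows "((1 - t) * u + t * v) powr p \<le> (1 - t) * u powr p + t * v powr p"
proof -
  have *: "(s * w) powr p \<le> s * w powr p" if "0 < s" "s < 1" "0 \<le> w" for s w :: real
    using that p powr_mono'[of 1 p s] by (simp add: powr_mult mult_right_mono)
  consider "u = 0" | "v = 0" | "u > 0" "v > 0" using u v by linarith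
  then show ?thesis
  proof cases
    case 3
    then show ?thesis using convex_onD[OF powr_convex[OF p], of t u v] t by simp
  qed (use * t u v in simp_all)
qed

text \<open>Convexity at \<open>x / a\<close> and \<open>y / b\<close> with weights proportional to
  \<open>a\<close> and \<open>b\<close>. The bound is linear in \<open>\<bar>x\<bar> powr p\<close>
  and \<open>\<bar>y\<bar> powr p\<close>, so a positive functional or an integral can be applied to
  it; optimizing over \<open>a\<close> and \<open>b\<close> afterwards gives Minkowski's inequality
  (\<open>Minkowski_from_convexity\<close>).\<close>

lemma powr_abs_add_le:
  fixes x y a b p :: real
  assumes p: "1 \<le> p" and a: "0 < a" and b: "0 < b"
  shows "\<bar>x + y\<bar> powr p \<le>
    (a + b) powr p * (a / (a + b) / a powr p) * \<bar>x\<bar> powr p + (a + b) powr p * (b / (a + b) / b powr p) * \<bar>y\<bar> powr p"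
proof -
  define t where "t = b / (a + b)"
  have t: "0 < t" "t < 1" "1 - t = a / (a + b)" using a b by (auto simp: t_def field_simps)
  have "\<bar>x + y\<bar> powr p \<le> (\<bar>x\<bar> + \<bar>y\<bar>) powr p" using p by (intro powr_mono2) auto
  also have "\<bar>x\<bar> + \<bar>y\<bar> = (a + b) * ((1 - t) * (\<bar>x\<bar> / a) + t * (\<bar>y\<bar> / b))"
  proof -
    have "(a + b) * (1 - t) = a" "(a + b) * t = b" unfolding t(3) unfolding t_def using a b by simp_all
    then have "(a + b) * ((1 - t) * (\<bar>x\<bar> / a) + t * (\<bar>y\<bar> / b)) = a * (\<bar>x\<bar> / a) + b * (\<bar>y\<bar> / b)"
      by (simp only: distrib_left mult.assoc[symmetric])
    then show ?thesis using a b by simp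
  qed
  also have "\<dots> powr p = (a + b) powr p * ((1 - t) * (\<bar>x\<bar> / a) + t * (\<bar>y\<bar> / b)) powr p"
    using a b t by (simp add: powr_mult)
  also have "\<dots> \<le> (a + b) powr p * ((1 - t) * (\<bar>x\<bar> / a) powr p + t * (\<bar>y\<bar> / b) powr p)"
    using a b by (intro mult_left_mono powr_convex_combination p t) auto
  also have "\<dots> = (a + b) powr p * (a / (a + b) / a powr p) * \<bar>x\<bar> powr p
      + (a + b) powr p * (b / (a + b) / b powr p) * \<bar>y\<bar> powr p"
    unfolding t(3) unfolding t_def using a b by (simp add: powr_divide algebra_simps)
  finally show ?thesis .
qed

section \<open>Hoelder duality on the unit ball of ell_r\<close>

lemma r_exponent_less:
  assumes "1 \<le> p" "p < q"
  shows "r_exponent p q = ereal (p * q / (q - p))" "0 < p * q / (q - p)"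
  using assms by (auto simp: r_exponent_def field_simps)

lemma ell_ball_abs_le_1:
  assumes p: "1 \<le> p" "p \<le> q" and \<beta>: "ell_norm (r_exponent p q) n \<beta> \<le> 1" and k: "k < n"
  shows "\<bar>\<beta> k\<bar> \<le> 1"
proof (cases "p = q")
  case True
  have "\<bar>\<beta> k\<bar> \<le> Max (insert 0 ((\<lambda>k. \<bar>\<beta> k\<bar>) ` {..<n}))"
    using k by (intro Max_ge) auto
  also have "\<dots> \<le> 1" using \<beta> True by (simp only: ell_norm_def r_exponent_def if_True refl)
  finally show ?thesis .
next
  case False
  define r where "r = p * q / (q - p)"
  have r: "r_exponent p q = ereal r" "0 < r"
    using r_exponent_less[of p q] p False by (auto simp: r_def)
  have "\<bar>\<beta> k\<bar> = (\<bar>\<beta> k\<bar> powr r) powr (1 / r)" using r(2) by (simp add: powr_powr)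
  also have "\<dots> \<le> (\<Sum>k<n. \<bar>\<beta> k\<bar> powr r) powr (1 / r)"
    using r(2) k by (intro powr_mono2 member_le_sum) auto
  also have "\<dots> \<le> 1" using \<beta> r by (simp add: ell_norm_def)
  finally show ?thesis .
qed

text \<open>Hoelder with the conjugate exponents q/p and r/p, since p/q + p/r = 1. For p = q the
  ball is that of the maximum norm, and all factors \<open>\<bar>\<beta> k\<bar>\<close> are at most
  1.\<close>

lemma ell_ball_Holder:
  assumes p: "1 \<le> p" "p \<le> q" and \<beta>: "ell_norm (r_exponent p q) n \<beta> \<le> 1"
    and a: "\<And>k. k < n \<Longrightarrow> 0 \<le> a k"
  shows "(\<Sum>k<n. \<bar>\<beta> k\<bar> powr p * a k) \<le> (\<Sum>k<n. a k powr (q / p)) powr (p / q)"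
proof (cases "p = q")
  case True
  have "(\<Sum>k<n. \<bar>\<beta> k\<bar> powr p * a k) \<le> (\<Sum>k<n. a k)"
    using a ell_ball_abs_le_1[OF p \<beta>] p by (intro sum_mono mult_left_le_one_le powr_le1) auto
  then show ?thesis using True p a by (simp add: sum_nonneg)
next
  case False
  define r where "r = p * q / (q - p)"
  have r: "r_exponent p q = ereal r" "0 < r"
    using r_exponent_less[of p q] p False by (auto simp: r_def)
  have pr: "p / r = 1 - p / q" using p False by (simp add: r_def field_simps)
  have "(\<Sum>k<n. \<bar>\<beta> k\<bar> powr r) powr (1 / r) \<le> 1" using \<beta> r by (simp add: ell_norm_def)
  then have ball: "(\<Sum>k<n. \<bar>\<beta> k\<bar> powr r) powr (p / r) \<le> 1"
    using powr_mono2[of p "(\<Sum>k<n. \<bar>\<beta> k\<bar> powr r) powr (1 / r)" 1] p by (simp add: powr_powr)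
  \<comment> \<open>The two-factor inequality is the case of \<open>Holder_sum_prod\<close> with
    index type \<open>bool\<close>.\<close>
  define c where "c j k = (if j then a k powr (q / p) else \<bar>\<beta> k\<bar> powr r)" for j k
  define \<theta> where "\<theta> j = (if j then p / q else p / r)" for j
  have "(\<Sum>k<n. \<Prod>j\<in>UNIV. c j k powr \<theta> j) \<le> (\<Prod>j\<in>UNIV. (\<Sum>k<n. c j k) powr \<theta> j)"
    using p False r(2) pr by (intro Holder_sum_prod) (auto simp: c_def \<theta>_def UNIV_bool)
  moreover have "(\<Prod>j\<in>UNIV. c j k powr \<theta> j) = \<bar>\<beta> k\<bar> powr p * a k" if "k < n" for k
    using p r(2) a[OF that] by (simp add: UNIV_bool c_def \<theta>_def powr_powr)
  ultimately have "(\<Sum>k<n. \<bar>\<beta> k\<bar> powr p * a k)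
      \<le> (\<Sum>k<n. a k powr (q / p)) powr (p / q) * (\<Sum>k<n. \<bar>\<beta> k\<bar> powr r) powr (p / r)"
    by (simp add: UNIV_bool c_def \<theta>_def mult.commute)
  also have "\<dots> \<le> (\<Sum>k<n. a k powr (q / p)) powr (p / q)"
    using ball by (intro mult_right_le_one_le) auto
  finally show ?thesis .
qed

text \<open>The equality case of Hoelder's inequality: \<open>\<bar>\<beta> k\<bar> powr r\<close>
  proportional to \<open>a k powr (q / p)\<close>. For p = q it is the constant 1.\<close>

lemma ell_ball_Holder_extremal:
  assumes p: "1 \<le> p" "p \<le> q" and a: "\<And>k. k < n \<Longrightarrow> 0 \<le> a k"
  obtains \<beta> where "ell_norm (r_exponent p q) n \<beta> \<le> 1"
    "(\<Sum>k<n. \<bar>\<beta> k\<bar> powr p * a k) = (\<Sum>k<n. a k powr (q / p)) powr (p / q)"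
proof (cases "p = q")
  case True
  have "ell_norm (r_exponent p q) n (\<lambda>_. 1) \<le> 1"
    using True by (auto simp: ell_norm_def r_exponent_def)
  then show thesis
    by (rule that) (use True p sum_nonneg[of "{..<n}" a] a in simp)
next
  case False
  define r where "r = p * q / (q - p)"
  have r: "r_exponent p q = ereal r" "0 < r"
    using r_exponent_less[of p q] p False by (auto simp: r_def)
  have pr: "p / r = 1 - p / q" using p False by (simp add: r_def field_simps)
  define A where "A = (\<Sum>k<n. a k powr (q / p))"
  have A0: "0 \<le> A" by (simp add: A_def sum_nonneg)
  show thesis
  proof (cases "A = 0")
    case True
    then have "a k = 0" if "k < n" for k
      using that unfolding A_def by (simp add: sum_nonneg_eq_0_iff)
    then show thesis
      by (intro that[of "\<lambda>_. 0"]) (use r True in \<open>auto simp: ell_norm_def A_def\<close>)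
  next
    case False
    then have A: "0 < A" using A0 by simp
    \<comment> \<open>Dividing by \<open>A\<close> makes the r-th powers sum to exactly 1.\<close>
    define \<beta> where "\<beta> k = (a k powr (q / p) / A) powr (1 / r)" for k
    have "(\<Sum>k<n. \<bar>\<beta> k\<bar> powr r) = (\<Sum>k<n. a k powr (q / p) / A)"
      using r(2) A by (intro sum.cong) (auto simp: \<beta>_def powr_powr)
    also have "\<dots> = 1" using A by (simp add: A_def flip: sum_divide_distrib)
    finally have 1: "ell_norm (r_exponent p q) n \<beta> \<le> 1" using r by (simp add: ell_norm_def)
    have summand: "\<bar>\<beta> k\<bar> powr p * a k = a k powr (q / p) / A powr (p / r)" if k: "k < n" for k
    proof -
      have "\<bar>\<beta> k\<bar> powr p = a k powr (q / p * (p / r)) / A powr (p / r)"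
        using A by (simp add: \<beta>_def powr_powr powr_divide)
      moreover have "a k powr (q / p * (p / r)) * a k = a k powr (q / p * (p / r) + 1)"
        using a[OF k] by (simp add: powr_add)
      moreover have "q / p * (p / r) + 1 = q / p"
        unfolding pr using p by (simp add: field_simps)
      ultimately show ?thesis by (simp only: times_divide_eq_left)
    qed
    have "(\<Sum>k<n. \<bar>\<beta> k\<bar> powr p * a k) = A / A powr (p / r)"
      by (simp add: summand A_def flip: sum_divide_distrib)
    also have "\<dots> = A powr (1 - p / r)" using A by (simp add: powr_diff)
    also have "1 - p / r = p / q" using pr by simp
    finally show thesis using that[OF 1] by (simp add: A_def)
  qed
qed

section \<open>Quotients and completions of seminormed spaces\<close>

text \<open>The records carry no vector space laws, so the axioms state, in terms of distances, just
  what the completion needs. Both \<open>quotient_space\<close> and \<open>Cauchy_space\<close>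
  inherit all of them, so one locale serves every stage of the construction.\<close>

locale pseudonormed =
  fixes V :: "'v seminormed"
  assumes plus_closed: "x \<in> vcarrier V \<Longrightarrow> y \<in> vcarrier V \<Longrightarrow> vplus V x y \<in> vcarrier V"
    and scale_closed: "x \<in> vcarrier V \<Longrightarrow> vscale V c x \<in> vcarrier V"
    and dist_self: "x \<in> vcarrier V \<Longrightarrow> vdist V x x = 0"
    and dist_commute: "x \<in> vcarrier V \<Longrightarrow> y \<in> vcarrier V \<Longrightarrow> vdist V x y = vdist V y x"
    and dist_triangle: "x \<in> vcarrier V \<Longrightarrow> y \<in> vcarrier V \<Longrightarrow> z \<in> vcarrier V \<Longrightarrow>
      vdist V x z \<le> vdist V x y + vdist V y z"
    and dist_plus: "x \<in> vcarrier V \<Longrightarrow> y \<in> vcarrier V \<Longrightarrow> x' \<in> vcarrier V \<Longrightarrow> y' \<in> vcarrier V \<Longrightarrow>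
      vdist V (vplus V x y) (vplus V x' y') \<le> vdist V x x' + vdist V y y'"
    and dist_scale: "x \<in> vcarrier V \<Longrightarrow> y \<in> vcarrier V \<Longrightarrow>
      vdist V (vscale V c x) (vscale V c y) = \<bar>c\<bar> * vdist V x y"
    and norm_dist: "x \<in> vcarrier V \<Longrightarrow> y \<in> vcarrier V \<Longrightarrow> \<bar>vnorm V x - vnorm V y\<bar> \<le> vdist V x y"
begin

lemma dist_nonneg: "x \<in> vcarrier V \<Longrightarrow> y \<in> vcarrier V \<Longrightarrow> 0 \<le> vdist V x y"
  using norm_dist[of x y] by linarith

lemma equiv_null_rel: "equiv (vcarrier V) (null_rel V)"
proof (rule equivI)
  show "null_rel V \<subseteq> vcarrier V \<times> vcarrier V" by (auto simp: null_rel_def)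
  show "refl_on (vcarrier V) (null_rel V)"
    by (auto simp: refl_on_def null_rel_def dist_self)
  show "sym (null_rel V)"
    by (auto simp: sym_def null_rel_def dist_commute)
  show "trans (null_rel V)"
  proof (rule transI)
    fix x y z assume "(x, y) \<in> null_rel V" "(y, z) \<in> null_rel V"
    then show "(x, z) \<in> null_rel V"
      using dist_triangle[of x y z] dist_nonneg[of x z] by (simp add: null_rel_def)
  qed
qed

lemma mem_vclass: "y \<in> vclass V x \<longleftrightarrow> x \<in> vcarrier V \<and> y \<in> vcarrier V \<and> vdist V x y = 0"
  by (simp add: vclass_def null_rel_def)

lemma vclass_eq_iff:
  "x \<in> vcarrier V \<Longrightarrow> y \<in> vcarrier V \<Longrightarrow> vclass V x = vclass V y \<longleftrightarrow> vdist V x y = 0"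
  unfolding vclass_def using eq_equiv_class_iff[OF equiv_null_rel, of x y] by (simp add: null_rel_def)

lemma quotient_carrier: "vcarrier (quotient_space V) = vclass V ` vcarrier V"
  by (auto simp: quotient_space_def quotient_def vclass_def)

lemma quotient_plus:
  assumes x: "x \<in> vcarrier V" and y: "y \<in> vcarrier V"
  shows "vplus (quotient_space V) (vclass V x) (vclass V y) = vclass V (vplus V x y)"
proof -
  have eq: "vclass V (vplus V a b) = vclass V (vplus V x y)" if "a \<in> vclass V x" "b \<in> vclass V y" for a b
  proof -
    have ab: "a \<in> vcarrier V" "b \<in> vcarrier V" "vdist V x a = 0" "vdist V y b = 0"
      using that by (simp_all add: mem_vclass)
    have "vdist V (vplus V x y) (vplus V a b) = 0"
      using dist_plus[OF x y ab(1,2)] dist_nonneg[OF plus_closed[OF x y] plus_closed[OF ab(1,2)]] ab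
      by simp
    then show ?thesis
      using vclass_eq_iff[OF plus_closed[OF x y] plus_closed[OF ab(1,2)]] by simp
  qed
  have "x \<in> vclass V x" "y \<in> vclass V y" using x y by (simp_all add: mem_vclass dist_self)
  then have ne: "vclass V x \<noteq> {}" "vclass V y \<noteq> {}" by blast+
  have "vplus (quotient_space V) (vclass V x) (vclass V y)
      = (\<Union>a\<in>vclass V x. \<Union>b\<in>vclass V y. vclass V (vplus V x y))"
    unfolding quotient_space_def by (simp cong: SUP_cong add: eq)
  then show ?thesis using ne by simp
qed

lemma quotient_scale:
  assumes x: "x \<in> vcarrier V"
  shows "vscale (quotient_space V) c (vclass V x) = vclass V (vscale V c x)"
proof -
  have eq: "vclass V (vscale V c a) = vclass V (vscale V c x)" if "a \<in> vclass V x" for a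
  proof -
    have a: "a \<in> vcarrier V" "vdist V x a = 0" using that by (simp_all add: mem_vclass)
    show ?thesis
      using vclass_eq_iff[OF scale_closed[OF x] scale_closed[OF a(1)], of c c] dist_scale[OF x a(1), of c] a
      by simp
  qed
  have "x \<in> vclass V x" using x by (simp add: mem_vclass dist_self)
  then have ne: "vclass V x \<noteq> {}" by blast
  have "vscale (quotient_space V) c (vclass V x) = (\<Union>a\<in>vclass V x. vclass V (vscale V c x))"
    unfolding quotient_space_def by (simp cong: SUP_cong add: eq)
  then show ?thesis using ne by simp
qed

lemma quotient_norm:
  assumes x: "x \<in> vcarrier V"
  shows "vnorm (quotient_space V) (vclass V x) = vnorm V x"
proof -
  have eq: "vnorm V a = vnorm V x" if "a \<in> vclass V x" for a
    using that norm_dist[of x a] by (simp add: mem_vclass)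
  have x': "x \<in> vclass V x" using x by (simp add: mem_vclass dist_self)
  have "vnorm V ` vclass V x = (\<lambda>_. vnorm V x) ` vclass V x" by (rule image_cong[OF refl eq])
  then have "vnorm V ` vclass V x = {vnorm V x}" using x' by force
  then show ?thesis by (simp add: quotient_space_def)
qed

lemma quotient_dist:
  assumes "x \<in> vcarrier V" "y \<in> vcarrier V"
  shows "vdist (quotient_space V) (vclass V x) (vclass V y) = vdist V x y"
  using assms by (simp add: vdist_def quotient_scale quotient_plus quotient_norm plus_closed scale_closed)

lemma pseudonormed_quotient: "pseudonormed (quotient_space V)"
proof
qed (auto simp: quotient_carrier quotient_plus quotient_scale quotient_dist quotient_norm
      plus_closed scale_closed dist_self dist_triangle dist_plus dist_scale norm_dist
      intro: dist_commute)

section \<open>The space of Cauchy sequences\<close>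

lemma vCauchyD:
  assumes "vCauchy V u"
  shows "u n \<in> vcarrier V" "e > 0 \<Longrightarrow> \<exists>n0. \<forall>i\<ge>n0. \<forall>k\<ge>n0. vdist V (u i) (u k) < e"
  using assms unfolding vCauchy_def by auto

lemma Cauchy_dist:
  assumes u: "vCauchy V u" and v: "vCauchy V v"
  shows "convergent (\<lambda>n. vdist V (u n) (v n))"
proof (rule Cauchy_convergent, rule CauchyI)
  fix e :: real assume e: "0 < e"
  obtain n1 where n1: "\<forall>i\<ge>n1. \<forall>k\<ge>n1. vdist V (u i) (u k) < e / 2"
    using vCauchyD(2)[OF u, of "e/2"] e by auto
  obtain n2 where n2: "\<forall>i\<ge>n2. \<forall>k\<ge>n2. vdist V (v i) (v k) < e / 2"
    using vCauchyD(2)[OF v, of "e/2"] e by auto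
  have "norm (vdist V (u i) (v i) - vdist V (u k) (v k)) < e" if ik: "i \<ge> max n1 n2" "k \<ge> max n1 n2" for i k
  proof -
    note c = vCauchyD(1)[OF u] vCauchyD(1)[OF v]
    have le: "vdist V (u a) (v a) - vdist V (u b) (v b) \<le> vdist V (u a) (u b) + vdist V (v a) (v b)" for a b
      using dist_triangle[OF c(1)[of a] c(1)[of b] c(2)[of a]]
        dist_triangle[OF c(1)[of b] c(2)[of b] c(2)[of a]] dist_commute[OF c(2)[of a] c(2)[of b]] by linarith
    have "vdist V (u i) (u k) < e / 2" "vdist V (v i) (v k) < e / 2"
      "vdist V (u k) (u i) < e / 2" "vdist V (v k) (v i) < e / 2"
      using n1 n2 ik by auto
    then show ?thesis using le[of i k] le[of k i] by (simp add: abs_less_iff)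
  qed
  then show "\<exists>M. \<forall>m\<ge>M. \<forall>n\<ge>M. norm (vdist V (u m) (v m) - vdist V (u n) (v n)) < e" by blast
qed

lemma Cauchy_norm:
  assumes u: "vCauchy V u"
  shows "convergent (\<lambda>n. vnorm V (u n))"
proof (rule Cauchy_convergent, rule CauchyI)
  fix e :: real assume e: "0 < e"
  obtain n1 where n1: "\<forall>i\<ge>n1. \<forall>k\<ge>n1. vdist V (u i) (u k) < e"
    using vCauchyD(2)[OF u e] by auto
  have "norm (vnorm V (u i) - vnorm V (u k)) < e" if "i \<ge> n1" "k \<ge> n1" for i k
    using norm_dist[OF vCauchyD(1)[OF u] vCauchyD(1)[OF u], of i k] n1 that by (simp add: le_less_trans)
  then show "\<exists>M. \<forall>m\<ge>M. \<forall>n\<ge>M. norm (vnorm V (u m) - vnorm V (u n)) < e" by blast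
qed

lemma vCauchy_plus:
  assumes u: "vCauchy V u" and v: "vCauchy V v"
  shows "vCauchy V (\<lambda>n. vplus V (u n) (v n))"
  unfolding vCauchy_def
proof (intro conjI allI impI)
  show "vplus V (u n) (v n) \<in> vcarrier V" for n
    by (intro plus_closed vCauchyD(1)[OF u] vCauchyD(1)[OF v])
  fix e :: real assume e: "0 < e"
  obtain n1 where n1: "\<forall>i\<ge>n1. \<forall>k\<ge>n1. vdist V (u i) (u k) < e / 2"
    using vCauchyD(2)[OF u, of "e/2"] e by auto
  obtain n2 where n2: "\<forall>i\<ge>n2. \<forall>k\<ge>n2. vdist V (v i) (v k) < e / 2"
    using vCauchyD(2)[OF v, of "e/2"] e by auto
  have "vdist V (vplus V (u i) (v i)) (vplus V (u k) (v k)) < e" if ik: "i \<ge> max n1 n2" "k \<ge> max n1 n2" for i k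
  proof -
    have "vdist V (u i) (u k) < e / 2" "vdist V (v i) (v k) < e / 2" using n1 n2 ik by auto
    then show ?thesis
      using dist_plus[OF vCauchyD(1)[OF u, of i] vCauchyD(1)[OF v, of i] vCauchyD(1)[OF u, of k] vCauchyD(1)[OF v, of k]]
      by linarith
  qed
  then show "\<exists>n0. \<forall>i\<ge>n0. \<forall>k\<ge>n0. vdist V (vplus V (u i) (v i)) (vplus V (u k) (v k)) < e" by blast
qed

lemma vCauchy_scale:
  assumes u: "vCauchy V u"
  shows "vCauchy V (\<lambda>n. vscale V c (u n))"
  unfolding vCauchy_def
proof (intro conjI allI impI)
  show "vscale V c (u n) \<in> vcarrier V" for n by (intro scale_closed vCauchyD(1)[OF u])
  fix e :: real assume e: "0 < e"
  obtain n1 where n1: "\<forall>i\<ge>n1. \<forall>k\<ge>n1. vdist V (u i) (u k) < e / (\<bar>c\<bar> + 1)"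
    using vCauchyD(2)[OF u, of "e / (\<bar>c\<bar> + 1)"] e by auto
  have "vdist V (vscale V c (u i)) (vscale V c (u k)) < e" if ik: "i \<ge> n1" "k \<ge> n1" for i k
  proof -
    have "(\<bar>c\<bar> + 1) * vdist V (u i) (u k) < e"
      using n1 ik by (simp add: pos_less_divide_eq mult.commute)
    then show ?thesis
      using dist_scale[OF vCauchyD(1)[OF u, of i] vCauchyD(1)[OF u, of k], of c]
        dist_nonneg[OF vCauchyD(1)[OF u, of i] vCauchyD(1)[OF u, of k]] by (simp add: distrib_right)
  qed
  then show "\<exists>n0. \<forall>i\<ge>n0. \<forall>k\<ge>n0. vdist V (vscale V c (u i)) (vscale V c (u k)) < e" by blast
qed

lemma dist_Cauchy_space: "vdist (Cauchy_space V) u v = lim (\<lambda>n. vdist V (u n) (v n))"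
  by (simp add: vdist_def Cauchy_space_def)

lemma dist_Cauchy_space_tendsto:
  "vCauchy V u \<Longrightarrow> vCauchy V v \<Longrightarrow> (\<lambda>n. vdist V (u n) (v n)) \<longlonglongrightarrow> vdist (Cauchy_space V) u v"
  unfolding dist_Cauchy_space by (metis Cauchy_dist convergent_LIMSEQ_iff)

lemma norm_Cauchy_space_tendsto:
  "vCauchy V u \<Longrightarrow> (\<lambda>n. vnorm V (u n)) \<longlonglongrightarrow> vnorm (Cauchy_space V) u"
  using Cauchy_norm[of u] by (simp add: Cauchy_space_def convergent_LIMSEQ_iff)

lemma Cauchy_space_simps:
  "u \<in> vcarrier (Cauchy_space V) \<longleftrightarrow> vCauchy V u"
  "vplus (Cauchy_space V) u v = (\<lambda>n. vplus V (u n) (v n))"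
  "vscale (Cauchy_space V) c u = (\<lambda>n. vscale V c (u n))"
  by (simp_all add: Cauchy_space_def)

lemma pseudonormed_Cauchy_space: "pseudonormed (Cauchy_space V)"
proof (unfold_locales; unfold Cauchy_space_simps)
  note D = dist_Cauchy_space_tendsto and C = vCauchyD(1)
  fix x y z x' y' c
  show "vCauchy V x \<Longrightarrow> vCauchy V y \<Longrightarrow> vCauchy V (\<lambda>n. vplus V (x n) (y n))" by (rule vCauchy_plus)
  show "vCauchy V x \<Longrightarrow> vCauchy V (\<lambda>n. vscale V c (x n))" by (rule vCauchy_scale)
  show "vCauchy V x \<Longrightarrow> vdist (Cauchy_space V) x x = 0"
    using C by (simp add: dist_Cauchy_space dist_self)
  show "vCauchy V x \<Longrightarrow> vCauchy V y \<Longrightarrow> vdist (Cauchy_space V) x y = vdist (Cauchy_space V) y x"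
    unfolding dist_Cauchy_space using C by (simp add: dist_commute)
  show "vdist (Cauchy_space V) x z \<le> vdist (Cauchy_space V) x y + vdist (Cauchy_space V) y z"
    if "vCauchy V x" "vCauchy V y" "vCauchy V z"
    by (rule LIMSEQ_le[OF D tendsto_add[OF D D]])
      (use that C in \<open>auto intro!: exI[of _ 0] dist_triangle\<close>)
  show "vdist (Cauchy_space V) (\<lambda>n. vplus V (x n) (y n)) (\<lambda>n. vplus V (x' n) (y' n))
      \<le> vdist (Cauchy_space V) x x' + vdist (Cauchy_space V) y y'"
    if "vCauchy V x" "vCauchy V y" "vCauchy V x'" "vCauchy V y'"
    by (rule LIMSEQ_le[OF D tendsto_add[OF D D]])
      (use that C in \<open>auto intro!: exI[of _ 0] dist_plus vCauchy_plus\<close>)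
  show "vdist (Cauchy_space V) (\<lambda>n. vscale V c (x n)) (\<lambda>n. vscale V c (y n)) = \<bar>c\<bar> * vdist (Cauchy_space V) x y"
    if xy: "vCauchy V x" "vCauchy V y"
  proof (rule LIMSEQ_unique[OF D])
    show "(\<lambda>n. vdist V (vscale V c (x n)) (vscale V c (y n))) \<longlonglongrightarrow> \<bar>c\<bar> * vdist (Cauchy_space V) x y"
      using tendsto_mult_left[OF D[OF xy], of "\<bar>c\<bar>"] C xy by (simp add: dist_scale)
  qed (use xy vCauchy_scale in auto)
  show "\<bar>vnorm (Cauchy_space V) x - vnorm (Cauchy_space V) y\<bar> \<le> vdist (Cauchy_space V) x y"
    if xy: "vCauchy V x" "vCauchy V y"
  proof (rule LIMSEQ_le[OF tendsto_rabs[OF tendsto_diff[OF norm_Cauchy_space_tendsto norm_Cauchy_space_tendsto]] D])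
  qed (use xy C in \<open>auto intro!: exI[of _ 0] norm_dist\<close>)
qed

text \<open>An element of the completion is a class of sequences of classes. A representing sequence
  consists of vectors of \<open>V\<close> itself, which bypasses both quotients.\<close>

definition represents :: "(nat \<Rightarrow> 'v) \<Rightarrow> (nat \<Rightarrow> 'v set) set \<Rightarrow> bool" where
  "represents f A \<longleftrightarrow> A \<in> vcarrier (completion (quotient_space V)) \<and> (\<forall>n. f n \<in> vcarrier V) \<and>
     (\<lambda>n. vclass V (f n)) \<in> A"

lemma vCauchy_quotient:
  assumes "\<And>n. f n \<in> vcarrier V"
  shows "vCauchy (quotient_space V) (\<lambda>n. vclass V (f n)) \<longleftrightarrow> vCauchy V f"
  using assms by (auto simp: vCauchy_def quotient_dist quotient_carrier)

lemma represents_iff: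
  "represents f A \<longleftrightarrow> vCauchy V f \<and> A = vclass (Cauchy_space (quotient_space V)) (\<lambda>n. vclass V (f n))"
proof -
  interpret Q: pseudonormed "quotient_space V" by (rule pseudonormed_quotient)
  interpret C: pseudonormed "Cauchy_space (quotient_space V)" by (rule Q.pseudonormed_Cauchy_space)
  let ?u = "\<lambda>n. vclass V (f n)"
  show ?thesis
  proof
    assume r: "represents f A"
    then have f: "\<And>n. f n \<in> vcarrier V" and u: "?u \<in> A" by (auto simp: represents_def)
    obtain w where w: "w \<in> vcarrier (Cauchy_space (quotient_space V))"
      "A = vclass (Cauchy_space (quotient_space V)) w"
      using r by (auto simp: represents_def completion_def C.quotient_carrier)
    have "?u \<in> vcarrier (Cauchy_space (quotient_space V))"
      "vdist (Cauchy_space (quotient_space V)) w ?u = 0"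
      using u by (simp_all add: w(2) C.mem_vclass)
    then show "vCauchy V f \<and> A = vclass (Cauchy_space (quotient_space V)) ?u"
      using w vCauchy_quotient[of f] f by (simp add: C.vclass_eq_iff Q.Cauchy_space_simps)
  next
    assume *: "vCauchy V f \<and> A = vclass (Cauchy_space (quotient_space V)) ?u"
    then have f: "\<And>n. f n \<in> vcarrier V" using vCauchyD(1) by blast
    then have "?u \<in> vcarrier (Cauchy_space (quotient_space V))"
      using * vCauchy_quotient[of f] by (simp add: Q.Cauchy_space_simps)
    then show "represents f A"
      using * f by (simp add: represents_def completion_def C.quotient_carrier C.mem_vclass C.dist_self)
  qed
qed

lemma represents_exists:
  assumes A: "A \<in> vcarrier (completion (quotient_space V))"
  shows "\<exists>f. represents f A"
proof -
  interpret Q: pseudonormed "quotient_space V" by (rule pseudonormed_quotient)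
  interpret C: pseudonormed "Cauchy_space (quotient_space V)" by (rule Q.pseudonormed_Cauchy_space)
  obtain u where u: "vCauchy (quotient_space V) u" "A = vclass (Cauchy_space (quotient_space V)) u"
    using A by (auto simp: completion_def C.quotient_carrier Q.Cauchy_space_simps)
  have "\<exists>x. x \<in> vcarrier V \<and> u n = vclass V x" for n
    using Q.vCauchyD(1)[OF u(1), of n] by (auto simp: quotient_carrier)
  then have "\<exists>f. \<forall>n. f n \<in> vcarrier V \<and> u n = vclass V (f n)" by (intro choice allI)
  then obtain f where f: "\<And>n. f n \<in> vcarrier V" "\<And>n. u n = vclass V (f n)" by blast
  have "u = (\<lambda>n. vclass V (f n))" using f(2) by auto
  then show ?thesis using u vCauchy_quotient[of f] f(1) by (auto simp: represents_iff)
qed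

lemma represents_norm:
  assumes "represents f A"
  shows "(\<lambda>n. vnorm V (f n)) \<longlonglongrightarrow> vnorm (completion (quotient_space V)) A"
proof -
  interpret Q: pseudonormed "quotient_space V" by (rule pseudonormed_quotient)
  interpret C: pseudonormed "Cauchy_space (quotient_space V)" by (rule Q.pseudonormed_Cauchy_space)
  have f: "vCauchy V f" "\<And>n. f n \<in> vcarrier V" using assms represents_iff vCauchyD(1) by blast+
  have u: "vCauchy (quotient_space V) (\<lambda>n. vclass V (f n))" using f by (simp add: vCauchy_quotient)
  have A: "A = vclass (Cauchy_space (quotient_space V)) (\<lambda>n. vclass V (f n))"
    using assms by (simp add: represents_iff)
  show ?thesis
    using Q.norm_Cauchy_space_tendsto[OF u] u
    by (simp add: A completion_def C.quotient_norm Q.Cauchy_space_simps quotient_norm f(2))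
qed

text \<open>Two representing sequences approach each other. Hence a limit along a representing
  sequence does not depend on its choice as soon as the map involved is suitably continuous.\<close>

lemma represents_unique:
  assumes "represents f A" "represents g A"
  shows "(\<lambda>n. vdist V (f n) (g n)) \<longlonglongrightarrow> 0"
proof -
  interpret Q: pseudonormed "quotient_space V" by (rule pseudonormed_quotient)
  interpret C: pseudonormed "Cauchy_space (quotient_space V)" by (rule Q.pseudonormed_Cauchy_space)
  have f: "vCauchy V f" "\<And>n. f n \<in> vcarrier V" using assms represents_iff vCauchyD(1) by blast+
  have g: "vCauchy V g" "\<And>n. g n \<in> vcarrier V" using assms represents_iff vCauchyD(1) by blast+
  have u: "vCauchy (quotient_space V) (\<lambda>n. vclass V (f n))" "vCauchy (quotient_space V) (\<lambda>n. vclass V (g n))"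
    using f g by (simp_all add: vCauchy_quotient)
  have "vdist (Cauchy_space (quotient_space V)) (\<lambda>n. vclass V (f n)) (\<lambda>n. vclass V (g n)) = 0"
    using assms u by (simp add: represents_iff flip: C.vclass_eq_iff add: Q.Cauchy_space_simps)
  then show ?thesis
    using Q.dist_Cauchy_space_tendsto[OF u] by (simp add: quotient_dist f g)
qed

lemma represents_plus:
  assumes "represents f A" "represents g B"
  shows "represents (\<lambda>n. vplus V (f n) (g n)) (vplus (completion (quotient_space V)) A B)"
proof -
  interpret Q: pseudonormed "quotient_space V" by (rule pseudonormed_quotient)
  interpret C: pseudonormed "Cauchy_space (quotient_space V)" by (rule Q.pseudonormed_Cauchy_space)
  have f: "vCauchy V f" "\<And>n. f n \<in> vcarrier V" using assms represents_iff vCauchyD(1) by blast+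
  have g: "vCauchy V g" "\<And>n. g n \<in> vcarrier V" using assms represents_iff vCauchyD(1) by blast+
  have u: "vCauchy (quotient_space V) (\<lambda>n. vclass V (f n))" "vCauchy (quotient_space V) (\<lambda>n. vclass V (g n))"
    using f g by (simp_all add: vCauchy_quotient)
  show ?thesis
    using assms u by (simp add: represents_iff completion_def C.quotient_plus Q.Cauchy_space_simps
        quotient_plus f g vCauchy_plus)
qed

lemma represents_scale:
  assumes "represents f A"
  shows "represents (\<lambda>n. vscale V c (f n)) (vscale (completion (quotient_space V)) c A)"
proof -
  interpret Q: pseudonormed "quotient_space V" by (rule pseudonormed_quotient)
  interpret C: pseudonormed "Cauchy_space (quotient_space V)" by (rule Q.pseudonormed_Cauchy_space)
  have f: "vCauchy V f" "\<And>n. f n \<in> vcarrier V" using assms represents_iff vCauchyD(1) by blast+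
  have u: "vCauchy (quotient_space V) (\<lambda>n. vclass V (f n))" using f by (simp add: vCauchy_quotient)
  show ?thesis
    using assms u by (simp add: represents_iff completion_def C.quotient_scale Q.Cauchy_space_simps
        quotient_scale f vCauchy_scale)
qed

lemma represents_const:
  "x \<in> vcarrier V \<Longrightarrow> represents (\<lambda>_. x) (to_completion (quotient_space V) (vclass V x))"
  by (auto simp: represents_iff to_completion_def vCauchy_def dist_self)

lemma norm_to_completion:
  assumes "x \<in> vcarrier V"
  shows "vnorm (completion (quotient_space V)) (to_completion (quotient_space V) (vclass V x)) = vnorm V x"
  using LIMSEQ_unique[OF represents_norm[OF represents_const[OF assms]] tendsto_const] .

end

section \<open>Extension of multilinear maps to completions\<close>

locale bounded_multilinear_on_pseudonormed =
  fixes V :: "'m::finite \<Rightarrow> 'v seminormed" and T :: "('m \<Rightarrow> 'v) \<Rightarrow> 'y::banach" and C :: real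
  assumes V: "pseudonormed (V j)"
    and norm_nonneg: "u \<in> vcarrier (V j) \<Longrightarrow> 0 \<le> vnorm (V j) u"
    and multilinear: "multilinear_map V T"
    and C: "0 \<le> C"
    and bound: "(\<And>j. x j \<in> vcarrier (V j)) \<Longrightarrow> norm (T x) \<le> C * (\<Prod>j\<in>UNIV. vnorm (V j) (x j))"
begin

lemma T_plus:
  "(\<And>j. x j \<in> vcarrier (V j)) \<Longrightarrow> u \<in> vcarrier (V j) \<Longrightarrow> v \<in> vcarrier (V j) \<Longrightarrow>
    T (x(j := vplus (V j) u v)) = T (x(j := u)) + T (x(j := v))"
  using multilinear unfolding multilinear_map_def by blast

lemma T_scale:
  "(\<And>j. x j \<in> vcarrier (V j)) \<Longrightarrow> u \<in> vcarrier (V j) \<Longrightarrow> T (x(j := vscale (V j) c u)) = c *\<^sub>R T (x(j := u))"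
  using multilinear unfolding multilinear_map_def by blast

text \<open>\<open>vdist\<close> is the norm of \<open>u + (-1) v\<close>, so linearity in slot
  \<open>j\<close> turns the difference into a single value of \<open>T\<close>; the remaining slots
  contribute at most a factor \<open>M\<close> each.\<close>

lemma T_diff_one:
  assumes x: "\<And>j. x j \<in> vcarrier (V j)" and u: "u \<in> vcarrier (V j)" and v: "v \<in> vcarrier (V j)"
    and M: "\<And>i. vnorm (V i) (x i) \<le> M"
  shows "norm (T (x(j := u)) - T (x(j := v))) \<le> C * M ^ card (UNIV - {j}) * vdist (V j) u v"
proof -
  interpret pseudonormed "V j" by (rule V)
  define w where "w = vplus (V j) u (vscale (V j) (-1) v)"
  have w: "w \<in> vcarrier (V j)" using u v by (simp add: w_def plus_closed scale_closed)
  have "T (x(j := u)) - T (x(j := v)) = T (x(j := w))"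
    using T_plus[OF x u scale_closed[OF v, of "-1"]] T_scale[OF x v, of "-1"] by (simp add: w_def)
  moreover have "norm (T (x(j := w))) \<le> C * (\<Prod>i\<in>UNIV. vnorm (V i) ((x(j := w)) i))"
    by (rule bound) (simp add: x w)
  moreover have "(\<Prod>i\<in>UNIV. vnorm (V i) ((x(j := w)) i)) = vdist (V j) u v * (\<Prod>i\<in>UNIV - {j}. vnorm (V i) (x i))"
    by (subst prod.remove[of _ j]) (auto simp: w_def vdist_def intro!: prod.cong)
  moreover have "(\<Prod>i\<in>UNIV - {j}. vnorm (V i) (x i)) \<le> (\<Prod>i\<in>UNIV - {j}. M)"
    by (rule prod_mono) (simp add: norm_nonneg x M)
  moreover have "0 \<le> vdist (V j) u v" using dist_nonneg[OF u v] .
  ultimately show ?thesis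
    using C mult_left_mono[OF mult_left_mono[of "(\<Prod>i\<in>UNIV - {j}. vnorm (V i) (x i))" "\<Prod>i\<in>UNIV - {j}. M" "vdist (V j) u v"] C]
    by (simp add: mult_ac)
qed

text \<open>Telescoping: exchange the coordinates of \<open>x\<close> for those of \<open>y\<close>
  one at a time, by induction on the set \<open>D\<close> of exchanged ones.\<close>

lemma T_diff:
  assumes x: "\<And>j. x j \<in> vcarrier (V j)" and y: "\<And>j. y j \<in> vcarrier (V j)"
    and M: "\<And>i. vnorm (V i) (x i) \<le> M" "\<And>i. vnorm (V i) (y i) \<le> M"
  shows "norm (T x - T y) \<le> (\<Sum>j\<in>UNIV. C * M ^ card (UNIV - {j}) * vdist (V j) (x j) (y j))"
proof -
  define z where "z D = (\<lambda>j. if j \<in> D then y j else x j)" for D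
  have "norm (T x - T (z D)) \<le> (\<Sum>j\<in>D. C * M ^ card (UNIV - {j}) * vdist (V j) (x j) (y j))" for D
    using finite[of D]
  proof (induction D)
    case empty
    then show ?case by (simp add: z_def)
  next
    case (insert a D)
    have zc: "z D j \<in> vcarrier (V j)" "vnorm (V j) (z D j) \<le> M" for j
      by (simp_all add: z_def x y M)
    have eq: "z (insert a D) = (z D)(a := y a)" "z D = (z D)(a := x a)"
      using insert(2) by (auto simp: z_def)
    have "norm (T (z D) - T (z (insert a D))) \<le> C * M ^ card (UNIV - {a}) * vdist (V a) (x a) (y a)"
      using T_diff_one[OF zc(1) x y zc(2), where j = a] eq by simp
    moreover have "norm (T x - T (z (insert a D))) \<le> norm (T x - T (z D)) + norm (T (z D) - T (z (insert a D)))"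
      using norm_triangle_ineq[of "T x - T (z D)" "T (z D) - T (z (insert a D))"] by simp
    ultimately show ?case using insert by simp
  qed
  from this[of UNIV] show ?thesis by (simp add: z_def)
qed

lemma Cauchy_family_bounded:
  assumes f: "\<And>j. vCauchy (V j) (f j)"
  obtains M where "0 \<le> M" "\<And>j n. vnorm (V j) (f j n) \<le> M"
proof -
  have "\<exists>K. \<forall>n. vnorm (V j) (f j n) \<le> K" for j
  proof -
    interpret pseudonormed "V j" by (rule V)
    obtain K where "\<forall>n. norm (vnorm (V j) (f j n)) \<le> K"
      using convergent_imp_Bseq[OF Cauchy_norm[OF f]] by (rule BseqE)
    then show ?thesis by (intro exI[of _ K]) (simp add: abs_le_iff)
  qed
  then have "\<exists>K. \<forall>j n. vnorm (V j) (f j n) \<le> K j" by (intro choice allI)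
  then obtain K where K: "\<And>j n. vnorm (V j) (f j n) \<le> K j" by blast
  have "vnorm (V j) (f j n) \<le> (\<Sum>j\<in>UNIV. \<bar>K j\<bar>)" for j n
    using K[of j n] member_le_sum[of j UNIV "\<lambda>j. \<bar>K j\<bar>"] by simp
  then show thesis using that[of "\<Sum>j\<in>UNIV. \<bar>K j\<bar>"] by (simp add: sum_nonneg)
qed

lemma T_Cauchy:
  assumes f: "\<And>j. vCauchy (V j) (f j)"
  shows "convergent (\<lambda>n. T (\<lambda>j. f j n))"
proof (rule Cauchy_convergent, rule CauchyI)
  fix e :: real assume e: "0 < e"
  obtain M where M: "0 \<le> M" "\<And>j n. vnorm (V j) (f j n) \<le> M" using Cauchy_family_bounded[OF f] by blast
  have fc: "f j n \<in> vcarrier (V j)" for j n using f[of j] by (simp add: vCauchy_def)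
  define K where "K j = C * M ^ card (UNIV - {j})" for j :: 'm
  have K: "0 \<le> K j" for j using M C by (simp add: K_def)
  \<comment> \<open>The summand 1 keeps \<open>S\<close> positive even when all \<open>K j\<close>
    vanish, and makes the final estimate strict.\<close>
  define S where "S = (\<Sum>j\<in>UNIV. K j) + 1"
  have S: "0 < S" using K by (simp add: S_def add_nonneg_pos sum_nonneg)
  have "\<exists>n0. \<forall>i\<ge>n0. \<forall>k\<ge>n0. vdist (V j) (f j i) (f j k) < e / S" for j
    using f[of j] e S by (simp add: vCauchy_def)
  then have "\<exists>n0. \<forall>j. \<forall>i\<ge>n0 j. \<forall>k\<ge>n0 j. vdist (V j) (f j i) (f j k) < e / S" by (intro choice allI)
  then obtain n0 where n0: "\<And>j i k. i \<ge> n0 j \<Longrightarrow> k \<ge> n0 j \<Longrightarrow> vdist (V j) (f j i) (f j k) < e / S"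
    by blast
  define N where "N = Max (range n0)"
  have N: "n0 j \<le> N" for j by (simp add: N_def)
  have "norm (T (\<lambda>j. f j i) - T (\<lambda>j. f j k)) < e" if "i \<ge> N" "k \<ge> N" for i k
  proof -
    have "norm (T (\<lambda>j. f j i) - T (\<lambda>j. f j k)) \<le> (\<Sum>j\<in>UNIV. K j * vdist (V j) (f j i) (f j k))"
      unfolding K_def by (rule T_diff) (use fc M in auto)
    also have "\<dots> \<le> (\<Sum>j\<in>UNIV. K j * (e / S))"
      using K n0 N that by (intro sum_mono mult_left_mono) (meson order_trans less_imp_le)+
    also have "\<dots> = (\<Sum>j\<in>UNIV. K j) * (e / S)" by (rule sum_distrib_right[symmetric])
    also have "\<dots> < S * (e / S)" using e S by (intro mult_strict_right_mono) (auto simp: S_def)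
    finally show ?thesis using S by simp
  qed
  then show "\<exists>M. \<forall>m\<ge>M. \<forall>n\<ge>M. norm (T (\<lambda>j. f j m) - T (\<lambda>j. f j n)) < e" by blast
qed

lemma T_same_limit:
  assumes f: "\<And>j. vCauchy (V j) (f j)" and g: "\<And>j. vCauchy (V j) (g j)"
    and fg: "\<And>j. (\<lambda>n. vdist (V j) (f j n) (g j n)) \<longlonglongrightarrow> 0"
  shows "(\<lambda>n. T (\<lambda>j. f j n) - T (\<lambda>j. g j n)) \<longlonglongrightarrow> 0"
proof -
  obtain M where M: "0 \<le> M" "\<And>j n. vnorm (V j) (f j n) \<le> M" using Cauchy_family_bounded[OF f] by blast
  obtain M' where M': "0 \<le> M'" "\<And>j n. vnorm (V j) (g j n) \<le> M'" using Cauchy_family_bounded[OF g] by blast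
  have fc: "f j n \<in> vcarrier (V j)" "g j n \<in> vcarrier (V j)" for j n
    using f[of j] g[of j] by (simp_all add: vCauchy_def)
  let ?b = "\<lambda>n. \<Sum>j\<in>UNIV. C * (max M M') ^ card (UNIV - {j}) * vdist (V j) (f j n) (g j n)"
  have "(\<lambda>n. C * (max M M') ^ card (UNIV - {j}) * vdist (V j) (f j n) (g j n)) \<longlonglongrightarrow> 0" for j
    using tendsto_mult_left[OF fg[of j], of "C * (max M M') ^ card (UNIV - {j})"] by simp
  then have b: "?b \<longlonglongrightarrow> 0" by (rule tendsto_null_sum)
  have le: "norm (T (\<lambda>j. f j n) - T (\<lambda>j. g j n)) \<le> ?b n" for n
    by (rule T_diff[OF fc]) (simp_all add: le_max_iff_disj M M')
  show ?thesis
    by (rule Lim_null_comparison[OF always_eventually b]) (rule allI, rule le)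
qed

abbreviation W where "W j \<equiv> completion (quotient_space (V j))"
abbreviation rep where "rep j \<equiv> pseudonormed.represents (V j)"

definition extension :: "('m \<Rightarrow> (nat \<Rightarrow> 'v set) set) \<Rightarrow> 'y" where
  "extension A = lim (\<lambda>n. T (\<lambda>j. (SOME f. rep j f (A j)) n))"

text \<open>The definition picks representing sequences by choice, but any other choice gives the
  same limit. Sums, multiples and constants can therefore be computed along sequences adapted to
  them.\<close>

lemma extension_tendsto:
  assumes f: "\<And>j. rep j (f j) (A j)"
  shows "(\<lambda>n. T (\<lambda>j. f j n)) \<longlonglongrightarrow> extension A"
proof -
  define g where "g j = (SOME f. rep j f (A j))" for j
  have g: "rep j (g j) (A j)" for j unfolding g_def by (rule someI[where P = "\<lambda>h. rep j h (A j)", OF f])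
  have c: "vCauchy (V j) (f j)" "vCauchy (V j) (g j)" for j
    using f[of j] g[of j] by (simp_all add: pseudonormed.represents_iff[OF V])
  have "(\<lambda>n. T (\<lambda>j. g j n)) \<longlonglongrightarrow> extension A"
    using T_Cauchy[OF c(2)] by (simp add: extension_def g_def convergent_LIMSEQ_iff)
  from tendsto_add[OF this T_same_limit[OF c(1) c(2) pseudonormed.represents_unique[OF V f g]]]
  show ?thesis by simp
qed

lemma bounded_multilinear_extension: "bounded_multilinear_map W extension"
  unfolding bounded_multilinear_map_def multilinear_map_def
proof (intro conjI allI impI ballI exI[of _ C])
  fix x assume x: "\<forall>j. x j \<in> vcarrier (W j)"
  then have "\<exists>r. \<forall>j. rep j (r j) (x j)"
    by (intro choice allI) (simp add: pseudonormed.represents_exists[OF V])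
  then obtain r where r: "\<And>j. rep j (r j) (x j)" by blast
  have rc: "r j n \<in> vcarrier (V j)" for j n
    using r by (simp add: pseudonormed.represents_def[OF V])
  show "norm (extension x) \<le> C * (\<Prod>j\<in>UNIV. vnorm (W j) (x j))"
  proof (rule LIMSEQ_le)
    show "(\<lambda>n. norm (T (\<lambda>j. r j n))) \<longlonglongrightarrow> norm (extension x)"
      by (intro tendsto_norm extension_tendsto r)
    show "(\<lambda>n. C * (\<Prod>j\<in>UNIV. vnorm (V j) (r j n))) \<longlonglongrightarrow> C * (\<Prod>j\<in>UNIV. vnorm (W j) (x j))"
      by (intro tendsto_mult_left tendsto_prod pseudonormed.represents_norm[OF V] r)
    show "\<exists>N. \<forall>n\<ge>N. norm (T (\<lambda>j. r j n)) \<le> C * (\<Prod>j\<in>UNIV. vnorm (V j) (r j n))"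
      by (intro exI[of _ 0] allI impI bound rc)
  qed
  fix j u v c assume u: "u \<in> vcarrier (W j)" and v: "v \<in> vcarrier (W j)"
  obtain f where f: "rep j f u" using pseudonormed.represents_exists[OF V u] ..
  obtain g where g: "rep j g v" using pseudonormed.represents_exists[OF V v] ..
  have fc: "f n \<in> vcarrier (V j)" "g n \<in> vcarrier (V j)" for n
    using f g by (simp_all add: pseudonormed.represents_def[OF V])
  have lim: "(\<lambda>n. T ((\<lambda>i. r i n)(j := h n))) \<longlonglongrightarrow> extension (x(j := w))" if h: "rep j h w" for h w
  proof -
    have "(\<lambda>n. T (\<lambda>i. (r(j := h)) i n)) \<longlonglongrightarrow> extension (x(j := w))"
      by (rule extension_tendsto) (simp add: r h)
    moreover have "(\<lambda>i. (r(j := h)) i n) = (\<lambda>i. r i n)(j := h n)" for n by auto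
    ultimately show ?thesis by simp
  qed
  show "extension (x(j := vplus (W j) u v)) = extension (x(j := u)) + extension (x(j := v))"
    by (rule LIMSEQ_unique[OF lim[OF pseudonormed.represents_plus[OF V f g]]])
      (use tendsto_add[OF lim[OF f] lim[OF g]] in \<open>simp add: T_plus rc fc\<close>)
  show "extension (x(j := vscale (W j) c u)) = c *\<^sub>R extension (x(j := u))"
    by (rule LIMSEQ_unique[OF lim[OF pseudonormed.represents_scale[OF V f]]])
      (use tendsto_scaleR[OF tendsto_const lim[OF f]] in \<open>simp add: T_scale rc fc\<close>)
qed

lemma extension_to_completion:
  assumes x: "\<And>j. x j \<in> vcarrier (V j)"
  shows "extension (\<lambda>j. to_completion (quotient_space (V j)) (vclass (V j) (x j))) = T x"
  by (rule LIMSEQ_unique[OF extension_tendsto[OF pseudonormed.represents_const[OF V x]]]) simp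

end

section \<open>The positive dual ball of the concavification\<close>

text \<open>Over \<open>a\<close> and \<open>b\<close> the right-hand side of the hypothesis has the
  infimum \<open>(U powr (1/p) + V powr (1/p)) powr p\<close>, approached as \<open>a\<close> tends
  to \<open>U powr (1/p)\<close> and \<open>b\<close> to \<open>V powr (1/p)\<close>. It converts
  the linear form of \<open>powr_abs_add_le\<close> back into a triangle inequality.\<close>

lemma Minkowski_from_convexity:
  fixes p U V W :: real
  assumes p: "1 \<le> p" and U: "0 \<le> U" and V: "0 \<le> V" and W: "0 \<le> W"
    and le: "\<And>a b. 0 < a \<Longrightarrow> 0 < b \<Longrightarrow>
      W \<le> (a + b) powr p * (a / (a + b) / a powr p) * U + (a + b) powr p * (b / (a + b) / b powr p) * V"
  shows "W powr (1 / p) \<le> U powr (1 / p) + V powr (1 / p)"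
proof (rule field_le_epsilon)
  fix e :: real assume e: "0 < e"
  \<comment> \<open>The optimal values, raised by \<open>e / 2\<close> so that they stay positive
    when \<open>U\<close> or \<open>V\<close> is 0.\<close>
  define a b where "a = U powr (1 / p) + e / 2" and "b = V powr (1 / p) + e / 2"
  have ab: "0 < a" "0 < b" using e by (simp_all add: a_def b_def add_nonneg_pos)
  have "(U powr (1 / p)) powr p \<le> a powr p" "(V powr (1 / p)) powr p \<le> b powr p"
    using p e by (intro powr_mono2; simp add: a_def b_def)+
  then have UV: "U \<le> a powr p" "V \<le> b powr p" using p U V by (simp_all add: powr_powr)
  have "a / (a + b) / a powr p * U \<le> a / (a + b) / a powr p * a powr p"
    "b / (a + b) / b powr p * V \<le> b / (a + b) / b powr p * b powr p"
    using ab UV by (intro mult_left_mono; simp)+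
  then have "a / (a + b) / a powr p * U + b / (a + b) / b powr p * V \<le> a / (a + b) + b / (a + b)"
    using ab by simp
  also have "\<dots> = 1" using ab by (simp flip: add_divide_distrib)
  finally have "(a + b) powr p * (a / (a + b) / a powr p * U + b / (a + b) / b powr p * V) \<le> (a + b) powr p * 1"
    by (rule mult_left_mono) simp
  then have "W \<le> (a + b) powr p" using le[OF ab] by (simp add: distrib_left mult.assoc)
  then have "W powr (1 / p) \<le> ((a + b) powr p) powr (1 / p)" using W p by (intro powr_mono2) auto
  also have "\<dots> = a + b" using ab p by (simp add: powr_powr)
  finally show "W powr (1 / p) \<le> U powr (1 / p) + V powr (1 / p) + e" by (simp add: a_def b_def)
qed

text \<open>The fractions \<open>u / (u + v)\<close> and \<open>v / (u + v)\<close> lie in [0, 1],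
  where raising to a power at most 1 does not decrease them, and they add up to 1.\<close>

lemma powr_subadditive:
  fixes u v a :: real
  assumes a: "0 < a" "a \<le> 1" and u: "0 \<le> u" and v: "0 \<le> v"
  shows "(u + v) powr a \<le> u powr a + v powr a"
proof (cases "u + v = 0")
  case False
  then have s: "0 < u + v" using u v by simp
  have *: "w / (u + v) \<le> (w / (u + v)) powr a" if "0 \<le> w" "w \<le> u + v" for w
    using powr_mono'[of a 1 "w / (u + v)"] a s that by simp
  have "1 = u / (u + v) + v / (u + v)" using s by (simp flip: add_divide_distrib)
  also have "\<dots> \<le> (u / (u + v)) powr a + (v / (u + v)) powr a"
    using u v by (intro add_mono *) auto
  also have "\<dots> = (u powr a + v powr a) / (u + v) powr a"
    using u v by (simp add: powr_divide add_divide_distrib)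
  finally show ?thesis using s by (simp add: pos_le_divide_eq)
qed simp

lemma pseudonormed_fun_space:
  assumes X: "fun_subspace X"
    and tri: "\<And>f g. f \<in> X \<Longrightarrow> g \<in> X \<Longrightarrow> n (\<lambda>\<omega>. f \<omega> + g \<omega>) \<le> n f + n g"
    and scale: "\<And>c f. f \<in> X \<Longrightarrow> n (\<lambda>\<omega>. c * f \<omega>) = \<bar>c\<bar> * n f"
  shows "pseudonormed (fun_space X n)"
proof -
  note XD = fun_subspaceD[OF X]
  have simps: "vcarrier (fun_space X n) = X" "vplus (fun_space X n) f g = (\<lambda>\<omega>. f \<omega> + g \<omega>)"
    "vscale (fun_space X n) c f = (\<lambda>\<omega>. c * f \<omega>)" "vnorm (fun_space X n) f = n f" for f g c
    by (simp_all add: fun_space_def)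
  have dist: "vdist (fun_space X n) f g = n (\<lambda>\<omega>. f \<omega> - g \<omega>)" for f g
    by (simp add: vdist_def simps)
  have neg: "n (\<lambda>\<omega>. f \<omega> - g \<omega>) = n (\<lambda>\<omega>. g \<omega> - f \<omega>)" if "f \<in> X" "g \<in> X" for f g
    using scale[OF XD(5)[OF that(2,1)], of "-1"] by simp
  have le: "n f \<le> n g + n (\<lambda>\<omega>. f \<omega> - g \<omega>)" if "f \<in> X" "g \<in> X" for f g
    using tri[OF that(2) XD(5)[OF that]] by simp
  show ?thesis
  proof (unfold_locales; unfold simps dist)
    fix x y z x' y' c
    show "x \<in> X \<Longrightarrow> n (\<lambda>\<omega>. x \<omega> - x \<omega>) = 0"
      using scale[OF XD(1), of 0] by simp
    show "n (\<lambda>\<omega>. x \<omega> - z \<omega>) \<le> n (\<lambda>\<omega>. x \<omega> - y \<omega>) + n (\<lambda>\<omega>. y \<omega> - z \<omega>)" if "x \<in> X" "y \<in> X" "z \<in> X"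
      using tri[OF XD(5)[OF that(1,2)] XD(5)[OF that(2,3)]] by simp
    show "n (\<lambda>\<omega>. x \<omega> + y \<omega> - (x' \<omega> + y' \<omega>)) \<le> n (\<lambda>\<omega>. x \<omega> - x' \<omega>) + n (\<lambda>\<omega>. y \<omega> - y' \<omega>)"
      if "x \<in> X" "y \<in> X" "x' \<in> X" "y' \<in> X"
      using tri[OF XD(5)[OF that(1,3)] XD(5)[OF that(2,4)]] by (simp add: algebra_simps)
    show "n (\<lambda>\<omega>. c * x \<omega> - c * y \<omega>) = \<bar>c\<bar> * n (\<lambda>\<omega>. x \<omega> - y \<omega>)" if "x \<in> X" "y \<in> X"
      using scale[OF XD(5)[OF that], of c] by (simp add: right_diff_distrib)
    show "\<bar>n x - n y\<bar> \<le> n (\<lambda>\<omega>. x \<omega> - y \<omega>)" if "x \<in> X" "y \<in> X"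
      using le[OF that] le[OF that(2,1)] neg[OF that] by linarith
  qed (use XD neg in auto)
qed

lemma closedin_Collect_ball:
  assumes "\<And>i. i \<in> I \<Longrightarrow> closedin S {x \<in> topspace S. P i x}"
  shows "closedin S {x \<in> topspace S. \<forall>i\<in>I. P i x}"
proof (cases "I = {}")
  case False
  then have "{x \<in> topspace S. \<forall>i\<in>I. P i x} = \<Inter> ((\<lambda>i. {x \<in> topspace S. P i x}) ` I)" by auto
  also have "closedin S \<dots>" using assms False by (intro closedin_Inter) auto
  finally show ?thesis .
qed simp

locale convex_function_lattice =
  fixes M :: "'a measure" and X :: "('a \<Rightarrow> real) set" and N :: "('a \<Rightarrow> real) \<Rightarrow> real" and p q :: real
  assumes p: "1 \<le> p" and pq: "p \<le> q"
    and lattice: "banach_function_lattice M X N" and convex: "p_convex1 p X N"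
begin

abbreviation E where "E \<equiv> concav M p X"
abbreviation NE where "NE \<equiv> concav_norm p N"
abbreviation K where "K \<equiv> pos_dual_ball M E NE"
abbreviation B where "B \<equiv> weak_star_pos_dual_ball M E NE"

definition rootp :: "('a \<Rightarrow> real) \<Rightarrow> 'a \<Rightarrow> real" where "rootp f = (\<lambda>\<omega>. \<bar>f \<omega>\<bar> powr (1 / p))"
definition pow :: "('a \<Rightarrow> real) \<Rightarrow> 'a \<Rightarrow> real" where "pow f = (\<lambda>\<omega>. \<bar>f \<omega>\<bar> powr p)"

lemma q: "1 \<le> q" "0 < p" "0 < q" using p pq by auto

lemma X_measurable: "f \<in> X \<Longrightarrow> f \<in> borel_measurable M"
  using lattice unfolding banach_function_lattice_def by blast

lemma X_subspace: "fun_subspace X"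
  using lattice unfolding banach_function_lattice_def fun_subspace_def by simp

lemma N_nonneg: "f \<in> X \<Longrightarrow> 0 \<le> N f"
  using lattice unfolding banach_function_lattice_def by simp

lemma N_scale: "f \<in> X \<Longrightarrow> N (\<lambda>\<omega>. c * f \<omega>) = \<bar>c\<bar> * N f"
  using lattice unfolding banach_function_lattice_def by simp

lemma ideal:
  assumes "f \<in> borel_measurable M" "g \<in> X" "AE \<omega> in M. \<bar>f \<omega>\<bar> \<le> \<bar>g \<omega>\<bar>"
  shows "f \<in> X" "N f \<le> N g"
  using lattice assms unfolding banach_function_lattice_def by simp_all

lemma mem_E: "f \<in> E \<longleftrightarrow> f \<in> borel_measurable M \<and> rootp f \<in> X"
  by (simp add: concav_def rootp_def)

lemma NE_rootp: "NE f = N (rootp f) powr p"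
  by (simp add: concav_norm_def rootp_def)

lemma E_measurable: "f \<in> E \<Longrightarrow> f \<in> borel_measurable M"
  by (simp add: mem_E)

lemma NE_nonneg: "0 \<le> NE f" by (simp add: NE_rootp)

lemma rootp_measurable: "f \<in> borel_measurable M \<Longrightarrow> rootp f \<in> borel_measurable M"
  unfolding rootp_def by measurable

lemma NE_ideal:
  assumes "f \<in> borel_measurable M" "g \<in> E" "AE \<omega> in M. \<bar>f \<omega>\<bar> \<le> \<bar>g \<omega>\<bar>"
  shows "f \<in> E" "NE f \<le> NE g"
proof -
  have "AE \<omega> in M. \<bar>rootp f \<omega>\<bar> \<le> \<bar>rootp g \<omega>\<bar>"
    using assms(3) q by (auto simp: rootp_def intro!: powr_mono2)
  note * = ideal[OF rootp_measurable[OF assms(1)] _ this]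
  show "f \<in> E" using * assms by (simp add: mem_E)
  show "NE f \<le> NE g" unfolding NE_rootp
    using * assms q N_nonneg by (intro powr_mono2) (simp_all add: mem_E)
qed

lemma NE_scale: "f \<in> E \<Longrightarrow> (\<lambda>\<omega>. c * f \<omega>) \<in> E \<and> NE (\<lambda>\<omega>. c * f \<omega>) = \<bar>c\<bar> * NE f"
proof -
  assume f: "f \<in> E"
  have eq: "rootp (\<lambda>\<omega>. c * f \<omega>) = (\<lambda>\<omega>. \<bar>c\<bar> powr (1 / p) * rootp f \<omega>)"
    by (simp add: rootp_def abs_mult powr_mult)
  have "(\<lambda>\<omega>. c * f \<omega>) \<in> borel_measurable M" using E_measurable[OF f] by measurable
  then show ?thesis
    using f q N_nonneg[of "rootp f"] fun_subspaceD(3)[OF X_subspace, of "rootp f" "\<bar>c\<bar> powr (1 / p)"]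
    by (simp add: mem_E NE_rootp eq N_scale powr_mult powr_powr)
qed

lemma rootp_add_le: "rootp (\<lambda>\<omega>. f \<omega> + g \<omega>) \<omega> \<le> (\<bar>f \<omega>\<bar> + \<bar>g \<omega>\<bar>) powr (1 / p)"
  unfolding rootp_def using q by (intro powr_mono2) auto

text \<open>The triangle inequality of the concavification is p-convexity for two functions.
  Membership in \<open>X\<close> has to come first, from the pointwise bound by
  \<open>rootp f + rootp g\<close> and the ideal property.\<close>

lemma E_add:
  assumes f: "f \<in> E" and g: "g \<in> E"
  shows "(\<lambda>\<omega>. f \<omega> + g \<omega>) \<in> E" "NE (\<lambda>\<omega>. f \<omega> + g \<omega>) \<le> NE f + NE g"
proof -
  have m: "(\<lambda>\<omega>. f \<omega> + g \<omega>) \<in> borel_measurable M"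
    using E_measurable[OF f] E_measurable[OF g] by measurable
  have fX: "rootp f \<in> X" "rootp g \<in> X" using f g by (simp_all add: mem_E)
  have s: "(\<bar>f \<omega>\<bar> + \<bar>g \<omega>\<bar>) powr (1 / p) \<le> rootp f \<omega> + rootp g \<omega>" for \<omega>
    unfolding rootp_def using q p by (intro powr_subadditive) auto
  have s': "\<bar>(\<bar>f \<omega>\<bar> + \<bar>g \<omega>\<bar>) powr (1 / p)\<bar> \<le> \<bar>rootp f \<omega> + rootp g \<omega>\<bar>" for \<omega>
    using s[of \<omega>] by simp
  have X1: "(\<lambda>\<omega>. (\<bar>f \<omega>\<bar> + \<bar>g \<omega>\<bar>) powr (1 / p)) \<in> X"
    by (rule ideal(1)[OF _ fun_subspaceD(2)[OF X_subspace fX]]) (use f g s' in \<open>auto simp: mem_E\<close>)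
  have X2: "rootp (\<lambda>\<omega>. f \<omega> + g \<omega>) \<in> X" "N (rootp (\<lambda>\<omega>. f \<omega> + g \<omega>)) \<le> N (\<lambda>\<omega>. (\<bar>f \<omega>\<bar> + \<bar>g \<omega>\<bar>) powr (1 / p))"
    using ideal[OF rootp_measurable[OF m] X1] rootp_add_le[of f g] by (simp_all add: rootp_def)
  show "(\<lambda>\<omega>. f \<omega> + g \<omega>) \<in> E" using m X2 by (simp add: mem_E)
  \<comment> \<open>p-convexity is applied to the two roots, whose p-th powers are
    \<open>\<bar>f\<bar>\<close> and \<open>\<bar>g\<bar>\<close>.\<close>
  define x where "x k = (if k = 0 then rootp f else rootp g)" for k :: nat
  have "\<bar>rootp h \<omega>\<bar> powr p = \<bar>h \<omega>\<bar>" for h \<omega> using q by (simp add: rootp_def powr_powr)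
  then have eq: "(\<lambda>\<omega>. (\<Sum>k<2. \<bar>x k \<omega>\<bar> powr p) powr (1 / p)) = (\<lambda>\<omega>. (\<bar>f \<omega>\<bar> + \<bar>g \<omega>\<bar>) powr (1 / p))"
    by (simp add: x_def numeral_2_eq_2)
  have "\<forall>k<2. x k \<in> X" using fX by (simp add: x_def)
  then have "N (\<lambda>\<omega>. (\<Sum>k<2. \<bar>x k \<omega>\<bar> powr p) powr (1 / p)) \<le> (\<Sum>k<2. N (x k) powr p) powr (1 / p)"
    using convex unfolding p_convex1_def by blast
  then have "N (\<lambda>\<omega>. (\<bar>f \<omega>\<bar> + \<bar>g \<omega>\<bar>) powr (1 / p)) \<le> (NE f + NE g) powr (1 / p)"
    unfolding eq by (simp add: x_def numeral_2_eq_2 NE_rootp)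
  then have "N (rootp (\<lambda>\<omega>. f \<omega> + g \<omega>)) powr p \<le> ((NE f + NE g) powr (1 / p)) powr p"
    using X2 N_nonneg q by (intro powr_mono2) auto
  then show "NE (\<lambda>\<omega>. f \<omega> + g \<omega>) \<le> NE f + NE g"
    using q NE_nonneg by (simp add: NE_rootp[symmetric] powr_powr)
qed

lemma E_subspace: "fun_subspace E"
proof -
  have "rootp (\<lambda>_. 0) = (\<lambda>_. 0)" by (simp add: rootp_def)
  then have "(\<lambda>_. 0) \<in> E" using fun_subspaceD(1)[OF X_subspace] by (simp add: mem_E)
  then show ?thesis unfolding fun_subspace_def using E_add(1) NE_scale by blast
qed

lemma NE_AE_zero:
  assumes "f \<in> E" "AE \<omega> in M. f \<omega> = 0"
  shows "NE f = 0"
proof -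
  have "NE f \<le> NE (\<lambda>_. 0)"
    by (rule NE_ideal(2)) (use assms fun_subspaceD(1)[OF E_subspace] in \<open>auto simp: mem_E\<close>)
  also have "NE (\<lambda>_. 0) = 0" using NE_scale[OF assms(1), of 0] by simp
  finally show ?thesis using NE_nonneg[of f] by simp
qed

lemma pow_mem: "x \<in> X \<Longrightarrow> pow x \<in> E" and NE_pow: "x \<in> X \<Longrightarrow> NE (pow x) = N x powr p"
proof -
  assume x: "x \<in> X"
  have eq: "rootp (pow x) = (\<lambda>\<omega>. \<bar>x \<omega>\<bar>)" using q by (simp add: rootp_def pow_def powr_powr)
  have m: "pow x \<in> borel_measurable M" "(\<lambda>\<omega>. \<bar>x \<omega>\<bar>) \<in> borel_measurable M"
    using X_measurable[OF x] unfolding pow_def by measurable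
  have a: "(\<lambda>\<omega>. \<bar>x \<omega>\<bar>) \<in> X" "N (\<lambda>\<omega>. \<bar>x \<omega>\<bar>) \<le> N x" using ideal[OF m(2) x] by simp_all
  moreover have "N x \<le> N (\<lambda>\<omega>. \<bar>x \<omega>\<bar>)" using ideal(2)[OF X_measurable[OF x] a(1)] by simp
  ultimately show "pow x \<in> E" "NE (pow x) = N x powr p" using m by (simp_all add: mem_E NE_rootp eq)
qed

lemma K_linear: "\<phi> \<in> K \<Longrightarrow> linear_on E \<phi>"
  by (simp add: pos_dual_ball_def linear_on_def)

lemma K_le: "\<phi> \<in> K \<Longrightarrow> f \<in> E \<Longrightarrow> \<phi> f \<le> NE f"
  unfolding pos_dual_ball_def using abs_le_D1 by blast

lemma K_nonneg: "\<phi> \<in> K \<Longrightarrow> f \<in> E \<Longrightarrow> (\<And>\<omega>. 0 \<le> f \<omega>) \<Longrightarrow> 0 \<le> \<phi> f"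
  unfolding pos_dual_ball_def by simp

lemma K_pow_nonneg: "\<phi> \<in> K \<Longrightarrow> x \<in> X \<Longrightarrow> 0 \<le> \<phi> (pow x)"
  by (rule K_nonneg[OF _ pow_mem]) (simp_all add: pow_def)

lemma K_mono:
  assumes "\<phi> \<in> K" "f \<in> E" "g \<in> E" "\<And>\<omega>. f \<omega> \<le> g \<omega>"
  shows "\<phi> f \<le> \<phi> g"
  using K_nonneg[OF assms(1) fun_subspaceD(5)[OF E_subspace assms(3,2)]] assms(4)
    linear_onD(4)[OF K_linear[OF assms(1)] E_subspace assms(3,2)] by simp

text \<open>Hahn--Banach with the norm of the positive part as sublinear bound. This gives norm
  bound and positivity at once: for \<open>g \<ge> 0\<close> a.e. the positive part of
  \<open>- g\<close> is a.e. zero, so \<open>L\<close> is at most 0 at \<open>- g\<close>. For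
  \<open>f \<ge> 0\<close> the bound at \<open>f\<close> is the norm itself.\<close>

lemma norm_attained:
  assumes f: "f \<in> E" and pos: "\<And>\<omega>. 0 \<le> f \<omega>"
  obtains \<phi> where "\<phi> \<in> K" "\<phi> f = NE f"
proof -
  note ED = fun_subspaceD[OF E_subspace]
  define P where "P g = NE (\<lambda>\<omega>. max (g \<omega>) 0)" for g
  have pp: "(\<lambda>\<omega>. max (g \<omega>) 0) \<in> E" "P g \<le> NE g" if g: "g \<in> E" for g
  proof -
    have "(\<lambda>\<omega>. max (g \<omega>) 0) \<in> borel_measurable M" using E_measurable[OF g] by measurable
    then show "(\<lambda>\<omega>. max (g \<omega>) 0) \<in> E" "P g \<le> NE g"
      using NE_ideal[OF _ g, of "\<lambda>\<omega>. max (g \<omega>) 0"] by (simp_all add: P_def)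
  qed
  have "sublinear_on E P"
    unfolding sublinear_on_def
  proof (intro conjI ballI allI impI)
    fix g h assume g: "g \<in> E" and h: "h \<in> E"
    have "P (\<lambda>\<omega>. g \<omega> + h \<omega>) \<le> NE (\<lambda>\<omega>. max (g \<omega>) 0 + max (h \<omega>) 0)"
      unfolding P_def
      using E_add(1)[OF pp(1)[OF g] pp(1)[OF h]] pp(1)[OF ED(2)[OF g h]]
      by (intro NE_ideal(2) AE_I2) (simp_all add: mem_E)
    also have "\<dots> \<le> P g + P h" unfolding P_def by (rule E_add(2)[OF pp(1)[OF g] pp(1)[OF h]])
    finally show "P (\<lambda>\<omega>. g \<omega> + h \<omega>) \<le> P g + P h" .
  next
    fix c :: real and g assume c: "0 < c" and g: "g \<in> E"
    have "(\<lambda>\<omega>. max (c * g \<omega>) 0) = (\<lambda>\<omega>. c * max (g \<omega>) 0)"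
      using c by (auto simp: max_def zero_le_mult_iff mult_le_0_iff)
    then show "P (\<lambda>\<omega>. c * g \<omega>) = c * P g" using NE_scale[OF pp(1)[OF g], of c] c by (simp add: P_def)
  qed
  then obtain L where L: "linear_on E L" "\<And>g. g \<in> E \<Longrightarrow> L g \<le> P g" "L f = P f"
    using hahn_banach_fun[OF E_subspace _ f] by metis
  note LD = linear_onD[OF L(1)]
  have le: "L g \<le> NE g" if "g \<in> E" for g using L(2)[OF that] pp(2)[OF that] by linarith
  have abs: "\<bar>L g\<bar> \<le> NE g" if g: "g \<in> E" for g
    using le[OF g] le[OF ED(4)[OF g]] LD(3)[OF g] NE_scale[OF g, of "-1"] by (simp add: abs_le_iff)
  have nn: "0 \<le> L g" if g: "g \<in> E" and ae: "AE \<omega> in M. 0 \<le> g \<omega>" for g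
  proof -
    have "P (\<lambda>\<omega>. - g \<omega>) = 0"
      unfolding P_def by (rule NE_AE_zero[OF pp(1)[OF ED(4)[OF g]]]) (use ae in auto)
    then show ?thesis using L(2)[OF ED(4)[OF g]] LD(3)[OF g] by simp
  qed
  have "restrict L E \<in> K"
    unfolding pos_dual_ball_def using abs nn LD(1,2) ED(2,3) by simp
  moreover have "restrict L E f = NE f"
    using L(3) f pos by (simp add: P_def max_absorb1)
  ultimately show thesis by (rule that)
qed

lemma K_nonempty: "K \<noteq> {}"
  using norm_attained[of "\<lambda>_. 0"] fun_subspaceD(1)[OF E_subspace] by auto

lemma topspace_B: "topspace B = K"
  by (auto simp: weak_star_pos_dual_ball_def pos_dual_ball_def PiE_def)

lemma continuous_eval: "f \<in> E \<Longrightarrow> continuous_map B euclideanreal (\<lambda>\<phi>. \<phi> f)"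
  unfolding weak_star_pos_dual_ball_def
  by (intro continuous_map_from_subtopology continuous_map_product_projection)

lemma Hausdorff_B: "Hausdorff_space B"
  unfolding weak_star_pos_dual_ball_def
  by (intro Hausdorff_space_subtopology) (simp add: Hausdorff_space_product_topology)

text \<open>Banach--Alaoglu: \<open>K\<close> lies in a product of compact intervals, and each
  defining condition is a family of closed conditions on finitely many evaluations.\<close>

lemma compact_B: "compact_space B"
proof -
  let ?\<Pi> = "product_topology (\<lambda>_. euclideanreal) E"
  note ED = fun_subspaceD[OF E_subspace]
  have proj: "continuous_map ?\<Pi> euclideanreal (\<lambda>\<phi>. \<phi> f)" if "f \<in> E" for f
    using that by (rule continuous_map_product_projection)
  have cl: "closedin ?\<Pi> {\<phi> \<in> topspace ?\<Pi>. h \<phi> \<in> S}"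
    if "continuous_map ?\<Pi> euclideanreal h" "closed S" for h S
    using closedin_continuous_map_preimage[of ?\<Pi> euclideanreal h S] that closed_closedin by simp
  have "closedin ?\<Pi> {\<phi> \<in> topspace ?\<Pi>. \<forall>f\<in>E. \<forall>g\<in>E. \<phi> (\<lambda>\<omega>. f \<omega> + g \<omega>) - (\<phi> f + \<phi> g) \<in> {0}}"
    by (intro closedin_Collect_ball cl continuous_map_diff continuous_map_add proj ED closed_singleton)
  moreover have "closedin ?\<Pi> {\<phi> \<in> topspace ?\<Pi>. \<forall>c\<in>UNIV. \<forall>f\<in>E. \<phi> (\<lambda>\<omega>. c * f \<omega>) - c * \<phi> f \<in> {0}}"
    by (intro closedin_Collect_ball cl continuous_map_diff continuous_map_real_mult_left proj ED closed_singleton)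
  moreover have "closedin ?\<Pi> {\<phi> \<in> topspace ?\<Pi>. \<forall>f\<in>E. \<phi> f \<in> {- NE f..NE f}}"
    by (intro closedin_Collect_ball cl proj closed_atLeastAtMost)
  moreover have "closedin ?\<Pi> {\<phi> \<in> topspace ?\<Pi>. \<forall>f\<in>{f \<in> E. AE \<omega> in M. 0 \<le> f \<omega>}. \<phi> f \<in> {0..}}"
    by (intro closedin_Collect_ball cl proj closed_atLeast) simp
  ultimately have "closedin ?\<Pi> ({\<phi> \<in> topspace ?\<Pi>. \<forall>f\<in>E. \<forall>g\<in>E. \<phi> (\<lambda>\<omega>. f \<omega> + g \<omega>) - (\<phi> f + \<phi> g) \<in> {0}}
      \<inter> {\<phi> \<in> topspace ?\<Pi>. \<forall>c\<in>UNIV. \<forall>f\<in>E. \<phi> (\<lambda>\<omega>. c * f \<omega>) - c * \<phi> f \<in> {0}}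
      \<inter> {\<phi> \<in> topspace ?\<Pi>. \<forall>f\<in>E. \<phi> f \<in> {- NE f..NE f}}
      \<inter> {\<phi> \<in> topspace ?\<Pi>. \<forall>f\<in>{f \<in> E. AE \<omega> in M. 0 \<le> f \<omega>}. \<phi> f \<in> {0..}})"
    by (intro closedin_Int)
  also have "\<dots> = K"
    unfolding pos_dual_ball_def topspace_product_topology topspace_euclidean PiE_UNIV_domain
    by (simp add: set_eq_iff PiE_def abs_le_iff minus_le_iff) blast
  finally have "closedin ?\<Pi> K" .
  moreover have "compactin ?\<Pi> (\<Pi>\<^sub>E f\<in>E. {- NE f..NE f})"
    by (simp add: compactin_PiE)
  moreover have "K \<subseteq> (\<Pi>\<^sub>E f\<in>E. {- NE f..NE f})"
    by (auto simp: pos_dual_ball_def PiE_def abs_le_iff minus_le_iff)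
  ultimately have "compactin ?\<Pi> K" by (blast intro: closed_compactin)
  then show ?thesis
    unfolding weak_star_pos_dual_ball_def by (simp add: compact_space_subtopology)
qed

end

section \<open>The strong norm as a supremum over the dual ball\<close>

context convex_function_lattice
begin

text \<open>The integrand of the q-th power of \<open>pq_seminorm\<close>, as a function on the dual
  ball.\<close>

definition gauge :: "('a \<Rightarrow> real) \<Rightarrow> (('a \<Rightarrow> real) \<Rightarrow> real) \<Rightarrow> real" where
  "gauge x \<phi> = \<phi> (pow x) powr (q / p)"

definition weighted_norm :: "nat \<Rightarrow> (nat \<Rightarrow> 'a \<Rightarrow> real) \<Rightarrow> (nat \<Rightarrow> real) \<Rightarrow> real" where
  "weighted_norm n x \<beta> = N (\<lambda>\<omega>. (\<Sum>k<n. \<bar>\<beta> k * x k \<omega>\<bar> powr p) powr (1 / p))"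

definition strong_norm :: "nat \<Rightarrow> (nat \<Rightarrow> 'a \<Rightarrow> real) \<Rightarrow> real" where
  "strong_norm n x = (SUP \<beta>\<in>{\<beta>. ell_norm (r_exponent p q) n \<beta> \<le> 1}. weighted_norm n x \<beta>)"

lemma gauge_nonneg: "0 \<le> gauge x \<phi>" by (simp add: gauge_def)

lemma gauge_le: "\<phi> \<in> K \<Longrightarrow> x \<in> X \<Longrightarrow> gauge x \<phi> \<le> N x powr q"
proof -
  assume a: "\<phi> \<in> K" "x \<in> X"
  have "gauge x \<phi> \<le> (N x powr p) powr (q / p)"
    unfolding gauge_def using K_le[OF a(1) pow_mem[OF a(2)]] K_pow_nonneg[OF a] NE_pow[OF a(2)] q
    by (intro powr_mono2) auto
  also have "\<dots> = N x powr q" using q by (simp add: powr_powr)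
  finally show ?thesis .
qed

lemma pow_scale: "pow (\<lambda>\<omega>. c * x \<omega>) = (\<lambda>\<omega>. \<bar>c\<bar> powr p * pow x \<omega>)"
  by (simp add: pow_def abs_mult powr_mult)

lemma gauge_scale:
  assumes "\<phi> \<in> K" "x \<in> X"
  shows "gauge (\<lambda>\<omega>. c * x \<omega>) \<phi> = \<bar>c\<bar> powr q * gauge x \<phi>"
  using linear_onD(2)[OF K_linear[OF assms(1)] pow_mem[OF assms(2)]] K_pow_nonneg[OF assms] q
  by (simp add: gauge_def pow_scale powr_mult powr_powr)

lemma continuous_gauge:
  assumes x: "x \<in> X"
  shows "continuous_map B euclideanreal (gauge x)"
proof -
  \<comment> \<open>Truncating at 0 makes the power continuous on the whole line; on
    \<open>K\<close> the value \<open>\<phi> (pow x)\<close> is nonnegative, so the composition is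
    still the gauge.\<close>
  have "continuous_on UNIV (\<lambda>t::real. max t 0 powr (q / p))"
    using q by (intro continuous_on_powr' continuous_intros) auto
  then have "continuous_map B euclideanreal ((\<lambda>t. max t 0 powr (q / p)) \<circ> (\<lambda>\<phi>. \<phi> (pow x)))"
    by (intro continuous_map_compose[OF continuous_eval[OF pow_mem[OF x]]]) simp
  then show ?thesis
    by (rule continuous_map_eq) (simp add: topspace_B gauge_def K_pow_nonneg[OF _ x] max_absorb1)
qed

text \<open>The p-th power removes the root: \<open>weighted_norm\<close> becomes a norm in the
  concavification of a function linear in the numbers \<open>\<bar>\<beta> k\<bar> powr p\<close>,
  on which \<open>\<phi>\<close> acts termwise.\<close>

lemma weighted_norm_eq:
  assumes x: "\<And>k. k < n \<Longrightarrow> x k \<in> X"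
  defines "F \<equiv> \<lambda>\<beta> \<omega>. \<Sum>k<n. \<bar>\<beta> k\<bar> powr p * pow (x k) \<omega>"
  shows "F \<beta> \<in> E" "0 \<le> F \<beta> \<omega>" "weighted_norm n x \<beta> powr p = NE (F \<beta>)" "0 \<le> weighted_norm n x \<beta>"
    "\<phi> \<in> K \<Longrightarrow> \<phi> (F \<beta>) = (\<Sum>k<n. \<bar>\<beta> k\<bar> powr p * \<phi> (pow (x k)))"
proof -
  note ED = fun_subspaceD[OF E_subspace]
  have FE: "(\<lambda>\<omega>. \<bar>\<beta> k\<bar> powr p * pow (x k) \<omega>) \<in> E" if "k \<in> {..<n}" for k
    using ED(3)[OF pow_mem[OF x]] that by simp
  show F: "F \<beta> \<in> E" unfolding F_def by (rule fun_subspace_sum[OF E_subspace FE])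
  show nn: "0 \<le> F \<beta> \<omega>" for \<omega> by (simp add: F_def pow_def sum_nonneg)
  have "rootp (F \<beta>) = (\<lambda>\<omega>. (\<Sum>k<n. \<bar>\<beta> k * x k \<omega>\<bar> powr p) powr (1 / p))"
    using nn unfolding rootp_def by (simp add: F_def pow_def abs_mult powr_mult)
  then have eq: "weighted_norm n x \<beta> = N (rootp (F \<beta>))" by (simp add: weighted_norm_def)
  show "weighted_norm n x \<beta> powr p = NE (F \<beta>)" by (simp add: eq NE_rootp)
  show "0 \<le> weighted_norm n x \<beta>" using F N_nonneg by (simp add: eq mem_E)
  show "\<phi> (F \<beta>) = (\<Sum>k<n. \<bar>\<beta> k\<bar> powr p * \<phi> (pow (x k)))" if \<phi>: "\<phi> \<in> K"
  proof -
    have "\<phi> (F \<beta>) = (\<Sum>k<n. \<phi> (\<lambda>\<omega>. \<bar>\<beta> k\<bar> powr p * pow (x k) \<omega>))"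
      unfolding F_def by (rule linear_on_sum[OF E_subspace K_linear[OF \<phi>] FE])
    then show ?thesis using linear_onD(2)[OF K_linear[OF \<phi>] pow_mem[OF x]] by simp
  qed
qed

text \<open>A functional attaining the norm of the weighted sum converts it into a sum of numbers,
  to which Hoelder's inequality on the ball of \<open>\<beta>\<close> applies.\<close>

lemma weighted_norm_le:
  assumes x: "\<And>k. k < n \<Longrightarrow> x k \<in> X" and \<beta>: "ell_norm (r_exponent p q) n \<beta> \<le> 1"
    and R: "\<And>\<phi>. \<phi> \<in> K \<Longrightarrow> (\<Sum>k<n. gauge (x k) \<phi>) \<le> R"
  shows "weighted_norm n x \<beta> \<le> R powr (1 / q)"
proof -
  note w = weighted_norm_eq[of n x, OF x]
  obtain \<phi> where \<phi>: "\<phi> \<in> K" "\<phi> (\<lambda>\<omega>. \<Sum>k<n. \<bar>\<beta> k\<bar> powr p * pow (x k) \<omega>)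
      = NE (\<lambda>\<omega>. \<Sum>k<n. \<bar>\<beta> k\<bar> powr p * pow (x k) \<omega>)"
    by (rule norm_attained[OF w(1)[of \<beta>] w(2)[of \<beta>]])
  have "weighted_norm n x \<beta> powr p = (\<Sum>k<n. \<bar>\<beta> k\<bar> powr p * \<phi> (pow (x k)))"
    using w(5)[OF _ \<phi>(1), of \<beta>] \<phi>(2) w(3)[of \<beta>] by simp
  also have "\<dots> \<le> (\<Sum>k<n. \<phi> (pow (x k)) powr (q / p)) powr (p / q)"
    using K_pow_nonneg[OF \<phi>(1) x] by (intro ell_ball_Holder p pq \<beta>)
  also have "\<dots> \<le> R powr (p / q)"
    using R[OF \<phi>(1)] q by (intro powr_mono2) (auto simp: gauge_def intro!: sum_nonneg)
  finally have "(weighted_norm n x \<beta> powr p) powr (1 / p) \<le> (R powr (p / q)) powr (1 / p)"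
    using q by (intro powr_mono2) auto
  then show ?thesis using q w(4)[of \<beta>] by (simp add: powr_powr)
qed

lemma ball_nonempty: "{\<beta>. ell_norm (r_exponent p q) n \<beta> \<le> 1} \<noteq> {}"
  using ell_ball_Holder_extremal[OF p pq, of n "\<lambda>_. 0"] by auto

lemma gauge_sum_bound:
  assumes x: "\<And>k. k < n \<Longrightarrow> x k \<in> X" and "\<phi> \<in> K"
  shows "(\<Sum>k<n. gauge (x k) \<phi>) \<le> (\<Sum>k<n. N (x k) powr q)"
  using assms by (intro sum_mono gauge_le) auto

lemma strong_norm_le:
  assumes x: "\<And>k. k < n \<Longrightarrow> x k \<in> X"
    and R: "\<And>\<phi>. \<phi> \<in> K \<Longrightarrow> (\<Sum>k<n. gauge (x k) \<phi>) \<le> R"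
  shows "strong_norm n x \<le> R powr (1 / q)"
  unfolding strong_norm_def using weighted_norm_le[OF x _ R]
  by (intro cSUP_least ball_nonempty) auto

lemma weighted_norm_le_strong_norm:
  assumes x: "\<And>k. k < n \<Longrightarrow> x k \<in> X" and \<beta>: "ell_norm (r_exponent p q) n \<beta> \<le> 1"
  shows "weighted_norm n x \<beta> \<le> strong_norm n x"
proof -
  have "bdd_above (weighted_norm n x ` {\<beta>. ell_norm (r_exponent p q) n \<beta> \<le> 1})"
    using weighted_norm_le[OF x _ gauge_sum_bound[OF x]] by (intro bdd_aboveI2) auto
  then show ?thesis unfolding strong_norm_def using \<beta> by (intro cSUP_upper) auto
qed

lemma strong_norm_nonneg:
  assumes x: "\<And>k. k < n \<Longrightarrow> x k \<in> X"
  shows "0 \<le> strong_norm n x"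
proof -
  obtain \<beta> where \<beta>: "ell_norm (r_exponent p q) n \<beta> \<le> 1" using ball_nonempty by blast
  show ?thesis
    by (rule order_trans[OF weighted_norm_eq(4)[of n x \<beta>, OF x] weighted_norm_le_strong_norm[OF x \<beta>]])
qed

text \<open>The converse of \<open>strong_norm_le\<close>: here \<open>\<phi>\<close> is given, and
  \<open>\<beta>\<close> is chosen extremal for the numbers
  \<open>\<phi> (pow (x k))\<close>.\<close>

lemma gauge_sum_le_strong_norm:
  assumes x: "\<And>k. k < n \<Longrightarrow> x k \<in> X" and \<phi>: "\<phi> \<in> K"
  shows "(\<Sum>k<n. gauge (x k) \<phi>) \<le> strong_norm n x powr q"
proof -
  note w = weighted_norm_eq[of n x, OF x]
  obtain \<beta> where \<beta>: "ell_norm (r_exponent p q) n \<beta> \<le> 1"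
    "(\<Sum>k<n. \<bar>\<beta> k\<bar> powr p * \<phi> (pow (x k))) = (\<Sum>k<n. \<phi> (pow (x k)) powr (q / p)) powr (p / q)"
    using ell_ball_Holder_extremal[OF p pq, of n "\<lambda>k. \<phi> (pow (x k))"] K_pow_nonneg[OF \<phi> x] by blast
  have "(\<Sum>k<n. gauge (x k) \<phi>) powr (p / q) = \<phi> (\<lambda>\<omega>. \<Sum>k<n. \<bar>\<beta> k\<bar> powr p * pow (x k) \<omega>)"
    using \<beta>(2) w(5)[OF _ \<phi>, of \<beta>] by (simp add: gauge_def)
  also have "\<dots> \<le> weighted_norm n x \<beta> powr p"
    using K_le[OF \<phi> w(1), of \<beta>] w(3)[of \<beta>] by simp
  also have "\<dots> \<le> strong_norm n x powr p"
    using weighted_norm_le_strong_norm[OF x \<beta>(1)] w(4)[of \<beta>] q by (intro powr_mono2) auto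
  finally have "((\<Sum>k<n. gauge (x k) \<phi>) powr (p / q)) powr (q / p) \<le> (strong_norm n x powr p) powr (q / p)"
    using q by (intro powr_mono2) auto
  then show ?thesis using q by (simp add: powr_powr sum_nonneg gauge_nonneg)
qed

text \<open>Every \<open>\<phi>\<close> acts like an integral: positivity carries the pointwise
  inequality \<open>powr_abs_add_le\<close> over to \<open>\<phi>\<close>, with exponent
  \<open>p\<close>.\<close>

lemma K_Minkowski:
  assumes \<phi>: "\<phi> \<in> K" and x: "x \<in> X" and y: "y \<in> X"
  shows "\<phi> (pow (\<lambda>\<omega>. x \<omega> + y \<omega>)) powr (1 / p) \<le> \<phi> (pow x) powr (1 / p) + \<phi> (pow y) powr (1 / p)"
proof (rule Minkowski_from_convexity[OF p])
  note XD = fun_subspaceD[OF X_subspace] and ED = fun_subspaceD[OF E_subspace]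
  note lin = linear_onD[OF K_linear[OF \<phi>]]
  fix a b :: real assume ab: "0 < a" "0 < b"
  let ?c = "(a + b) powr p * (a / (a + b) / a powr p)" and ?d = "(a + b) powr p * (b / (a + b) / b powr p)"
  have "\<phi> (pow (\<lambda>\<omega>. x \<omega> + y \<omega>)) \<le> \<phi> (\<lambda>\<omega>. ?c * pow x \<omega> + ?d * pow y \<omega>)"
    by (intro K_mono[OF \<phi> pow_mem[OF XD(2)[OF x y]]] ED(2,3) pow_mem x y)
      (use powr_abs_add_le[OF p ab] in \<open>simp add: pow_def\<close>)
  also have "\<dots> = ?c * \<phi> (pow x) + ?d * \<phi> (pow y)"
    by (simp only: lin(1)[OF ED(3)[OF pow_mem[OF x]] ED(3)[OF pow_mem[OF y]]] lin(2)[OF pow_mem[OF x]]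
        lin(2)[OF pow_mem[OF y]])
  finally show "\<phi> (pow (\<lambda>\<omega>. x \<omega> + y \<omega>)) \<le> ?c * \<phi> (pow x) + ?d * \<phi> (pow y)" .
qed (use K_pow_nonneg[OF \<phi>] x y fun_subspaceD(2)[OF X_subspace x y] in auto)

end

section \<open>The seminorm attached to a measure on the dual ball\<close>

locale convex_function_lattice_measure = convex_function_lattice +
  fixes \<nu> :: "(('a \<Rightarrow> real) \<Rightarrow> real) measure"
  assumes \<nu>: "regular_borel_prob B \<nu>"
begin

sublocale prob_space \<nu> using \<nu> by (simp add: regular_borel_prob_def)

abbreviation sn where "sn \<equiv> pq_seminorm p q \<nu>"

lemma space_\<nu>: "space \<nu> = K"
  using \<nu> topspace_B by (simp add: regular_borel_prob_def)

lemma gauge_integrable: "x \<in> X \<Longrightarrow> integrable \<nu> (gauge x)"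
  using gauge_le gauge_nonneg
  by (intro integrable_const_bound[where B = "N x powr q"] AE_I2
      continuous_map_borel_measurable[OF \<nu> continuous_gauge]) (auto simp: space_\<nu>)

lemma integral_gauge_nonneg: "0 \<le> (LINT \<phi>|\<nu>. gauge x \<phi>)"
  by (simp add: gauge_nonneg)

lemma sn_eq: "sn x = (LINT \<phi>|\<nu>. gauge x \<phi>) powr (1 / q)"
  by (simp add: pq_seminorm_def gauge_def pow_def)

lemma sn_powr: "sn x powr q = (LINT \<phi>|\<nu>. gauge x \<phi>)"
  using q integral_gauge_nonneg[of x] by (simp add: sn_eq powr_powr)

lemma sn_nonneg: "0 \<le> sn x" by (simp add: sn_eq)

lemma sn_scale:
  assumes x: "x \<in> X"
  shows "sn (\<lambda>\<omega>. c * x \<omega>) = \<bar>c\<bar> * sn x"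
proof -
  have "(LINT \<phi>|\<nu>. gauge (\<lambda>\<omega>. c * x \<omega>) \<phi>) = (LINT \<phi>|\<nu>. \<bar>c\<bar> powr q * gauge x \<phi>)"
    using x by (intro Bochner_Integration.integral_cong) (auto simp: space_\<nu> gauge_scale)
  then show ?thesis using q by (simp add: sn_eq powr_mult powr_powr integral_gauge_nonneg)
qed

text \<open>Minkowski's inequality a second time, now for the integral and the exponent
  \<open>q\<close>, applied to the functions \<open>\<phi> (pow x) powr (1 / p)\<close> of
  \<open>\<phi>\<close>, which are subadditive in \<open>x\<close> by
  \<open>K_Minkowski\<close>.\<close>

lemma sn_triangle:
  assumes x: "x \<in> X" and y: "y \<in> X"
  shows "sn (\<lambda>\<omega>. x \<omega> + y \<omega>) \<le> sn x + sn y"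
  unfolding sn_eq
proof (rule Minkowski_from_convexity[OF q(1) integral_gauge_nonneg integral_gauge_nonneg integral_gauge_nonneg])
  fix a b :: real assume ab: "0 < a" "0 < b"
  let ?c = "(a + b) powr q * (a / (a + b) / a powr q)" and ?d = "(a + b) powr q * (b / (a + b) / b powr q)"
  have xy: "(\<lambda>\<omega>. x \<omega> + y \<omega>) \<in> X" using fun_subspaceD(2)[OF X_subspace x y] .
  have le: "gauge (\<lambda>\<omega>. x \<omega> + y \<omega>) \<phi> \<le> ?c * gauge x \<phi> + ?d * gauge y \<phi>" if \<phi>: "\<phi> \<in> K" for \<phi>
  proof -
    have g: "gauge z \<phi> = (\<phi> (pow z) powr (1 / p)) powr q" for z
      by (simp add: gauge_def powr_powr)
    have "gauge (\<lambda>\<omega>. x \<omega> + y \<omega>) \<phi> \<le> \<bar>\<phi> (pow x) powr (1 / p) + \<phi> (pow y) powr (1 / p)\<bar> powr q"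
      unfolding g using K_Minkowski[OF \<phi> x y] q by (intro powr_mono2) auto
    also have "\<dots> \<le> ?c * \<bar>\<phi> (pow x) powr (1 / p)\<bar> powr q + ?d * \<bar>\<phi> (pow y) powr (1 / p)\<bar> powr q"
      by (rule powr_abs_add_le[OF q(1) ab])
    finally show ?thesis by (simp add: g)
  qed
  have "(LINT \<phi>|\<nu>. gauge (\<lambda>\<omega>. x \<omega> + y \<omega>) \<phi>) \<le> (LINT \<phi>|\<nu>. ?c * gauge x \<phi> + ?d * gauge y \<phi>)"
    using le gauge_integrable x y xy
    by (intro integral_mono Bochner_Integration.integrable_add integrable_mult_right) (auto simp: space_\<nu>)
  also have "\<dots> = ?c * (LINT \<phi>|\<nu>. gauge x \<phi>) + ?d * (LINT \<phi>|\<nu>. gauge y \<phi>)"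
    using gauge_integrable x y
    by (subst Bochner_Integration.integral_add) simp_all
  finally show "(LINT \<phi>|\<nu>. gauge (\<lambda>\<omega>. x \<omega> + y \<omega>) \<phi>)
      \<le> ?c * (LINT \<phi>|\<nu>. gauge x \<phi>) + ?d * (LINT \<phi>|\<nu>. gauge y \<phi>)" .
qed

lemma pseudonormed_sn: "pseudonormed (fun_space X sn)"
  by (rule pseudonormed_fun_space[OF X_subspace sn_triangle sn_scale])

text \<open>The bound on the sum of gauges is uniform in \<open>\<phi>\<close>, so averaging over a
  probability measure preserves it.\<close>

lemma sn_sum_le_strong_norm:
  assumes x: "\<And>k. k < n \<Longrightarrow> x k \<in> X"
  shows "(\<Sum>k<n. sn (x k) powr q) \<le> strong_norm n x powr q"
proof -
  have "(\<Sum>k<n. sn (x k) powr q) = (LINT \<phi>|\<nu>. (\<Sum>k<n. gauge (x k) \<phi>))"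
    unfolding sn_powr using gauge_integrable x by (intro Bochner_Integration.integral_sum[symmetric]) auto
  also have "\<dots> \<le> (LINT \<phi>|\<nu>. strong_norm n x powr q)"
    using gauge_sum_le_strong_norm[OF x] gauge_integrable x
    by (intro integral_mono Bochner_Integration.integrable_sum) (auto simp: space_\<nu>)
  finally show ?thesis using prob_space by simp
qed

end

section \<open>Domination and factorization\<close>

locale multilinear_on_lattices =
  fixes M :: "'m::finite \<Rightarrow> 'a measure" and X :: "'m \<Rightarrow> ('a \<Rightarrow> real) set"
    and N :: "'m \<Rightarrow> ('a \<Rightarrow> real) \<Rightarrow> real" and p q :: "'m \<Rightarrow> real"
    and T :: "('m \<Rightarrow> 'a \<Rightarrow> real) \<Rightarrow> 'y::banach"
  assumes lattices: "convex_function_lattice (M j) (X j) (N j) (p j) (q j)"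
    and multilinear: "multilinear_map (\<lambda>j. fun_space (X j) (N j)) T"
begin

abbreviation Ej where "Ej j \<equiv> concav (M j) (p j) (X j)"
abbreviation Kj where "Kj j \<equiv> pos_dual_ball (M j) (Ej j) (concav_norm (p j) (N j))"
abbreviation Bj where "Bj j \<equiv> weak_star_pos_dual_ball (M j) (Ej j) (concav_norm (p j) (N j))"
abbreviation gaugej where "gaugej j \<equiv> convex_function_lattice.gauge (p j) (q j)"
abbreviation strong_normj where "strong_normj j \<equiv> convex_function_lattice.strong_norm (N j) (p j) (q j)"

text \<open>The exponent called q in the theorem. It may be less than 1, so the arguments below work
  with s-th powers and never with a triangle inequality in ell_s.\<close>

definition s :: real where "s = 1 / (\<Sum>j\<in>UNIV. 1 / q j)"
definition \<theta> :: "'m \<Rightarrow> real" where "\<theta> j = s / q j"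

lemma q_pos: "0 < q j"
  using convex_function_lattice.q(3)[OF lattices] .

lemma s_pos: "0 < s"
  unfolding s_def using q_pos by (intro divide_pos_pos sum_pos) auto

lemma \<theta>_pos: "0 < \<theta> j"
  using s_pos q_pos by (simp add: \<theta>_def)

lemma \<theta>_sum: "sum \<theta> UNIV = 1"
proof -
  have "sum \<theta> UNIV = s * (\<Sum>j\<in>UNIV. 1 / q j)" by (simp add: \<theta>_def sum_distrib_left)
  moreover have "(\<Sum>j\<in>UNIV. 1 / q j) \<noteq> 0" using s_pos unfolding s_def by force
  ultimately show ?thesis by (simp add: s_def)
qed

lemma q_theta: "q j * \<theta> j = s" using q_pos[of j] by (simp add: \<theta>_def)

lemma strongly_concave_iff:
  "strongly_concave p q X N T \<longleftrightarrow>
    (\<exists>C>0. \<forall>n x. (\<forall>j. \<forall>k<n. x j k \<in> X j) \<longrightarrow>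
      (\<Sum>k<n. norm (T (\<lambda>j. x j k)) powr s) powr (1 / s) \<le> C * (\<Prod>j\<in>UNIV. strong_normj j n (x j)))"
  unfolding strongly_concave_def Let_def s_def convex_function_lattice.strong_norm_def[OF lattices]
    convex_function_lattice.weighted_norm_def[OF lattices] ..

lemma T_scale:
  assumes x: "\<And>j. x j \<in> X j"
  shows "T (\<lambda>j \<omega>. a j * x j \<omega>) = (\<Prod>j\<in>UNIV. a j) *\<^sub>R T x"
proof -
  define z where "z D = (\<lambda>j. if j \<in> D then (\<lambda>\<omega>. a j * x j \<omega>) else x j)" for D
  have zX: "z D j \<in> X j" for D j
    using x fun_subspaceD(3)[OF convex_function_lattice.X_subspace[OF lattices], of "x j" j]
    by (simp add: z_def)
  have "T (z D) = (\<Prod>j\<in>D. a j) *\<^sub>R T x" for D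
    using finite[of D]
  proof (induction D)
    case (insert i D)
    have "z (insert i D) = (z D)(i := (\<lambda>\<omega>. a i * x i \<omega>))" "(z D)(i := x i) = z D"
      using insert(2) by (auto simp: z_def)
    moreover have "T ((z D)(i := (\<lambda>\<omega>. a i * x i \<omega>))) = a i *\<^sub>R T ((z D)(i := x i))"
      using multilinear[unfolded multilinear_map_def, THEN spec, of "z D", THEN mp, THEN spec, of i,
          THEN bspec, of "x i", THEN bspec, of "x i", THEN spec, of "a i"] zX x
      by (simp add: fun_space_def)
    ultimately have "T (z (insert i D)) = a i *\<^sub>R T (z D)" by (simp only:)
    then show ?case using insert by (simp only: insert.IH prod.insert scaleR_scaleR not_False_eq_True)
  qed (simp add: z_def)
  from this[of UNIV] show ?thesis by (simp add: z_def)
qed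

text \<open>Since \<open>s = q j * \<theta> j\<close>, the s-th power of each factor is a power
  \<open>\<theta> j\<close> of its \<open>q j\<close>-th power. Hoelder in \<open>k\<close> with
  these weights separates the coordinates, and each sum over \<open>k\<close> is bounded by the
  strong norm.\<close>

lemma strongly_concave_if_dominated:
  assumes \<nu>: "\<And>j. regular_borel_prob (Bj j) (\<nu> j)"
    and dom: "\<And>x. (\<And>j. x j \<in> X j) \<Longrightarrow> norm (T x) \<le> C * (\<Prod>j\<in>UNIV. pq_seminorm (p j) (q j) (\<nu> j) (x j))"
  shows "strongly_concave p q X N T"
  unfolding strongly_concave_iff
\<comment> \<open>Strong concavity asks for a positive constant, while \<open>C\<close> may have any
  sign.\<close>
proof (intro exI[of _ "max C 1"] conjI allI impI)
  show "0 < max C 1" by simp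
  fix n :: nat and x :: "'m \<Rightarrow> nat \<Rightarrow> 'a \<Rightarrow> real"
  assume x: "\<forall>j. \<forall>k<n. x j k \<in> X j"
  let ?C = "max C 1"
  define sn where "sn j = pq_seminorm (p j) (q j) (\<nu> j)" for j
  have lm: "convex_function_lattice_measure (M j) (X j) (N j) (p j) (q j) (\<nu> j)" for j
    by (simp add: convex_function_lattice_measure_def lattices convex_function_lattice_measure_axioms_def \<nu>)
  have sn0: "0 \<le> sn j y" for j y
    unfolding sn_def by (rule convex_function_lattice_measure.sn_nonneg[OF lm])
  have str0: "0 \<le> strong_normj j n (x j)" for j
    using convex_function_lattice.strong_norm_nonneg[OF lattices, of n "x j" j] x by blast
  have sum_sn: "(\<Sum>k<n. sn j (x j k) powr q j) \<le> strong_normj j n (x j) powr q j" for j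
    unfolding sn_def using convex_function_lattice_measure.sn_sum_le_strong_norm[OF lm, of n "x j" j] x by blast
  have "(\<Sum>k<n. norm (T (\<lambda>j. x j k)) powr s) \<le> (\<Sum>k<n. ?C powr s * (\<Prod>j\<in>UNIV. (sn j (x j k) powr q j) powr \<theta> j))"
  proof (rule sum_mono)
    fix k assume k: "k \<in> {..<n}"
    have "norm (T (\<lambda>j. x j k)) \<le> C * (\<Prod>j\<in>UNIV. sn j (x j k))"
      unfolding sn_def by (rule dom) (use x k in auto)
    also have "\<dots> \<le> ?C * (\<Prod>j\<in>UNIV. sn j (x j k))"
      using sn0 by (intro mult_right_mono prod_nonneg) auto
    finally have "norm (T (\<lambda>j. x j k)) powr s \<le> (?C * (\<Prod>j\<in>UNIV. sn j (x j k))) powr s"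
      using s_pos by (intro powr_mono2) auto
    also have "\<dots> = ?C powr s * (\<Prod>j\<in>UNIV. sn j (x j k) powr s)"
      using sn0 by (simp add: powr_mult prod_nonneg prod_powr_distrib)
    also have "\<dots> = ?C powr s * (\<Prod>j\<in>UNIV. (sn j (x j k) powr q j) powr \<theta> j)"
      by (simp add: powr_powr q_theta)
    finally show "norm (T (\<lambda>j. x j k)) powr s \<le> ?C powr s * (\<Prod>j\<in>UNIV. (sn j (x j k) powr q j) powr \<theta> j)" .
  qed
  also have "\<dots> \<le> ?C powr s * (\<Prod>j\<in>UNIV. (\<Sum>k<n. sn j (x j k) powr q j) powr \<theta> j)"
    unfolding sum_distrib_left[symmetric]
    by (intro mult_left_mono Holder_sum_prod) (simp_all add: \<theta>_pos \<theta>_sum)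
  also have "\<dots> \<le> ?C powr s * (\<Prod>j\<in>UNIV. (strong_normj j n (x j) powr q j) powr \<theta> j)"
    using sum_sn \<theta>_pos by (intro mult_left_mono prod_mono conjI powr_mono2) (auto intro: sum_nonneg less_imp_le)
  also have "\<dots> = (?C * (\<Prod>j\<in>UNIV. strong_normj j n (x j))) powr s"
    using str0 by (simp add: powr_powr q_theta powr_mult prod_nonneg prod_powr_distrib)
  finally have "(\<Sum>k<n. norm (T (\<lambda>j. x j k)) powr s) powr (1 / s)
      \<le> ((?C * (\<Prod>j\<in>UNIV. strong_normj j n (x j))) powr s) powr (1 / s)"
    using s_pos by (intro powr_mono2) (auto intro: sum_nonneg)
  also have "\<dots> = ?C * (\<Prod>j\<in>UNIV. strong_normj j n (x j))"
    using s_pos str0 by (simp add: powr_powr prod_nonneg)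
  finally show "(\<Sum>k<n. norm (T (\<lambda>j. x j k)) powr s) powr (1 / s) \<le> ?C * (\<Prod>j\<in>UNIV. strong_normj j n (x j))" .
qed

text \<open>Nonpositive mean of the defects is the additive form of the desired domination. The
  factor \<open>* 1\<close> exhibits the first term as a multiple of the constant function 1, the
  shape in which the scaling rules for function spaces and for \<open>L\<close> apply.\<close>

definition defect :: "real \<Rightarrow> ('m \<Rightarrow> 'a \<Rightarrow> real) \<Rightarrow> ('m \<Rightarrow> ('a \<Rightarrow> real) \<Rightarrow> real) \<Rightarrow> real" where
  "defect C x \<phi> = norm (T x) powr s * 1 - (\<Sum>j\<in>UNIV. (C powr s * \<theta> j) * gaugej j (x j) (\<phi> j))"

lemma gaugej_bounded:
  assumes "x \<in> X j"
  shows "(\<lambda>\<phi>. gaugej j x (\<phi> j)) \<in> bounded_funs_on {\<phi>. \<forall>j. \<phi> j \<in> Kj j}"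
proof -
  interpret convex_function_lattice "M j" "X j" "N j" "p j" "q j" by (rule lattices)
  show ?thesis
    using gauge_le[OF _ assms] gauge_nonneg
    by (auto simp: bounded_funs_on_def intro!: exI[of _ "N j x powr q j"])
qed

lemma defect_bounded:
  assumes x: "\<And>j. x j \<in> X j"
  shows "defect C x \<in> bounded_funs_on {\<phi>. \<forall>j. \<phi> j \<in> Kj j}"
proof -
  note ED = fun_subspaceD[OF fun_subspace_bounded_funs]
  have one: "(\<lambda>_. 1) \<in> bounded_funs_on {\<phi>. \<forall>j. \<phi> j \<in> Kj j}" by (auto simp: bounded_funs_on_def)
  show ?thesis
    unfolding defect_def[abs_def]
    by (intro ED(3)[OF one] ED(5) fun_subspace_sum[OF fun_subspace_bounded_funs] ED(3)[OF gaugej_bounded[OF x]])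
qed

text \<open>A near-maximum is enough, because \<open>mean_nonpos_on_cone\<close> asks only for
  values up to an arbitrary positive error.\<close>

lemma almost_maximizer:
  fixes G :: "'b \<Rightarrow> real"
  assumes "S \<noteq> {}" "\<And>\<phi>. \<phi> \<in> S \<Longrightarrow> G \<phi> \<le> R" "0 < \<delta>"
  shows "\<exists>\<phi>\<in>S. \<forall>\<psi>\<in>S. G \<psi> \<le> G \<phi> + \<delta>"
proof -
  have bdd: "bdd_above (G ` S)" using assms(2) by (intro bdd_aboveI2)
  have "(SUP \<phi>\<in>S. G \<phi>) - \<delta> < (SUP \<phi>\<in>S. G \<phi>)" using assms(3) by simp
  then obtain \<phi> where \<phi>: "\<phi> \<in> S" "(SUP \<phi>\<in>S. G \<phi>) - \<delta> < G \<phi>"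
    using less_cSUP_iff[OF assms(1) bdd] by blast
  show ?thesis
  proof (intro bexI[OF _ \<phi>(1)] ballI)
    fix \<psi> assume "\<psi> \<in> S"
    then show "G \<psi> \<le> G \<phi> + \<delta>" using cSUP_upper[OF _ bdd, of \<psi>] \<phi>(2) by simp
  qed
qed

text \<open>The weights are absorbed into the vectors by homogeneity, and AM--GM turns the product in the
  definition of strong concavity into a sum, which is what makes the problem convex.\<close>

lemma defect_sum_small:
  fixes n :: nat
  assumes C: "0 < C"
    and sc: "\<And>(n::nat) x. (\<And>j k. k < n \<Longrightarrow> x j k \<in> X j) \<Longrightarrow>
      (\<Sum>k<n. norm (T (\<lambda>j. x j k)) powr s) powr (1 / s) \<le> C * (\<Prod>j\<in>UNIV. strong_normj j n (x j))"
    and w: "\<And>k. k < n \<Longrightarrow> 0 \<le> w k" and x: "\<And>j k. k < n \<Longrightarrow> x k j \<in> X j" and \<epsilon>: "0 < \<epsilon>"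
  shows "\<exists>\<phi>. (\<forall>j. \<phi> j \<in> Kj j) \<and> (\<Sum>k<n. w k * defect C (x k) \<phi>) \<le> \<epsilon>"
proof -
  \<comment> \<open>In slot \<open>j\<close> this power multiplies the gauge by \<open>w k\<close>.
    Over all slots the exponents add up to \<open>1 / s\<close>, so the s-th power of the norm of
    \<open>T\<close> is multiplied by \<open>w k\<close> as well.\<close>
  define y where "y j k = (\<lambda>\<omega>. w k powr (1 / q j) * x k j \<omega>)" for j k
  \<comment> \<open>An error \<open>\<delta>\<close> in each coordinate is averaged with the weights
    \<open>\<theta> j\<close> and multiplied by \<open>C powr s\<close>, which makes it
    \<open>\<epsilon>\<close>.\<close>
  define \<delta> where "\<delta> = \<epsilon> / C powr s"
  have \<delta>: "0 < \<delta>" using C \<epsilon> by (simp add: \<delta>_def)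
  have yX: "y j k \<in> X j" if "k < n" for j k
    unfolding y_def by (rule fun_subspaceD(3)[OF convex_function_lattice.X_subspace[OF lattices] x[OF that]])
  have gy: "gaugej j (y j k) \<phi> = w k * gaugej j (x k j) \<phi>" if "k < n" "\<phi> \<in> Kj j" for j k \<phi>
    using convex_function_lattice.gauge_scale[OF lattices that(2) x[OF that(1)], of "w k powr (1 / q j)"]
      w[OF that(1)] q_pos[of j] by (simp add: y_def powr_powr)
  have Ty: "norm (T (\<lambda>j. y j k)) powr s = w k * norm (T (x k)) powr s" if k: "k < n" for k
  proof -
    have "(\<Prod>j\<in>UNIV. w k powr (1 / q j)) = w k powr (1 / s)"
    proof (cases "w k = 0")
      case False
      then show ?thesis by (simp add: s_def flip: powr_sum)
    qed simp
    then have "T (\<lambda>j. y j k) = w k powr (1 / s) *\<^sub>R T (x k)"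
      unfolding y_def using T_scale[of "x k" "\<lambda>j. w k powr (1 / q j)", OF x[OF k]] by simp
    then show ?thesis using w[OF k] s_pos by (simp add: powr_mult powr_powr)
  qed
  \<comment> \<open>Each strong norm depends on one coordinate only, so the near-maximisers are
    chosen independently and assembled into one point of the product.\<close>
  have "\<exists>\<phi>\<in>Kj j. \<forall>\<psi>\<in>Kj j. (\<Sum>k<n. gaugej j (y j k) \<psi>) \<le> (\<Sum>k<n. gaugej j (y j k) \<phi>) + \<delta>" for j
    using convex_function_lattice.gauge_sum_bound[OF lattices yX]
    by (intro almost_maximizer[OF convex_function_lattice.K_nonempty[OF lattices] _ \<delta>])
  then have "\<exists>\<phi>. \<forall>j. \<phi> j \<in> Kj j \<and>
      (\<forall>\<psi>\<in>Kj j. (\<Sum>k<n. gaugej j (y j k) \<psi>) \<le> (\<Sum>k<n. gaugej j (y j k) (\<phi> j)) + \<delta>)"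
    by (intro choice allI) blast
  then obtain \<phi> where \<phi>: "\<And>j. \<phi> j \<in> Kj j"
    "\<And>j \<psi>. \<psi> \<in> Kj j \<Longrightarrow> (\<Sum>k<n. gaugej j (y j k) \<psi>) \<le> (\<Sum>k<n. gaugej j (y j k) (\<phi> j)) + \<delta>"
    by blast
  define R where "R j = (\<Sum>k<n. gaugej j (y j k) (\<phi> j)) + \<delta>" for j
  have R0: "0 \<le> R j" for j
    using \<delta> convex_function_lattice.gauge_nonneg[OF lattices] by (simp add: R_def add_nonneg_nonneg sum_nonneg)
  have str: "strong_normj j n (y j) \<le> R j powr (1 / q j)" for j
    using convex_function_lattice.strong_norm_le[OF lattices yX] \<phi>(2) by (simp add: R_def)
  have str0: "0 \<le> strong_normj j n (y j)" for j
    using convex_function_lattice.strong_norm_nonneg[OF lattices yX] .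
  have "((\<Sum>k<n. norm (T (\<lambda>j. y j k)) powr s) powr (1 / s)) powr s
      \<le> (C * (\<Prod>j\<in>UNIV. strong_normj j n (y j))) powr s"
    using s_pos by (intro powr_mono2 sc yX) auto
  then have "(\<Sum>k<n. norm (T (\<lambda>j. y j k)) powr s) \<le> (C * (\<Prod>j\<in>UNIV. strong_normj j n (y j))) powr s"
    using s_pos by (simp add: powr_powr sum_nonneg)
  also have "\<dots> \<le> (C * (\<Prod>j\<in>UNIV. R j powr (1 / q j))) powr s"
    using str str0 C s_pos by (intro powr_mono2 mult_left_mono prod_mono) (auto intro!: mult_nonneg_nonneg prod_nonneg)
  also have "\<dots> = C powr s * (\<Prod>j\<in>UNIV. R j powr \<theta> j)"
    using C by (simp add: powr_mult prod_nonneg prod_powr_distrib powr_powr \<theta>_def)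
  also have "\<dots> \<le> C powr s * (\<Sum>j\<in>UNIV. \<theta> j * R j)"
    using R0 \<theta>_pos \<theta>_sum by (intro mult_left_mono weighted_arith_geo_mean) (auto intro: less_imp_le)
  also have "\<dots> = C powr s * (\<Sum>j\<in>UNIV. \<theta> j * (\<Sum>k<n. gaugej j (y j k) (\<phi> j))) + \<epsilon>"
  proof -
    have "(\<Sum>j\<in>UNIV. \<theta> j * R j) = (\<Sum>j\<in>UNIV. \<theta> j * (\<Sum>k<n. gaugej j (y j k) (\<phi> j))) + \<delta>"
      using \<theta>_sum by (simp add: R_def distrib_left sum.distrib flip: sum_distrib_right)
    then show ?thesis using C by (simp add: \<delta>_def distrib_left)
  qed
  finally have *: "(\<Sum>k<n. w k * norm (T (x k)) powr s)
      \<le> C powr s * (\<Sum>j\<in>UNIV. \<theta> j * (\<Sum>k<n. w k * gaugej j (x k j) (\<phi> j))) + \<epsilon>"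
    using \<phi>(1) by (simp add: Ty gy)
  have "(\<Sum>k<n. w k * defect C (x k) \<phi>) = (\<Sum>k<n. w k * norm (T (x k)) powr s)
      - C powr s * (\<Sum>j\<in>UNIV. \<theta> j * (\<Sum>k<n. w k * gaugej j (x k j) (\<phi> j)))"
    unfolding defect_def right_diff_distrib sum_subtractf sum_distrib_left
    by (subst (2) sum.swap) (simp add: mult_ac)
  then show ?thesis using * \<phi>(1) by (intro exI[of _ \<phi>]) simp
qed

text \<open>The cone consists of the nonnegative combinations of defects;
  \<open>defect_sum_small\<close> says that none of them is bounded below by a positive
  constant.\<close>

lemma exists_mean:
  assumes C: "0 < C"
    and sc: "\<And>(n::nat) x. (\<And>j k. k < n \<Longrightarrow> x j k \<in> X j) \<Longrightarrow>
      (\<Sum>k<n. norm (T (\<lambda>j. x j k)) powr s) powr (1 / s) \<le> C * (\<Prod>j\<in>UNIV. strong_normj j n (x j))"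
  obtains L where "mean_on {\<phi>. \<forall>j. \<phi> j \<in> Kj j} L"
    "\<And>x. (\<And>j. x j \<in> X j) \<Longrightarrow> L (defect C x) \<le> 0"
proof -
  let ?\<Omega> = "{\<phi>. \<forall>j. \<phi> j \<in> Kj j}"
  \<comment> \<open>With lists of weighted tuples, addition of combinations is concatenation and the
    zero function is the empty list.\<close>
  define comb where "comb xs = (\<lambda>\<phi>. \<Sum>(w, x)\<leftarrow>xs. w * defect C x \<phi>)" for xs
  define dom :: "(real \<times> ('m \<Rightarrow> 'a \<Rightarrow> real)) set" where "dom = {(w, x). 0 \<le> w \<and> (\<forall>j. x j \<in> X j)}"
  note fs = fun_subspace_bounded_funs[of ?\<Omega>]
  have bdd: "comb xs \<in> bounded_funs_on ?\<Omega>" if "set xs \<subseteq> dom" for xs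
    using that
  proof (induction xs)
    case Nil
    then show ?case by (simp add: comb_def fun_subspaceD(1)[OF fs])
  next
    case (Cons a xs)
    obtain w x where a: "a = (w, x)" "\<forall>j. x j \<in> X j" using Cons by (cases a) (auto simp: dom_def)
    have "comb (a # xs) = (\<lambda>\<phi>. w * defect C x \<phi> + comb xs \<phi>)" by (simp add: comb_def a)
    then show ?case
      using Cons a fun_subspaceD(2)[OF fs fun_subspaceD(3)[OF fs defect_bounded[of x C]]] by simp
  qed
  obtain L where L: "mean_on ?\<Omega> L" "\<And>h. h \<in> comb ` {xs. set xs \<subseteq> dom} \<Longrightarrow> L h \<le> 0"
  proof (rule mean_nonpos_on_cone[of "comb ` {xs. set xs \<subseteq> dom}" ?\<Omega>])
    show "comb ` {xs. set xs \<subseteq> dom} \<subseteq> bounded_funs_on ?\<Omega>" using bdd by auto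
    show "(\<lambda>_. 0) \<in> comb ` {xs. set xs \<subseteq> dom}" by (rule image_eqI[of _ _ "[]"]) (auto simp: comb_def)
  next
    fix f g assume "f \<in> comb ` {xs. set xs \<subseteq> dom}" "g \<in> comb ` {xs. set xs \<subseteq> dom}"
    then obtain xs ys where "f = comb xs" "g = comb ys" "set xs \<subseteq> dom" "set ys \<subseteq> dom" by auto
    then show "(\<lambda>x. f x + g x) \<in> comb ` {xs. set xs \<subseteq> dom}"
      by (intro image_eqI[of _ _ "xs @ ys"]) (auto simp: comb_def)
  next
    fix c :: real and f assume c: "0 < c" and "f \<in> comb ` {xs. set xs \<subseteq> dom}"
    then obtain xs where xs: "f = comb xs" "set xs \<subseteq> dom" by auto
    have "(\<lambda>x. c * f x) = comb (map (\<lambda>(w, x). (c * w, x)) xs)"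
      by (simp add: xs(1) comb_def sum_list_const_mult[symmetric] case_prod_unfold comp_def mult.assoc)
    moreover have "set (map (\<lambda>(w, x). (c * w, x)) xs) \<subseteq> dom" using xs(2) c by (auto simp: dom_def)
    ultimately show "(\<lambda>x. c * f x) \<in> comb ` {xs. set xs \<subseteq> dom}" by blast
  next
    fix h and \<epsilon> :: real assume "h \<in> comb ` {xs. set xs \<subseteq> dom}" and \<epsilon>: "0 < \<epsilon>"
    then obtain xs where xs: "h = comb xs" "set xs \<subseteq> dom" by auto
    have nth: "0 \<le> fst (xs ! k)" "snd (xs ! k) j \<in> X j" if "k < length xs" for k j
      using xs(2) nth_mem[OF that] by (auto simp: dom_def case_prod_unfold)
    have "h \<phi> = (\<Sum>k<length xs. fst (xs ! k) * defect C (snd (xs ! k)) \<phi>)" for \<phi>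
      by (simp add: xs(1) comb_def sum_list_sum_nth case_prod_unfold atLeast0LessThan)
    then show "\<exists>\<phi>\<in>?\<Omega>. h \<phi> \<le> \<epsilon>"
      using defect_sum_small[OF C sc, of "length xs" "\<lambda>k. fst (xs ! k)" "\<lambda>k. snd (xs ! k)" \<epsilon>] nth \<epsilon> by auto
  next
    fix L assume "mean_on ?\<Omega> L" "\<And>h. h \<in> comb ` {xs. set xs \<subseteq> dom} \<Longrightarrow> L h \<le> 0"
    then show thesis by (rule that)
  qed
  have "L (defect C x) \<le> 0" if "\<And>j. x j \<in> X j" for x
  proof -
    have "defect C x = comb [(1, x)]" by (simp add: comb_def)
    then show ?thesis using that by (intro L(2) image_eqI[of _ _ "[(1, x)]"]) (auto simp: dom_def)
  qed
  with L(1) show thesis by (rule that)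
qed

text \<open>The mean bounds the s-th power of the norm of \<open>T x\<close> by a weighted sum. At
  arguments with all seminorms at most 1 that sum is at most \<open>C powr s\<close>, and
  multilinearity rescales this to the product.\<close>

lemma dominated_if_strongly_concave:
  assumes "strongly_concave p q X N T"
  obtains \<nu> C where "\<And>j. regular_borel_prob (Bj j) (\<nu> j)" "0 < C"
    "\<And>x. (\<And>j. x j \<in> X j) \<Longrightarrow> norm (T x) \<le> C * (\<Prod>j\<in>UNIV. pq_seminorm (p j) (q j) (\<nu> j) (x j))"
proof -
  let ?\<Omega> = "{\<phi>. \<forall>j. \<phi> j \<in> Kj j}"
  obtain C where C: "0 < C" and sc: "\<And>(n::nat) x. (\<And>j k. k < n \<Longrightarrow> x j k \<in> X j) \<Longrightarrow>
      (\<Sum>k<n. norm (T (\<lambda>j. x j k)) powr s) powr (1 / s) \<le> C * (\<Prod>j\<in>UNIV. strong_normj j n (x j))"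
    using assms unfolding strongly_concave_iff by blast
  obtain L where L: "mean_on ?\<Omega> L" "\<And>x. (\<And>j. x j \<in> X j) \<Longrightarrow> L (defect C x) \<le> 0"
    using exists_mean[OF C sc] by blast
  have lin: "linear_on (bounded_funs_on ?\<Omega>) L" using L(1) by (simp add: mean_on_def)
  \<comment> \<open>The marginal of the mean in coordinate \<open>j\<close>, that is, its image
    under evaluation at \<open>j\<close>.\<close>
  have "\<exists>\<nu>. regular_borel_prob (Bj j) \<nu> \<and>
      (\<forall>x\<in>X j. L (\<lambda>\<phi>. gaugej j x (\<phi> j)) \<le> (LINT \<psi>|\<nu>. gaugej j x \<psi>))" for j
  proof -
    interpret convex_function_lattice "M j" "X j" "N j" "p j" "q j" by (rule lattices)
    obtain \<nu> where \<nu>: "regular_borel_prob (Bj j) \<nu>"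
      "\<And>g R. continuous_map (Bj j) euclideanreal g \<Longrightarrow>
        (\<And>\<psi>. \<psi> \<in> topspace (Bj j) \<Longrightarrow> 0 \<le> g \<psi> \<and> g \<psi> \<le> R) \<Longrightarrow> L (\<lambda>\<phi>. g (\<phi> j)) \<le> (LINT \<psi>|\<nu>. g \<psi>)"
      by (rule mean_dominated_by_radon[OF compact_B Hausdorff_B L(1), of "\<lambda>\<phi>. \<phi> j"])
        (auto simp: topspace_B)
    have "L (\<lambda>\<phi>. gauge x (\<phi> j)) \<le> (LINT \<psi>|\<nu>. gauge x \<psi>)" if "x \<in> X j" for x
      by (rule \<nu>(2)[OF continuous_gauge[OF that], of "N j x powr q j"])
        (simp add: topspace_B gauge_le that gauge_nonneg)
    with \<nu>(1) show ?thesis by blast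
  qed
  then have "\<exists>\<nu>. \<forall>j. regular_borel_prob (Bj j) (\<nu> j) \<and>
      (\<forall>x\<in>X j. L (\<lambda>\<phi>. gaugej j x (\<phi> j)) \<le> (LINT \<psi>|\<nu> j. gaugej j x \<psi>))"
    by (intro choice allI)
  then obtain \<nu> where \<nu>: "\<And>j. regular_borel_prob (Bj j) (\<nu> j)"
    "\<And>j x. x \<in> X j \<Longrightarrow> L (\<lambda>\<phi>. gaugej j x (\<phi> j)) \<le> (LINT \<psi>|\<nu> j. gaugej j x \<psi>)"
    by blast
  have lm: "convex_function_lattice_measure (M j) (X j) (N j) (p j) (q j) (\<nu> j)" for j
    by (simp add: convex_function_lattice_measure_def lattices convex_function_lattice_measure_axioms_def \<nu>)
  define sn where "sn j = pq_seminorm (p j) (q j) (\<nu> j)" for j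
  have sn0: "0 \<le> sn j y" for j y
    unfolding sn_def by (rule convex_function_lattice_measure.sn_nonneg[OF lm])
  have sn_scale: "y \<in> X j \<Longrightarrow> sn j (\<lambda>\<omega>. c * y \<omega>) = \<bar>c\<bar> * sn j y" for j y c
    unfolding sn_def by (rule convex_function_lattice_measure.sn_scale[OF lm])
  have sum_bound: "norm (T x) powr s \<le> C powr s * (\<Sum>j\<in>UNIV. \<theta> j * sn j (x j) powr q j)"
    if x: "\<And>j. x j \<in> X j" for x
  proof -
    note ED = fun_subspaceD[OF fun_subspace_bounded_funs[of ?\<Omega>]]
    note LD = linear_onD[OF lin]
    have one: "(\<lambda>_. 1) \<in> bounded_funs_on ?\<Omega>" by (auto simp: bounded_funs_on_def)
    note g = gaugej_bounded[OF x]
    let ?S = "\<lambda>\<phi>. \<Sum>j\<in>UNIV. (C powr s * \<theta> j) * gaugej j (x j) (\<phi> j)"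
    have S: "?S \<in> bounded_funs_on ?\<Omega>"
      by (rule fun_subspace_sum[OF fun_subspace_bounded_funs ED(3)[OF g]])
    have "L (defect C x) = L (\<lambda>\<phi>. norm (T x) powr s * 1) - L ?S"
      unfolding defect_def[abs_def] by (rule LD(4)[OF fun_subspace_bounded_funs ED(3)[OF one] S])
    moreover have "L (\<lambda>\<phi>. norm (T x) powr s * 1) = norm (T x) powr s"
      using LD(2)[OF one, of "norm (T x) powr s"] L(1) by (simp add: mean_on_def)
    moreover have "L ?S = (\<Sum>j\<in>UNIV. (C powr s * \<theta> j) * L (\<lambda>\<phi>. gaugej j (x j) (\<phi> j)))"
      by (simp only: linear_on_sum[OF fun_subspace_bounded_funs lin ED(3)[OF g]] LD(2)[OF g])
    ultimately have "norm (T x) powr s \<le> (\<Sum>j\<in>UNIV. (C powr s * \<theta> j) * L (\<lambda>\<phi>. gaugej j (x j) (\<phi> j)))"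
      using L(2)[OF x] by simp
    also have "\<dots> \<le> (\<Sum>j\<in>UNIV. (C powr s * \<theta> j) * (LINT \<psi>|\<nu> j. gaugej j (x j) \<psi>))"
      using \<theta>_pos \<nu>(2)[OF x] by (intro sum_mono mult_left_mono) (simp_all add: less_imp_le)
    also have "\<dots> = C powr s * (\<Sum>j\<in>UNIV. \<theta> j * sn j (x j) powr q j)"
      by (simp add: sn_def convex_function_lattice_measure.sn_powr[OF lm] sum_distrib_left mult.assoc)
    finally show ?thesis .
  qed
  \<comment> \<open>A seminorm may vanish at a nonzero function, so the normalization divides by the
    seminorm plus \<open>\<epsilon>\<close>; at the end \<open>\<epsilon>\<close> tends to 0 from
    the right.\<close>
  have eps: "norm (T x) \<le> C * (\<Prod>j\<in>UNIV. sn j (x j) + \<epsilon>)" if x: "\<And>j. x j \<in> X j" and \<epsilon>: "0 < \<epsilon>" for x \<epsilon>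
  proof -
    define a where "a j = sn j (x j) + \<epsilon>" for j
    have a: "0 < a j" for j using sn0[of j] \<epsilon> by (simp add: a_def add_nonneg_pos)
    let ?y = "\<lambda>j \<omega>. 1 / a j * x j \<omega>"
    have y: "?y j \<in> X j" for j
      by (rule fun_subspaceD(3)[OF convex_function_lattice.X_subspace[OF lattices] x])
    have "sn j (?y j) \<le> 1" for j
      using sn_scale[OF x, of j "1 / a j"] a[of j] \<epsilon> by (simp add: pos_divide_le_eq) (simp add: a_def)
    then have "sn j (?y j) powr q j \<le> 1" for j
      using q_pos[of j] sn0 by (intro powr_le1) (auto intro: less_imp_le)
    then have "(\<Sum>j\<in>UNIV. \<theta> j * sn j (?y j) powr q j) \<le> (\<Sum>j\<in>UNIV. \<theta> j)"
      using \<theta>_pos by (intro sum_mono mult_left_le) (auto intro: less_imp_le)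
    then have "C powr s * (\<Sum>j\<in>UNIV. \<theta> j * sn j (?y j) powr q j) \<le> C powr s"
      using mult_left_mono[of "\<Sum>j\<in>UNIV. \<theta> j * sn j (?y j) powr q j" 1 "C powr s"] \<theta>_sum by simp
    with sum_bound[OF y] have "norm (T ?y) powr s \<le> C powr s" by linarith
    then have "norm (T ?y) \<le> C"
      using powr_less_mono2[of s C "norm (T ?y)"] s_pos C by (meson less_imp_le not_le)
    moreover have "T ?y = (\<Prod>j\<in>UNIV. 1 / a j) *\<^sub>R T x" by (rule T_scale[OF x])
    moreover have "0 < (\<Prod>j\<in>UNIV. a j)" using a by (simp add: prod_pos)
    ultimately show ?thesis
      using a by (simp add: prod_dividef abs_prod abs_of_pos pos_divide_le_eq a_def[symmetric])
  qed
  have "norm (T x) \<le> C * (\<Prod>j\<in>UNIV. sn j (x j))" if x: "\<And>j. x j \<in> X j" for x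
  proof (rule tendsto_lowerbound)
    show "((\<lambda>\<epsilon>. C * (\<Prod>j\<in>UNIV. sn j (x j) + \<epsilon>)) \<longlongrightarrow> C * (\<Prod>j\<in>UNIV. sn j (x j))) (at_right 0)"
      by (rule tendsto_eq_intros refl | simp)+
    show "\<forall>\<^sub>F \<epsilon> in at_right 0. norm (T x) \<le> C * (\<Prod>j\<in>UNIV. sn j (x j) + \<epsilon>)"
      using eventually_at_right_less[of "0::real"] by eventually_elim (rule eps[OF x])
  qed simp
  then show thesis using that[OF \<nu>(1) C] by (simp add: sn_def)
qed

text \<open>Domination is exactly boundedness of \<open>T\<close> for the seminorms of the measures,
  so \<open>S\<close> is the extension of \<open>T\<close> to the completed quotients.\<close>

lemma factorization_if_dominated:
  assumes \<nu>: "\<And>j. regular_borel_prob (Bj j) (\<nu> j)" and C: "0 < C"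
    and dom: "\<And>x. (\<And>j. x j \<in> X j) \<Longrightarrow> norm (T x) \<le> C * (\<Prod>j\<in>UNIV. pq_seminorm (p j) (q j) (\<nu> j) (x j))"
  shows "\<exists>S. bounded_multilinear_map (\<lambda>j. F_tilde (X j) (p j) (q j) (\<nu> j)) S \<and>
    (\<forall>x. (\<forall>j. x j \<in> X j) \<longrightarrow> T x = S (\<lambda>j. iota (X j) (p j) (q j) (\<nu> j) (x j)))"
proof -
  let ?V = "\<lambda>j. fun_space (X j) (pq_seminorm (p j) (q j) (\<nu> j))"
  have lm: "convex_function_lattice_measure (M j) (X j) (N j) (p j) (q j) (\<nu> j)" for j
    by (simp add: convex_function_lattice_measure_def lattices convex_function_lattice_measure_axioms_def \<nu>)
  have carrier: "vcarrier (?V j) = X j" and norm: "vnorm (?V j) = pq_seminorm (p j) (q j) (\<nu> j)" for j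
    by (simp_all add: fun_space_def)
  interpret bounded_multilinear_on_pseudonormed ?V T C
  proof (rule bounded_multilinear_on_pseudonormed.intro)
    show "pseudonormed (?V j)" for j
      by (rule convex_function_lattice_measure.pseudonormed_sn[OF lm])
    show "0 \<le> vnorm (?V j) u" for j u
      unfolding norm by (rule convex_function_lattice_measure.sn_nonneg[OF lm])
    \<comment> \<open>Multilinearity reads only the carrier and the operations, and these are the
      same for \<open>N j\<close> and for the new seminorm.\<close>
    show "multilinear_map ?V T"
      using multilinear by (simp add: multilinear_map_def fun_space_def)
    show "norm (T x) \<le> C * (\<Prod>j\<in>UNIV. vnorm (?V j) (x j))" if "\<And>j. x j \<in> vcarrier (?V j)" for x
      unfolding norm by (rule dom) (use that carrier in simp)
  qed (use C in simp)
  show ?thesis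
    using bounded_multilinear_extension extension_to_completion
    by (intro exI[of _ extension]) (simp add: F_tilde_def iota_def seminorm_quotient_def carrier)
qed

text \<open>\<open>iota\<close> preserves the seminorm, so the bound on \<open>S\<close> restricts
  to the image of \<open>iota\<close> without loss.\<close>

lemma dominated_if_factorization:
  assumes \<nu>: "\<And>j. regular_borel_prob (Bj j) (\<nu> j)"
    and S: "bounded_multilinear_map (\<lambda>j. F_tilde (X j) (p j) (q j) (\<nu> j)) S"
    and T: "\<And>x. (\<And>j. x j \<in> X j) \<Longrightarrow> T x = S (\<lambda>j. iota (X j) (p j) (q j) (\<nu> j) (x j))"
  shows "\<exists>C. \<forall>x. (\<forall>j. x j \<in> X j) \<longrightarrow> norm (T x) \<le> C * (\<Prod>j\<in>UNIV. pq_seminorm (p j) (q j) (\<nu> j) (x j))"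
proof -
  obtain C where C: "\<And>A. (\<And>j. A j \<in> vcarrier (F_tilde (X j) (p j) (q j) (\<nu> j))) \<Longrightarrow>
      norm (S A) \<le> C * (\<Prod>j\<in>UNIV. vnorm (F_tilde (X j) (p j) (q j) (\<nu> j)) (A j))"
    using S unfolding bounded_multilinear_map_def by blast
  have lm: "convex_function_lattice_measure (M j) (X j) (N j) (p j) (q j) (\<nu> j)" for j
    by (simp add: convex_function_lattice_measure_def lattices convex_function_lattice_measure_axioms_def \<nu>)
  have "iota (X j) (p j) (q j) (\<nu> j) y \<in> vcarrier (F_tilde (X j) (p j) (q j) (\<nu> j))"
    "vnorm (F_tilde (X j) (p j) (q j) (\<nu> j)) (iota (X j) (p j) (q j) (\<nu> j) y) = pq_seminorm (p j) (q j) (\<nu> j) y"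
    if y: "y \<in> X j" for j y
  proof -
    interpret pseudonormed "fun_space (X j) (pq_seminorm (p j) (q j) (\<nu> j))"
      by (rule convex_function_lattice_measure.pseudonormed_sn[OF lm])
    have "y \<in> vcarrier (fun_space (X j) (pq_seminorm (p j) (q j) (\<nu> j)))" using y by (simp add: fun_space_def)
    from represents_const[OF this] norm_to_completion[OF this]
    show "iota (X j) (p j) (q j) (\<nu> j) y \<in> vcarrier (F_tilde (X j) (p j) (q j) (\<nu> j))"
      "vnorm (F_tilde (X j) (p j) (q j) (\<nu> j)) (iota (X j) (p j) (q j) (\<nu> j) y) = pq_seminorm (p j) (q j) (\<nu> j) y"
      by (simp_all add: represents_def F_tilde_def iota_def seminorm_quotient_def) (simp add: fun_space_def)
  qed
  then have "norm (T x) \<le> C * (\<Prod>j\<in>UNIV. pq_seminorm (p j) (q j) (\<nu> j) (x j))" if "\<And>j. x j \<in> X j" for x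
    using C[of "\<lambda>j. iota (X j) (p j) (q j) (\<nu> j) (x j)"] T[OF that] that by simp
  then show ?thesis by blast
qed

end

theorem theorem3p4:
  fixes M :: "'m::finite \<Rightarrow> 'a measure"
    and X :: "'m \<Rightarrow> ('a \<Rightarrow> real) set"
    and N :: "'m \<Rightarrow> ('a \<Rightarrow> real) \<Rightarrow> real"
    and p q :: "'m \<Rightarrow> real"
    and T :: "('m \<Rightarrow> 'a \<Rightarrow> real) \<Rightarrow> 'y::banach"
  assumes "\<And>j. 1 \<le> p j" and "\<And>j. p j \<le> q j"
    and "\<And>j. banach_function_lattice (M j) (X j) (N j)"
    and "\<And>j. p_convex1 (p j) (X j) (N j)"
    and "multilinear_operator M X N T"
  shows "strongly_concave p q X N T \<longleftrightarrow>
    (\<exists>\<nu> S.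
       (\<forall>j. regular_borel_prob
              (weak_star_pos_dual_ball (M j) (concav (M j) (p j) (X j)) (concav_norm (p j) (N j)))
              (\<nu> j)) \<and>
       bounded_multilinear_map (\<lambda>j. F_tilde (X j) (p j) (q j) (\<nu> j)) S \<and>
       (\<forall>x. (\<forall>j. x j \<in> X j) \<longrightarrow> T x = S (\<lambda>j. iota (X j) (p j) (q j) (\<nu> j) (x j))))"
    (is "?lhs \<longleftrightarrow> ?rhs")
proof -
  interpret multilinear_on_lattices M X N p q T
    using assms by (simp add: multilinear_on_lattices_def convex_function_lattice_def multilinear_operator_def)
  show ?thesis
  proof
    assume lhs: ?lhs
    show ?rhs
    proof (rule dominated_if_strongly_concave[OF lhs])
      fix \<nu> C
      assume \<nu>: "\<And>j. regular_borel_prob (Bj j) (\<nu> j)" "0 < C"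
        "\<And>x. (\<And>j. x j \<in> X j) \<Longrightarrow> norm (T x) \<le> C * (\<Prod>j\<in>UNIV. pq_seminorm (p j) (q j) (\<nu> j) (x j))"
      from factorization_if_dominated[OF \<nu>] \<nu>(1) show ?rhs by blast
    qed
  next
    assume ?rhs
    then obtain \<nu> S where \<nu>: "\<And>j. regular_borel_prob (Bj j) (\<nu> j)"
      and S: "bounded_multilinear_map (\<lambda>j. F_tilde (X j) (p j) (q j) (\<nu> j)) S"
        "\<And>x. (\<And>j. x j \<in> X j) \<Longrightarrow> T x = S (\<lambda>j. iota (X j) (p j) (q j) (\<nu> j) (x j))"
      by blast
    from dominated_if_factorization[OF \<nu> S] obtain C where
      "\<And>x. (\<And>j. x j \<in> X j) \<Longrightarrow> norm (T x) \<le> C * (\<Prod>j\<in>UNIV. pq_seminorm (p j) (q j) (\<nu> j) (x j))"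
      by blast
    with \<nu> show ?lhs by (rule strongly_concave_if_dominated)
  qed
qed

end
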